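(* Let $\omega$ be a modulus of continuity such that $\omega_\sharp$ is finite valued. There exist self-adjoint operators $A$, $B$ on a Hilbert space and a real-valued function $f\in\Lambda_{\omega_{\sharp}}(\mathbb{R})$ such that $$\operatorname{rank}(A-B)=1\qquad\text{and}\qquad s_m\big(f(A)-f(B)\big)\ge\omega\big((1+m)^{-1}\big)\quad\text{for all } m\ge0.$$
   Context: A modulus of continuity is a nondecreasing continuous function $\omega:[0,\infty)\to[0,\infty)$ with $\omega(0)=0$, $\omega(x)>0$ for $x>0$, and $\omega(x+y)\le\omega(x)+\omega(y)$ for all $x,y\ge 0$. $\omega_{\sharp}(x):=x\int_x^\infty\frac{\omega(t)}{t^2}\,dt+\int_0^x\frac{\omega(t)}{t}\,dt$ for $x>0$. $\Lambda_{\omega_\sharp}(\mathbb{R})$ is the space of functions $f:\mathbb{R}\to\mathbb{C}$ with $\sup_{x\ne y}\frac{|f(x)-f(y)|}{\omega_\sharp(|x-y|)}<\infty$. For a bounded operator $T$ on a Hilbert space, the singular values are $s_m(T)=\inf\{\Vert T-R\Vert:\operatorname{rank}R\le m\}$, $m\ge0$. $f(A)$, $f(B)$ are given by the functional calculus for self-adjoint operators. *)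

theory Defs
  imports "HOL-Analysis.Analysis" "HOL-Library.Extended_Nat"
begin

section \<open>Moduli of continuity\<close>

text \<open>A modulus of continuity is a function on \<open>[0,\<infinity>)\<close>; its values at negative arguments are
  irrelevant.\<close>

definition modulus_of_continuity :: "(real \<Rightarrow> real) \<Rightarrow> bool" where
  "modulus_of_continuity \<omega> \<longleftrightarrow>
     continuous_on {0..} \<omega> \<and> mono_on {0..} \<omega> \<and> \<omega> 0 = 0 \<and> (\<forall>x>0. \<omega> x > 0) \<and>
     (\<forall>x\<ge>0. \<forall>y\<ge>0. \<omega> (x + y) \<le> \<omega> x + \<omega> y)"

text \<open>Both integrands are nonnegative, so the transform is always defined as an extended
  nonnegative real, and that it is finite valued is a property of \<open>\<omega>\<close>.\<close>

definition omega_sharp :: "(real \<Rightarrow> real) \<Rightarrow> real \<Rightarrow> ennreal" where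
  "omega_sharp \<omega> x =
     ennreal x * (\<integral>\<^sup>+t\<in>{x..}. ennreal (\<omega> t / t\<^sup>2) \<partial>lborel) +
     (\<integral>\<^sup>+t\<in>{0<..x}. ennreal (\<omega> t / t) \<partial>lborel)"

definition Lambda_space :: "(real \<Rightarrow> ennreal) \<Rightarrow> (real \<Rightarrow> complex) set" where
  "Lambda_space \<kappa> =
     {f. (SUP (x, y)\<in>{(x, y). x \<noteq> y}. ennreal (cmod (f x - f y)) / \<kappa> \<bar>x - y\<bar>) < \<infinity>}"


section \<open>Complex Hilbert spaces\<close>

text \<open>The inner product is linear in the first argument. Definiteness is contained in
  \<open>norm_eq_sqrt_cinner\<close>, because \<open>norm\<close> is a norm.\<close>

class complex_hilbert = banach +
  fixes scaleC :: "complex \<Rightarrow> 'a \<Rightarrow> 'a" (infixr "*\<^sub>C" 75)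
    and cinner :: "'a \<Rightarrow> 'a \<Rightarrow> complex"
  assumes scaleC_add_right: "c *\<^sub>C (x + y) = c *\<^sub>C x + c *\<^sub>C y"
    and scaleC_add_left: "(c + d) *\<^sub>C x = c *\<^sub>C x + d *\<^sub>C x"
    and scaleC_scaleC: "c *\<^sub>C d *\<^sub>C x = (c * d) *\<^sub>C x"
    and scaleR_scaleC: "r *\<^sub>R x = complex_of_real r *\<^sub>C x"
    and cinner_commute: "cinner x y = cnj (cinner y x)"
    and cinner_add_left: "cinner (x + y) z = cinner x z + cinner y z"
    and cinner_scaleC_left: "cinner (c *\<^sub>C x) y = c * cinner x y"
    and norm_eq_sqrt_cinner: "norm x = sqrt (Re (cinner x x))"

global_interpretation complex_vector: vector_space "scaleC :: complex \<Rightarrow> 'a \<Rightarrow> 'a::complex_hilbert"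
proof
  show "1 *\<^sub>C x = x" for x :: 'a
    using scaleR_scaleC[of 1 x] by simp
qed (simp_all add: scaleC_add_right scaleC_add_left scaleC_scaleC)


section \<open>The Hilbert space of square-summable complex sequences\<close>

text \<open>Up to unitary equivalence this is the only separable infinite-dimensional Hilbert space.
  It serves as the concrete type for \<open>there is a Hilbert space\<close>, since HOL has no existential
  quantification over types.\<close>

typedef ell2 = "{x :: nat \<Rightarrow> complex. summable (\<lambda>n. (cmod (x n))\<^sup>2)}"
  by (rule exI[of _ "\<lambda>_. 0"]) simp

setup_lifting type_definition_ell2

lemma ell2_summable_add:
  assumes "summable (\<lambda>n. (cmod (x n))\<^sup>2)" "summable (\<lambda>n. (cmod (y n))\<^sup>2)"
  shows "summable (\<lambda>n. (cmod (x n + y n))\<^sup>2)"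
proof (rule summable_comparison_test)
  have "(cmod (x n + y n))\<^sup>2 \<le> 2 * (cmod (x n))\<^sup>2 + 2 * (cmod (y n))\<^sup>2" for n
  proof -
    have "(cmod (x n + y n))\<^sup>2 \<le> (cmod (x n) + cmod (y n))\<^sup>2"
      by (simp add: norm_triangle_ineq power_mono)
    also have "\<dots> \<le> 2 * (cmod (x n))\<^sup>2 + 2 * (cmod (y n))\<^sup>2"
      using sum_squares_bound[of "cmod (x n)" "cmod (y n)"] by (simp add: power2_sum)
    finally show ?thesis .
  qed
  then show "\<exists>N. \<forall>n\<ge>N. norm ((cmod (x n + y n))\<^sup>2) \<le> 2 * (cmod (x n))\<^sup>2 + 2 * (cmod (y n))\<^sup>2"
    by auto
  show "summable (\<lambda>n. 2 * (cmod (x n))\<^sup>2 + 2 * (cmod (y n))\<^sup>2)"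
    using assms by (intro summable_add summable_mult)
qed

lemma ell2_summable_mult:
  assumes "summable (\<lambda>n. (cmod (x n))\<^sup>2)"
  shows "summable (\<lambda>n. (cmod (c * x n))\<^sup>2)"
  using assms by (simp add: norm_mult power_mult_distrib summable_mult)

lemma ell2_summable_cinner:
  assumes "summable (\<lambda>n. (cmod (x n))\<^sup>2)" "summable (\<lambda>n. (cmod (y n))\<^sup>2)"
  shows "summable (\<lambda>n. x n * cnj (y n))"
proof (rule summable_comparison_test)
  have "norm (x n * cnj (y n)) \<le> (cmod (x n))\<^sup>2 + (cmod (y n))\<^sup>2" for n
  proof -
    have "2 * (cmod (x n) * cmod (y n)) \<le> (cmod (x n))\<^sup>2 + (cmod (y n))\<^sup>2"
      using sum_squares_bound[of "cmod (x n)" "cmod (y n)"] by simp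
    moreover have "0 \<le> cmod (x n) * cmod (y n)" by simp
    ultimately have "cmod (x n) * cmod (y n) \<le> (cmod (x n))\<^sup>2 + (cmod (y n))\<^sup>2" by linarith
    then show ?thesis by (simp add: norm_mult)
  qed
  then show "\<exists>N. \<forall>n\<ge>N. norm (x n * cnj (y n)) \<le> (cmod (x n))\<^sup>2 + (cmod (y n))\<^sup>2" by auto
  show "summable (\<lambda>n. (cmod (x n))\<^sup>2 + (cmod (y n))\<^sup>2)"
    using assms by (intro summable_add)
qed

instantiation ell2 :: ab_group_add
begin

lift_definition zero_ell2 :: ell2 is "\<lambda>_. 0" by simp

lift_definition plus_ell2 :: "ell2 \<Rightarrow> ell2 \<Rightarrow> ell2" is "\<lambda>x y n. x n + y n"
  by (rule ell2_summable_add)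

lift_definition uminus_ell2 :: "ell2 \<Rightarrow> ell2" is "\<lambda>x n. - x n" by simp

lift_definition minus_ell2 :: "ell2 \<Rightarrow> ell2 \<Rightarrow> ell2" is "\<lambda>x y n. x n - y n"
  subgoal for x y using ell2_summable_add[of x "\<lambda>n. - y n"] by simp
  done

instance
  by standard (transfer; simp add: fun_eq_iff algebra_simps)+

end

instantiation ell2 :: real_normed_vector
begin

lift_definition scaleR_ell2 :: "real \<Rightarrow> ell2 \<Rightarrow> ell2" is "\<lambda>r x n. complex_of_real r * x n"
  by (rule ell2_summable_mult)

lift_definition norm_ell2 :: "ell2 \<Rightarrow> real" is "\<lambda>x. sqrt (\<Sum>n. (cmod (x n))\<^sup>2)" .

definition dist_ell2 :: "ell2 \<Rightarrow> ell2 \<Rightarrow> real" where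
  "dist_ell2 x y = norm (x - y)"

definition sgn_ell2 :: "ell2 \<Rightarrow> ell2" where
  "sgn_ell2 x = inverse (norm x) *\<^sub>R x"

definition uniformity_ell2 :: "(ell2 \<times> ell2) filter" where
  "uniformity_ell2 = (INF e\<in>{0<..}. principal {(x, y). dist x y < e})"

definition open_ell2 :: "ell2 set \<Rightarrow> bool" where
  "open_ell2 U \<longleftrightarrow> (\<forall>x\<in>U. \<forall>\<^sub>F (x', y) in uniformity. x' = x \<longrightarrow> y \<in> U)"

instance
proof
  fix x y :: ell2 and a b :: real
  show "dist x y = norm (x - y)" by (rule dist_ell2_def)
  show "sgn x = inverse (norm x) *\<^sub>R x" by (rule sgn_ell2_def)
  show "uniformity = (INF e\<in>{0<..}. principal {(x :: ell2, y). dist x y < e})"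
    by (rule uniformity_ell2_def)
  show "open U \<longleftrightarrow> (\<forall>x\<in>U. \<forall>\<^sub>F (x', y) in uniformity. x' = x \<longrightarrow> y \<in> U)" for U :: "ell2 set"
    by (rule open_ell2_def)
  show "a *\<^sub>R (x + y) = a *\<^sub>R x + a *\<^sub>R y" by transfer (simp add: algebra_simps)
  show "(a + b) *\<^sub>R x = a *\<^sub>R x + b *\<^sub>R x" by transfer (simp add: algebra_simps)
  show "a *\<^sub>R b *\<^sub>R x = (a * b) *\<^sub>R x" by transfer (simp add: algebra_simps)
  show "1 *\<^sub>R x = x" by transfer simp
  show "norm x = 0 \<longleftrightarrow> x = 0"
    by transfer (auto simp: suminf_eq_zero_iff fun_eq_iff)
  show "norm (a *\<^sub>R x) = \<bar>a\<bar> * norm x"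
    by transfer (simp add: norm_mult power_mult_distrib suminf_mult real_sqrt_mult)
  show "norm (x + y) \<le> norm x + norm y"
  proof transfer
    fix x y :: "nat \<Rightarrow> complex"
    assume x: "summable (\<lambda>n. (cmod (x n))\<^sup>2)" and y: "summable (\<lambda>n. (cmod (y n))\<^sup>2)"
    let ?S = "\<lambda>z :: nat \<Rightarrow> complex. \<Sum>n. (cmod (z n))\<^sup>2"
    have part: "sqrt (\<Sum>n<N. (cmod (z n))\<^sup>2) \<le> sqrt (?S z)"
      if "summable (\<lambda>n. (cmod (z n))\<^sup>2)" for z :: "nat \<Rightarrow> complex" and N
      using that by (simp add: sum_le_suminf)
    have "(\<Sum>n<N. (cmod (x n + y n))\<^sup>2) \<le> (sqrt (?S x) + sqrt (?S y))\<^sup>2" for N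
    proof -
      have "sqrt (\<Sum>n<N. (cmod (x n + y n))\<^sup>2) \<le> L2_set (\<lambda>n. cmod (x n) + cmod (y n)) {..<N}"
        unfolding L2_set_def
        by (intro real_sqrt_le_mono sum_mono power_mono norm_triangle_ineq) auto
      also have "\<dots> \<le> L2_set (\<lambda>n. cmod (x n)) {..<N} + L2_set (\<lambda>n. cmod (y n)) {..<N}"
        by (rule L2_set_triangle_ineq)
      also have "\<dots> \<le> sqrt (?S x) + sqrt (?S y)"
        unfolding L2_set_def using part[OF x] part[OF y] by (intro add_mono)
      finally show ?thesis
        by (rule sqrt_le_D)
    qed
    then have "?S (\<lambda>n. x n + y n) \<le> (sqrt (?S x) + sqrt (?S y))\<^sup>2"
      by (intro suminf_le_const ell2_summable_add x y)
    moreover have "0 \<le> sqrt (?S x) + sqrt (?S y)"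
      using x y by (intro add_nonneg_nonneg real_sqrt_ge_zero suminf_nonneg) auto
    ultimately show "sqrt (?S (\<lambda>n. x n + y n)) \<le> sqrt (?S x) + sqrt (?S y)"
      by (rule real_le_lsqrt[rotated])
  qed
qed

end

lemma ell2_norm_power2: "(norm x)\<^sup>2 = (\<Sum>n. (cmod (Rep_ell2 x n))\<^sup>2)"
  by transfer (simp add: suminf_nonneg)

lemma ell2_sum_le_norm: "(\<Sum>n<N. (cmod (Rep_ell2 x n))\<^sup>2) \<le> (norm x)\<^sup>2"
  unfolding ell2_norm_power2 using Rep_ell2[of x] by (intro sum_le_suminf) auto

lemma ell2_coord_le_norm: "cmod (Rep_ell2 x n) \<le> norm x"
proof -
  have "(cmod (Rep_ell2 x n))\<^sup>2 \<le> (\<Sum>k<Suc n. (cmod (Rep_ell2 x k))\<^sup>2)"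
    by (simp add: sum_nonneg)
  also have "\<dots> \<le> (norm x)\<^sup>2" by (rule ell2_sum_le_norm)
  finally show ?thesis by (rule power2_le_imp_le) simp
qed

instance ell2 :: banach
proof
  fix X :: "nat \<Rightarrow> ell2"
  assume X: "Cauchy X"
  have minus: "Rep_ell2 (x - y) n = Rep_ell2 x n - Rep_ell2 y n" for x y n
    by transfer simp
  have "Cauchy (\<lambda>k. Rep_ell2 (X k) n)" for n
  proof (rule metric_CauchyI)
    fix e :: real assume "e > 0"
    then obtain M where "\<forall>k\<ge>M. \<forall>l\<ge>M. dist (X k) (X l) < e"
      using metric_CauchyD[OF X] by blast
    then show "\<exists>M. \<forall>k\<ge>M. \<forall>l\<ge>M. dist (Rep_ell2 (X k) n) (Rep_ell2 (X l) n) < e"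
      by (metis dist_norm ell2_coord_le_norm le_less_trans minus)
  qed
  then have "\<exists>l. (\<lambda>k. Rep_ell2 (X k) n) \<longlonglongrightarrow> l" for n
    by (simp add: Cauchy_convergent_iff convergent_def)
  then obtain y where y: "\<And>n. (\<lambda>k. Rep_ell2 (X k) n) \<longlonglongrightarrow> y n" by metis
  have tail: "\<exists>M. \<forall>k\<ge>M. \<forall>N. (\<Sum>n<N. (cmod (Rep_ell2 (X k) n - y n))\<^sup>2) \<le> e\<^sup>2" if "e > 0" for e
  proof -
    obtain M where M: "\<forall>k\<ge>M. \<forall>l\<ge>M. dist (X k) (X l) < e"
      using metric_CauchyD[OF X \<open>e > 0\<close>] by blast
    have "(\<Sum>n<N. (cmod (Rep_ell2 (X k) n - y n))\<^sup>2) \<le> e\<^sup>2" if k: "k \<ge> M" for k N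
    proof (rule tendsto_upperbound)
      show "(\<lambda>l. \<Sum>n<N. (cmod (Rep_ell2 (X k) n - Rep_ell2 (X l) n))\<^sup>2)
              \<longlonglongrightarrow> (\<Sum>n<N. (cmod (Rep_ell2 (X k) n - y n))\<^sup>2)"
        by (intro tendsto_intros y)
      have "(\<Sum>n<N. (cmod (Rep_ell2 (X k) n - Rep_ell2 (X l) n))\<^sup>2) \<le> e\<^sup>2" if l: "l \<ge> M" for l
      proof -
        have "(\<Sum>n<N. (cmod (Rep_ell2 (X k) n - Rep_ell2 (X l) n))\<^sup>2) \<le> (norm (X k - X l))\<^sup>2"
          using ell2_sum_le_norm[of "X k - X l" N] by (simp add: minus)
        also have "\<dots> \<le> e\<^sup>2"
          using M k l by (intro power_mono) (auto simp: dist_norm less_imp_le)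
        finally show ?thesis .
      qed
      then show "\<forall>\<^sub>F l in sequentially.
          (\<Sum>n<N. (cmod (Rep_ell2 (X k) n - Rep_ell2 (X l) n))\<^sup>2) \<le> e\<^sup>2"
        by (auto simp: eventually_sequentially)
    qed simp
    then show ?thesis by blast
  qed
  have summ: "summable (\<lambda>n. (cmod (z n))\<^sup>2)"
    if "\<And>N. (\<Sum>n<N. (cmod (z n))\<^sup>2) \<le> b" for z :: "nat \<Rightarrow> complex" and b
  proof (rule bounded_imp_summable)
    show "(\<Sum>k\<le>n. (cmod (z k))\<^sup>2) \<le> b" for n
      using that[of "Suc n"] by (simp only: lessThan_Suc_atMost)
  qed simp
  obtain M where M: "\<forall>k\<ge>M. \<forall>N. (\<Sum>n<N. (cmod (Rep_ell2 (X k) n - y n))\<^sup>2) \<le> 1\<^sup>2"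
    using tail[of 1] by auto
  have "summable (\<lambda>n. (cmod (y n - Rep_ell2 (X M) n))\<^sup>2)"
    by (rule summ[where b = "1\<^sup>2"], subst norm_minus_commute) (use M in blast)
  moreover have "summable (\<lambda>n. (cmod (Rep_ell2 (X M) n))\<^sup>2)"
    using Rep_ell2[of "X M"] by simp
  ultimately have "summable (\<lambda>n. (cmod (y n))\<^sup>2)"
    using ell2_summable_add[of "\<lambda>n. y n - Rep_ell2 (X M) n" "Rep_ell2 (X M)"] by simp
  then have rep: "Rep_ell2 (Abs_ell2 y) = y" by (simp add: Abs_ell2_inverse)
  have "X \<longlonglongrightarrow> Abs_ell2 y"
  proof (rule metric_LIMSEQ_I)
    fix e :: real assume e: "e > 0"
    then obtain M where M: "\<forall>k\<ge>M. \<forall>N. (\<Sum>n<N. (cmod (Rep_ell2 (X k) n - y n))\<^sup>2) \<le> (e / 2)\<^sup>2"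
      using tail[of "e / 2"] by auto
    have "dist (X k) (Abs_ell2 y) < e" if k: "k \<ge> M" for k
    proof -
      have "(norm (X k - Abs_ell2 y))\<^sup>2 \<le> (e / 2)\<^sup>2"
        unfolding ell2_norm_power2 minus rep
        by (rule suminf_le_const, rule summ[where b = "(e / 2)\<^sup>2"]) (use M k in blast)+
      then have "norm (X k - Abs_ell2 y) \<le> e / 2"
        by (rule power2_le_imp_le) (use e in simp)
      then show ?thesis using e by (simp add: dist_norm)
    qed
    then show "\<exists>M. \<forall>k\<ge>M. dist (X k) (Abs_ell2 y) < e" by blast
  qed
  then show "convergent X" by (auto simp: convergent_def)
qed

instantiation ell2 :: complex_hilbert
begin

lift_definition scaleC_ell2 :: "complex \<Rightarrow> ell2 \<Rightarrow> ell2" is "\<lambda>c x n. c * x n"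
  by (rule ell2_summable_mult)

lift_definition cinner_ell2 :: "ell2 \<Rightarrow> ell2 \<Rightarrow> complex" is "\<lambda>x y. \<Sum>n. x n * cnj (y n)" .

instance
proof
  fix x y z :: ell2 and c d :: complex and r :: real
  show "c *\<^sub>C (x + y) = c *\<^sub>C x + c *\<^sub>C y" by transfer (simp add: algebra_simps)
  show "(c + d) *\<^sub>C x = c *\<^sub>C x + d *\<^sub>C x" by transfer (simp add: algebra_simps)
  show "c *\<^sub>C d *\<^sub>C x = (c * d) *\<^sub>C x" by transfer (simp add: algebra_simps)
  show "r *\<^sub>R x = complex_of_real r *\<^sub>C x" by transfer simp
  show "cinner x y = cnj (cinner y x)"
  proof transfer
    fix x y :: "nat \<Rightarrow> complex"
    assume "summable (\<lambda>n. (cmod (x n))\<^sup>2)" "summable (\<lambda>n. (cmod (y n))\<^sup>2)"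
    then have "(\<lambda>n. cnj (y n * cnj (x n))) sums cnj (\<Sum>n. y n * cnj (x n))"
      by (subst sums_cnj) (intro summable_sums ell2_summable_cinner)
    then show "(\<Sum>n. x n * cnj (y n)) = cnj (\<Sum>n. y n * cnj (x n))"
      by (intro sums_unique[symmetric]) (simp add: mult.commute)
  qed
  show "cinner (x + y) z = cinner x z + cinner y z"
    by transfer (simp add: distrib_right suminf_add ell2_summable_cinner)
  show "cinner (c *\<^sub>C x) y = c * cinner x y"
    by transfer (simp add: mult.assoc suminf_mult ell2_summable_cinner)
  show "norm x = sqrt (Re (cinner x x))"
  proof transfer
    fix x :: "nat \<Rightarrow> complex"
    assume x: "summable (\<lambda>n. (cmod (x n))\<^sup>2)"
    have "Re (\<Sum>n. x n * cnj (x n)) = (\<Sum>n. Re (x n * cnj (x n)))"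
      using x by (intro Re_suminf ell2_summable_cinner)
    also have "\<dots> = (\<Sum>n. (cmod (x n))\<^sup>2)"
      by (simp add: cmod_power2 flip: power2_eq_square)
    finally show "sqrt (\<Sum>n. (cmod (x n))\<^sup>2) = sqrt (Re (\<Sum>n. x n * cnj (x n)))" by simp
  qed
qed

end


section \<open>Operators\<close>

text \<open>A possibly unbounded operator is a partial function whose domain is \<open>dom A\<close>.\<close>

type_synonym 'a unbounded_op = "'a \<rightharpoonup> 'a"

definition linear_op :: "'a::complex_hilbert unbounded_op \<Rightarrow> bool" where
  "linear_op A \<longleftrightarrow> complex_vector.subspace (dom A) \<and>
     (\<forall>x\<in>dom A. \<forall>y\<in>dom A. the (A (x + y)) = the (A x) + the (A y)) \<and>
     (\<forall>c. \<forall>x\<in>dom A. the (A (c *\<^sub>C x)) = c *\<^sub>C the (A x))"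

text \<open>The last conjunct says that \<open>A\<close> equals its adjoint, domains included: the adjoint maps
  \<open>y\<close> to \<open>z\<close> iff \<open>\<langle>A x, y\<rangle> = \<langle>x, z\<rangle>\<close> for all \<open>x\<close> in the domain of \<open>A\<close>.\<close>

definition self_adjoint :: "'a::complex_hilbert unbounded_op \<Rightarrow> bool" where
  "self_adjoint A \<longleftrightarrow> linear_op A \<and> closure (dom A) = UNIV \<and>
     (\<forall>y z. A y = Some z \<longleftrightarrow> (\<forall>x\<in>dom A. cinner (the (A x)) y = cinner x z))"

definition bounded_clinear :: "('a::complex_hilbert \<Rightarrow> 'a) \<Rightarrow> bool" where
  "bounded_clinear T \<longleftrightarrow> bounded_linear T \<and> (\<forall>c x. T (c *\<^sub>C x) = c *\<^sub>C T x)"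

text \<open>The difference \<open>A - B\<close> is the bounded operator \<open>T\<close>, in the sense that \<open>A = B + T\<close> with
  equality of domains. Requiring only agreement on \<open>dom A \<inter> dom B\<close> would be too weak: two distinct
  self-adjoint extensions of one symmetric operator would then differ by \<open>0\<close>.\<close>

definition has_bounded_difference ::
    "'a::complex_hilbert unbounded_op \<Rightarrow> 'a unbounded_op \<Rightarrow> ('a \<Rightarrow> 'a) \<Rightarrow> bool" where
  "has_bounded_difference A B T \<longleftrightarrow> bounded_clinear T \<and> dom A = dom B \<and>
     (\<forall>x\<in>dom A. the (A x) - the (B x) = T x)"

definition op_rank :: "('a::complex_hilbert \<Rightarrow> 'a) \<Rightarrow> enat" where
  "op_rank T = (if \<exists>S. finite S \<and> range T \<subseteq> complex_vector.span S
                then enat (complex_vector.dim (range T)) else \<infinity>)"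

definition singular_value :: "nat \<Rightarrow> ('a::complex_hilbert \<Rightarrow> 'a) \<Rightarrow> real" where
  "singular_value m T =
     Inf {onorm (\<lambda>x. T x - R x) | R. bounded_clinear R \<and> op_rank R \<le> enat m}"


section \<open>Spectral measures and the functional calculus\<close>

text \<open>\<open>E\<close> assigns orthogonal projections to the Borel sets of the real line, countably additively
  in the strong operator topology; its values at other sets are irrelevant. Multiplicativity,
  \<open>E (S \<inter> S') = E S \<circ> E S'\<close>, follows from additivity.\<close>

definition spectral_measure :: "(real set \<Rightarrow> 'a::complex_hilbert \<Rightarrow> 'a) \<Rightarrow> bool" where
  "spectral_measure E \<longleftrightarrow>
     (\<forall>S\<in>sets borel. bounded_clinear (E S) \<and> (\<forall>x. E S (E S x) = E S x) \<and>
        (\<forall>x y. cinner (E S x) y = cinner x (E S y))) \<and>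
     (\<forall>x. E UNIV x = x) \<and>
     (\<forall>S :: nat \<Rightarrow> real set. range S \<subseteq> sets borel \<longrightarrow> disjoint_family S \<longrightarrow>
        (\<forall>x. (\<lambda>n. E (S n) x) sums E (\<Union>n. S n) x))"

text \<open>The scalar measure \<open>\<mu>\<^sub>x(S) = \<langle>E(S) x, x\<rangle> = \<parallel>E(S) x\<parallel>\<^sup>2\<close>.\<close>

definition scalar_measure :: "(real set \<Rightarrow> 'a::complex_hilbert \<Rightarrow> 'a) \<Rightarrow> 'a \<Rightarrow> real measure" where
  "scalar_measure E x = measure_of UNIV (sets borel) (\<lambda>S. ennreal (Re (cinner (E S x) x)))"

text \<open>\<open>F = \<integral> f dE\<close>, the operator with domain \<open>{x. \<integral> \<bar>f\<bar>\<^sup>2 d\<mu>\<^sub>x < \<infinity>}\<close> and quadratic form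
  \<open>\<langle>F x, x\<rangle> = \<integral> f d\<mu>\<^sub>x\<close>. By polarization these conditions determine \<open>F\<close>.\<close>

definition is_spectral_integral ::
    "(real set \<Rightarrow> 'a::complex_hilbert \<Rightarrow> 'a) \<Rightarrow> (real \<Rightarrow> complex) \<Rightarrow> 'a unbounded_op \<Rightarrow> bool" where
  "is_spectral_integral E f F \<longleftrightarrow> f \<in> borel_measurable borel \<and> linear_op F \<and>
     dom F = {x. (\<integral>\<^sup>+t. ennreal ((cmod (f t))\<^sup>2) \<partial>scalar_measure E x) < \<infinity>} \<and>
     (\<forall>x\<in>dom F. cinner (the (F x)) x = integral\<^sup>L (scalar_measure E x) f)"

text \<open>\<open>F = f(A)\<close>: the integral of \<open>f\<close> against the spectral measure of \<open>A\<close>, which is the unique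
  spectral measure \<open>E\<close> with \<open>A = \<integral> t dE(t)\<close>. It is a relation rather than a function, so
  that neither the existence nor the uniqueness in the spectral theorem enters the definition.\<close>

definition is_functional_calculus ::
    "(real \<Rightarrow> complex) \<Rightarrow> 'a::complex_hilbert unbounded_op \<Rightarrow> 'a unbounded_op \<Rightarrow> bool" where
  "is_functional_calculus f A F \<longleftrightarrow>
     (\<exists>E. spectral_measure E \<and> is_spectral_integral E complex_of_real A \<and>
          is_spectral_integral E f F)"

end

theory Submission
  imports Defs
begin

text \<open>Let \<open>B\<close> be the Jacobi matrix with diagonal \<open>0\<close> and off-diagonal entries \<open>1/2\<close> (the discrete
  Laplacian with a Dirichlet condition), and let \<open>A\<close> be the same matrix with \<open>1/2\<close> in the corner
  (a Neumann condition). They are multiplication by \<open>cos \<theta>\<close> on \<open>L\<^sup>2(0, \<pi>)\<close> in the orthonormal bases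
  \<open>sin ((n + 1) \<theta>)\<close> and \<open>cos ((n + 1/2) \<theta>)\<close>, up to normalization. By the product formulas for sines and
  cosines, \<open>f(A) - f(B)\<close> is the Hankel matrix with entries \<open>u (m + n + 1) + u (m + n + 2)\<close>, where
  \<open>u\<close> is the sequence of cosine coefficients of \<open>f(cos \<theta>)\<close>. For \<open>f\<close> a sum of waves of frequencies
  \<open>4 * 2^j\<close> with amplitudes proportional to \<open>\<omega>(2^-j)\<close>, this matrix contains for each \<open>j\<close> a submatrix
  of size \<open>2^(j-1)\<close> that is a permutation matrix times a multiple of \<open>\<omega>(2^-j)\<close>, which bounds the
  singular values from below. The modulus of continuity of such a lacunary series is at most
  \<open>\<Sum>j. \<omega>(2^-j) min(1, 2^j d)\<close>, a dyadic minorant of \<open>\<omega>\<^sub>\<sharp>(d)\<close> up to a constant.\<close>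

section \<open>Coordinates in the sequence space\<close>

text \<open>The functional calculus has to be certified by an explicit spectral measure on
  \<open>ell2\<close>. Instead of a unitary map to a space of square-integrable functions,
  multiplication by \<open>g (cos \<theta>)\<close> is represented by its matrix of integrals in
  either basis, and the projections are the matrices belonging to indicator functions. The one
  substantial fact is that these matrices multiply as their symbols do. This is Parseval's identity;
  it is derived from the three-term recurrences and polynomial approximation. The singular value
  bound is demanded for every \<open>m\<close> and without a constant. The blocks have sizes running
  through the powers of two, and \<open>\<omega> (2 * x) \<le> 2 * \<omega> x\<close> bridges the
  gaps between them at the cost of a constant factor. This factor is put into the amplitudes of
  \<open>f\<close>, since membership in the function space is insensitive to scaling. Finiteness of
  the transform makes the amplitudes summable, so \<open>f(A)\<close> and \<open>f(B)\<close> are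
  bounded and their difference is defined everywhere.\<close>

lemma Rep_ell2_zero [simp]: "Rep_ell2 0 n = 0" by transfer simp
lemma Rep_ell2_add [simp]: "Rep_ell2 (x + y) n = Rep_ell2 x n + Rep_ell2 y n" by transfer simp
lemma Rep_ell2_diff [simp]: "Rep_ell2 (x - y) n = Rep_ell2 x n - Rep_ell2 y n" by transfer simp
lemma Rep_ell2_scaleC [simp]: "Rep_ell2 (c *\<^sub>C x) n = c * Rep_ell2 x n" by transfer simp
lemma Rep_ell2_scaleR [simp]: "Rep_ell2 (c *\<^sub>R x) n = complex_of_real c * Rep_ell2 x n"
  by transfer simp

lemma Rep_ell2_sum [simp]: "Rep_ell2 (\<Sum>i\<in>I. x i) n = (\<Sum>i\<in>I. Rep_ell2 (x i) n)"
  by (induction I rule: infinite_finite_induct) auto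

lemma ell2_eqI: "(\<And>n. Rep_ell2 x n = Rep_ell2 y n) \<Longrightarrow> x = y"
  by transfer auto

lemma ell2_summable: "summable (\<lambda>n. (cmod (Rep_ell2 x n))\<^sup>2)"
  using Rep_ell2[of x] by simp

lift_definition ket :: "nat \<Rightarrow> ell2" is "\<lambda>k n. if n = k then 1 else 0"
  subgoal for k
    by (rule summable_finite[of "{k}"]) auto
  done

lemma Rep_ket [simp]: "Rep_ell2 (ket k) n = (if n = k then 1 else 0)"
  by transfer simp

lemma ell2_cinner_sums: "(\<lambda>n. Rep_ell2 x n * cnj (Rep_ell2 y n)) sums cinner x y"
  by transfer (intro summable_sums ell2_summable_cinner)

lemma cinner_ket: "cinner x (ket m) = Rep_ell2 x m"
proof -
  have "(\<lambda>n. Rep_ell2 x n * cnj (Rep_ell2 (ket m) n)) sums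
      (\<Sum>n\<in>{m}. Rep_ell2 x n * cnj (Rep_ell2 (ket m) n))"
    by (rule sums_finite) auto
  then show ?thesis
    using ell2_cinner_sums[of x "ket m"] sums_unique2 by fastforce
qed

lemma cinner_add_right: "cinner x (y + z) = cinner x y + cinner x z" for x :: "'a::complex_hilbert"
  by (metis cinner_add_left cinner_commute complex_cnj_add)

lemma cinner_scaleC_right: "cinner x (c *\<^sub>C y) = cnj c * cinner x y" for x :: "'a::complex_hilbert"
  by (metis cinner_commute cinner_scaleC_left complex_cnj_mult)

lemma norm_cinner_le: "cmod (cinner x y) \<le> norm x * norm y" for x y :: ell2
proof -
  have part: "norm (\<Sum>n<N. Rep_ell2 x n * cnj (Rep_ell2 y n)) \<le> norm x * norm y" for N
  proof -
    have *: "L2_set (\<lambda>n. cmod (Rep_ell2 z n)) {..<N} \<le> norm z" for z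
      unfolding L2_set_def by (rule real_le_lsqrt) (auto simp: ell2_sum_le_norm sum_nonneg)
    have "norm (\<Sum>n<N. Rep_ell2 x n * cnj (Rep_ell2 y n))
        \<le> (\<Sum>n<N. \<bar>cmod (Rep_ell2 x n)\<bar> * \<bar>cmod (Rep_ell2 y n)\<bar>)"
      by (rule order_trans[OF norm_sum]) (simp add: norm_mult)
    also have "\<dots> \<le> L2_set (\<lambda>n. cmod (Rep_ell2 x n)) {..<N} * L2_set (\<lambda>n. cmod (Rep_ell2 y n)) {..<N}"
      by (rule L2_set_mult_ineq)
    also have "\<dots> \<le> norm x * norm y"
      by (intro mult_mono *) (auto simp: L2_set_nonneg)
    finally show ?thesis .
  qed
  have "(\<lambda>N. norm (\<Sum>n<N. Rep_ell2 x n * cnj (Rep_ell2 y n))) \<longlonglongrightarrow> norm (cinner x y)"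
    using ell2_cinner_sums[of x y] by (intro tendsto_norm) (simp add: sums_def)
  then show ?thesis
    by (rule LIMSEQ_le_const2) (use part in blast)
qed

lemma bounded_linear_cinner_left: "bounded_linear (\<lambda>x. cinner x y)" for y :: ell2
proof (rule bounded_linear_intro[of _ "norm y"])
  show "cinner (r *\<^sub>R x) y = r *\<^sub>R cinner x y" for r x
    by (simp add: scaleR_scaleC cinner_scaleC_left scaleR_conv_of_real)
qed (auto simp: cinner_add_left norm_cinner_le)

lemma bounded_linear_cinner_right: "bounded_linear (\<lambda>y. cinner x y)" for x :: ell2
proof (rule bounded_linear_intro[of _ "norm x"])
  show "cinner x (r *\<^sub>R y) = r *\<^sub>R cinner x y" for r y
    by (simp add: scaleR_scaleC cinner_scaleC_right scaleR_conv_of_real)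
  show "norm (cinner x y) \<le> norm y * norm x" for y
    by (subst mult.commute) (rule norm_cinner_le)
qed (rule cinner_add_right)

text \<open>The squared norm of the remainder is the full squared norm minus a partial sum, so it
  tends to 0.\<close>

lemma ket_expansion: "(\<lambda>N. \<Sum>n<N. Rep_ell2 x n *\<^sub>C ket n) \<longlonglongrightarrow> x"
proof -
  define y where "y N = (\<Sum>n<N. Rep_ell2 x n *\<^sub>C ket n)" for N
  have Rep_y: "Rep_ell2 (y N) k = (if k < N then Rep_ell2 x k else 0)" for N k
    by (simp add: y_def if_distrib[of "\<lambda>t. _ * t"] sum.delta cong: if_cong)
  have "(norm (x - y N))\<^sup>2 = (norm x)\<^sup>2 - (\<Sum>n<N. (cmod (Rep_ell2 x n))\<^sup>2)" for N
  proof -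
    have "(\<lambda>n. (cmod (Rep_ell2 x n))\<^sup>2 - (if n < N then (cmod (Rep_ell2 x n))\<^sup>2 else 0)) sums
       ((norm x)\<^sup>2 - (\<Sum>n<N. (cmod (Rep_ell2 x n))\<^sup>2))"
      using sums_If_finite_set[of "{..<N}" "\<lambda>n. (cmod (Rep_ell2 x n))\<^sup>2"]
      by (intro sums_diff) (auto simp: ell2_norm_power2 ell2_summable summable_sums)
    moreover have "(\<lambda>n. (cmod (Rep_ell2 x n))\<^sup>2 - (if n < N then (cmod (Rep_ell2 x n))\<^sup>2 else 0))
        = (\<lambda>n. (cmod (Rep_ell2 (x - y N) n))\<^sup>2)"
      by (auto simp: Rep_y)
    ultimately show ?thesis
      unfolding ell2_norm_power2 by (simp add: sums_unique2 sums_iff)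
  qed
  moreover have "(\<lambda>N. (norm x)\<^sup>2 - (\<Sum>n<N. (cmod (Rep_ell2 x n))\<^sup>2)) \<longlonglongrightarrow> (norm x)\<^sup>2 - (norm x)\<^sup>2"
    using summable_sums[OF ell2_summable[of x]]
    by (intro tendsto_intros) (simp add: sums_def ell2_norm_power2)
  ultimately have "(\<lambda>N. sqrt ((norm (x - y N))\<^sup>2)) \<longlonglongrightarrow> sqrt 0"
    by (intro tendsto_real_sqrt) simp
  then have "(\<lambda>N. norm (y N - x)) \<longlonglongrightarrow> 0"
    by (simp add: norm_minus_commute)
  then show ?thesis
    unfolding y_def[symmetric] using LIM_zero_cancel tendsto_norm_zero_iff by blast
qed

text \<open>Finite combinations of basis vectors are dense. This principle reduces operator
  identities, symmetry and strong convergence to single vectors \<open>ket n\<close>, that is to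
  matrix columns.\<close>

lemma ell2_closed_induct:
  assumes "closed {x. P x}" "P 0" "\<And>x y. P x \<Longrightarrow> P y \<Longrightarrow> P (x + y)" "\<And>c n. P (c *\<^sub>C ket n)"
  shows "P x"
proof -
  have "P (\<Sum>n<N. Rep_ell2 x n *\<^sub>C ket n)" for N
    by (induction N) (auto simp: assms)
  then show ?thesis
    using closed_sequentially[OF assms(1) _ ket_expansion[of x]] by simp
qed

lemma bounded_clinear_eqI:
  fixes S T :: "ell2 \<Rightarrow> ell2"
  assumes S: "bounded_clinear S" and T: "bounded_clinear T" and eq: "\<And>n. S (ket n) = T (ket n)"
  shows "S x = T x"
proof (rule ell2_closed_induct[of "\<lambda>x. S x = T x"])
  interpret S: bounded_linear S using S by (simp add: bounded_clinear_def)
  interpret T: bounded_linear T using T by (simp add: bounded_clinear_def)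
  show "closed {x. S x = T x}"
    by (intro closed_Collect_eq S.continuous_on T.continuous_on continuous_on_id)
  show "S 0 = T 0" by (simp add: S.zero T.zero)
  show "S x = T x \<Longrightarrow> S y = T y \<Longrightarrow> S (x + y) = T (x + y)" for x y by (simp add: S.add T.add)
  show "S (c *\<^sub>C ket n) = T (c *\<^sub>C ket n)" for c n
    using S T eq by (simp add: bounded_clinear_def)
qed

lemma bounded_clinear_add:
  "bounded_clinear S \<Longrightarrow> bounded_clinear T \<Longrightarrow> bounded_clinear (\<lambda>x. S x + T x)"
  by (auto simp: bounded_clinear_def scaleC_add_right intro: bounded_linear_add)

lemma bounded_clinear_scaleC:
  fixes T :: "ell2 \<Rightarrow> ell2"
  assumes "bounded_clinear T"
  shows "bounded_clinear (\<lambda>x. c *\<^sub>C T x)"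
proof -
  interpret T: bounded_linear T using assms by (simp add: bounded_clinear_def)
  have nC: "norm (c *\<^sub>C y) = cmod c * norm y" for y :: ell2
    by transfer (simp add: norm_mult power_mult_distrib suminf_mult real_sqrt_mult)
  obtain K where K: "\<And>x. norm (T x) \<le> norm x * K" using T.bounded by blast
  have "bounded_linear (\<lambda>x. c *\<^sub>C T x)"
  proof (rule bounded_linear_intro[of _ "cmod c * K"])
    show "c *\<^sub>C T (x + y) = c *\<^sub>C T x + c *\<^sub>C T y" for x y
      by (simp add: T.add scaleC_add_right)
    show "c *\<^sub>C T (r *\<^sub>R x) = r *\<^sub>R c *\<^sub>C T x" for r x
      by (rule ell2_eqI) (simp add: T.scaleR)
    show "norm (c *\<^sub>C T x) \<le> norm x * (cmod c * K)" for x
      using mult_left_mono[OF K[of x], of "cmod c"] by (simp add: nC ac_simps)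
  qed
  then show ?thesis
    using assms by (auto simp: bounded_clinear_def scaleC_scaleC mult.commute)
qed

lemma bounded_clinear_zero: "bounded_clinear (\<lambda>x :: ell2. 0 :: ell2)"
  by (auto simp: bounded_clinear_def intro: ell2_eqI)

lemma bounded_clinear_sum:
  fixes T :: "'i \<Rightarrow> ell2 \<Rightarrow> ell2"
  shows "(\<And>i. i \<in> I \<Longrightarrow> bounded_clinear (T i)) \<Longrightarrow> bounded_clinear (\<lambda>x. \<Sum>i\<in>I. T i x)"
  by (induction I rule: infinite_finite_induct)
    (auto simp: bounded_clinear_zero bounded_clinear_add)

lemma bounded_clinear_compose:
  "bounded_clinear S \<Longrightarrow> bounded_clinear T \<Longrightarrow> bounded_clinear (\<lambda>x. S (T x))"
  by (auto simp: bounded_clinear_def intro: bounded_linear_compose)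

lemma bounded_clinear_id: "bounded_clinear (\<lambda>x. x)"
  by (simp add: bounded_clinear_def)

lemma bounded_clinear_diff:
  "bounded_clinear S \<Longrightarrow> bounded_clinear T \<Longrightarrow> bounded_clinear (\<lambda>x. S x - T x)"
  by (auto simp: bounded_clinear_def complex_vector.scale_right_diff_distrib
      intro: bounded_linear_sub)


section \<open>Operators given by real symmetric matrices\<close>

text \<open>An operator norm bound expressed on finite truncations. The numbers of rows and columns
  are independent, so that \<open>N\<close> can tend to infinity for fixed \<open>M\<close>. Real
  test vectors suffice, since a real matrix acts separately on real and imaginary parts.\<close>

definition bounded_matrix :: "real \<Rightarrow> (nat \<Rightarrow> nat \<Rightarrow> real) \<Rightarrow> bool" where
  "bounded_matrix C G \<longleftrightarrow> 0 \<le> C \<and> (\<forall>m n. G m n = G n m) \<and>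
     (\<forall>M N x. (\<Sum>m<M. (\<Sum>n<N. G m n * x n)\<^sup>2) \<le> C\<^sup>2 * (\<Sum>n<N. (x n)\<^sup>2))"

definition mat_op :: "(nat \<Rightarrow> nat \<Rightarrow> real) \<Rightarrow> ell2 \<Rightarrow> ell2" where
  "mat_op G x = Abs_ell2 (\<lambda>m. \<Sum>n. complex_of_real (G m n) * Rep_ell2 x n)"

lemma bounded_matrixD:
  assumes "bounded_matrix C G"
  shows "0 \<le> C" "G m n = G n m"
    "(\<Sum>m<M. (\<Sum>n<N. G m n * x n)\<^sup>2) \<le> C\<^sup>2 * (\<Sum>n<N. (x n)\<^sup>2)"
  using assms unfolding bounded_matrix_def by auto

lemma bounded_matrix_sum_le:
  fixes z :: "nat \<Rightarrow> complex"
  assumes "bounded_matrix C G"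
  shows "(\<Sum>m<M. (cmod (\<Sum>n<N. complex_of_real (G m n) * z n))\<^sup>2) \<le> C\<^sup>2 * (\<Sum>n<N. (cmod (z n))\<^sup>2)"
proof -
  have "(\<Sum>m<M. (\<Sum>n<N. G m n * Re (z n))\<^sup>2) + (\<Sum>m<M. (\<Sum>n<N. G m n * Im (z n))\<^sup>2)
     \<le> C\<^sup>2 * (\<Sum>n<N. (Re (z n))\<^sup>2) + C\<^sup>2 * (\<Sum>n<N. (Im (z n))\<^sup>2)"
    by (intro add_mono bounded_matrixD(3)[OF assms])
  then show ?thesis
    by (simp add: cmod_power2 sum.distrib distrib_left)
qed

lemma bounded_matrix_row_summable:
  assumes "bounded_matrix C G"
  shows "summable (\<lambda>n. (G m n)\<^sup>2)"
proof (rule bounded_imp_summable)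
  fix N
  \<comment> \<open>The unit vector with index \<open>m\<close> picks out column \<open>m\<close>,
    which by symmetry is row \<open>m\<close>.\<close>
  have "(\<Sum>k<Suc N. (\<Sum>n<Suc m. G k n * (if n = m then 1 else 0))\<^sup>2)
      \<le> C\<^sup>2 * (\<Sum>n<Suc m. (if n = m then 1 else 0)\<^sup>2)"
    by (rule bounded_matrixD(3)[OF assms])
  also have "(\<Sum>k<Suc N. (\<Sum>n<Suc m. G k n * (if n = m then 1 else 0))\<^sup>2) = (\<Sum>k\<le>N. (G m k)\<^sup>2)"
    by (auto simp: bounded_matrixD(2)[OF assms, of _ m] sum.delta if_distrib lessThan_Suc_atMost
        cong: if_cong simp del: sum.lessThan_Suc)
  also have "C\<^sup>2 * (\<Sum>n<Suc m. (if n = m then 1 else 0)\<^sup>2) = C\<^sup>2"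
    by (simp add: if_distrib[of "\<lambda>t. t\<^sup>2"] sum.delta cong: if_cong del: sum.lessThan_Suc)
  finally show "(\<Sum>k\<le>N. (G m k)\<^sup>2) \<le> C\<^sup>2" .
qed simp

lemma bounded_matrix_summable:
  assumes "bounded_matrix C G"
  shows "summable (\<lambda>n. complex_of_real (G m n) * Rep_ell2 x n)"
  using ell2_summable_cinner[OF ell2_summable[of x], of "\<lambda>n. complex_of_real (G m n)"]
    bounded_matrix_row_summable[OF assms, of m]
  by (simp add: mult.commute)

lemma
  assumes G: "bounded_matrix C G"
  shows Rep_mat_op_sums: "(\<lambda>n. complex_of_real (G m n) * Rep_ell2 x n) sums Rep_ell2 (mat_op G x) m"
    and norm_mat_op_le: "norm (mat_op G x) \<le> C * norm x"
proof -
  let ?y = "\<lambda>m. \<Sum>n. complex_of_real (G m n) * Rep_ell2 x n"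
  \<comment> \<open>\<open>N\<close> tends to infinity while \<open>M\<close> is fixed, so that only
    finitely many rows are involved. The resulting bound is uniform in \<open>M\<close>, hence the
    image is square summable and \<open>Abs_ell2\<close> is meaningful.\<close>
  have bound: "(\<Sum>m<M. (cmod (?y m))\<^sup>2) \<le> C\<^sup>2 * (norm x)\<^sup>2" for M
  proof (rule LIMSEQ_le_const2)
    show "(\<lambda>N. \<Sum>m<M. (cmod (\<Sum>n<N. complex_of_real (G m n) * Rep_ell2 x n))\<^sup>2)
       \<longlonglongrightarrow> (\<Sum>m<M. (cmod (?y m))\<^sup>2)"
      by (intro tendsto_intros summable_LIMSEQ bounded_matrix_summable[OF G])
    have "(\<Sum>m<M. (cmod (\<Sum>n<N. complex_of_real (G m n) * Rep_ell2 x n))\<^sup>2)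
        \<le> C\<^sup>2 * (norm x)\<^sup>2" for N
      by (rule order_trans[OF bounded_matrix_sum_le[OF G]])
        (intro mult_left_mono ell2_sum_le_norm, simp)
    then show "\<exists>N. \<forall>n\<ge>N. (\<Sum>m<M. (cmod (\<Sum>k<n. complex_of_real (G m k) * Rep_ell2 x k))\<^sup>2)
        \<le> C\<^sup>2 * (norm x)\<^sup>2"
      by blast
  qed
  have summ: "summable (\<lambda>m. (cmod (?y m))\<^sup>2)"
  proof (rule bounded_imp_summable)
    show "(\<Sum>k\<le>n. (cmod (?y k))\<^sup>2) \<le> C\<^sup>2 * (norm x)\<^sup>2" for n
      using bound[of "Suc n"] by (simp only: lessThan_Suc_atMost)
  qed simp
  then have Rep: "Rep_ell2 (mat_op G x) = ?y"
    unfolding mat_op_def by (intro Abs_ell2_inverse) simp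
  show "(\<lambda>n. complex_of_real (G m n) * Rep_ell2 x n) sums Rep_ell2 (mat_op G x) m"
    unfolding Rep by (intro summable_sums bounded_matrix_summable[OF G])
  have "(norm (mat_op G x))\<^sup>2 \<le> (C * norm x)\<^sup>2"
    unfolding ell2_norm_power2[of "mat_op G x"] Rep power_mult_distrib
    by (rule suminf_le_const[OF summ bound])
  then show "norm (mat_op G x) \<le> C * norm x"
    by (rule power2_le_imp_le) (use G in \<open>simp add: bounded_matrix_def\<close>)
qed

lemma bounded_clinear_mat_op:
  assumes G: "bounded_matrix C G"
  shows "bounded_clinear (mat_op G)"
proof -
  have add: "mat_op G (x + y) = mat_op G x + mat_op G y" for x y
  proof (rule ell2_eqI)
    show "Rep_ell2 (mat_op G (x + y)) m = Rep_ell2 (mat_op G x + mat_op G y) m" for m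
      using sums_unique2[OF Rep_mat_op_sums[OF G, of m "x + y"]]
        sums_add[OF Rep_mat_op_sums[OF G, of m x] Rep_mat_op_sums[OF G, of m y]]
      by (simp add: algebra_simps)
  qed
  have scale: "mat_op G (c *\<^sub>C x) = c *\<^sub>C mat_op G x" for c x
  proof (rule ell2_eqI)
    show "Rep_ell2 (mat_op G (c *\<^sub>C x)) m = Rep_ell2 (c *\<^sub>C mat_op G x) m" for m
      using sums_unique2[OF Rep_mat_op_sums[OF G, of m "c *\<^sub>C x"]]
        sums_mult[OF Rep_mat_op_sums[OF G, of m x], of c]
      by (simp add: algebra_simps)
  qed
  have "bounded_linear (mat_op G)"
    by (rule bounded_linear_intro[of _ C])
      (use norm_mat_op_le[OF G] in \<open>auto simp: add scale scaleR_scaleC mult.commute\<close>)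
  then show ?thesis
    using scale by (auto simp: bounded_clinear_def)
qed

lemma Rep_mat_op_ket:
  assumes "bounded_matrix C G"
  shows "Rep_ell2 (mat_op G (ket n)) m = complex_of_real (G m n)"
proof -
  have "(\<lambda>k. complex_of_real (G m k) * Rep_ell2 (ket n) k) sums
      (\<Sum>k\<in>{n}. complex_of_real (G m k) * Rep_ell2 (ket n) k)"
    by (rule sums_finite) auto
  then show ?thesis
    using Rep_mat_op_sums[OF assms, of m "ket n"] sums_unique2 by fastforce
qed

lemma mat_op_symmetric:
  assumes G: "bounded_matrix C G"
  shows "cinner (mat_op G x) y = cinner x (mat_op G y)"
proof (rule ell2_closed_induct[of "\<lambda>y. cinner (mat_op G x) y = cinner x (mat_op G y)"])
  interpret G: bounded_linear "mat_op G"
    using bounded_clinear_mat_op[OF G] by (simp add: bounded_clinear_def)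
  have inner: "continuous_on UNIV (\<lambda>y. cinner z y)" for z :: ell2
    by (intro linear_continuous_on bounded_linear_cinner_right)
  show "closed {y. cinner (mat_op G x) y = cinner x (mat_op G y)}"
    by (intro closed_Collect_eq inner continuous_on_compose2[OF inner] G.continuous_on
        continuous_on_id) auto
  show "cinner (mat_op G x) 0 = cinner x (mat_op G 0)"
    using bounded_linear_cinner_right[THEN bounded_linear.linear, THEN linear_0]
    by (simp add: G.zero)
  show "cinner (mat_op G x) (y + z) = cinner x (mat_op G (y + z))"
    if "cinner (mat_op G x) y = cinner x (mat_op G y)"
      "cinner (mat_op G x) z = cinner x (mat_op G z)" for y z
    using that by (simp add: cinner_add_right G.add)
  have "cinner (mat_op G x) (ket n) = cinner x (mat_op G (ket n))" for n
  proof -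
    have "(\<lambda>k. complex_of_real (G n k) * Rep_ell2 x k) sums cinner x (mat_op G (ket n))"
      using ell2_cinner_sums[of x "mat_op G (ket n)"] G
      by (simp add: Rep_mat_op_ket[OF G] bounded_matrix_def mult.commute)
    then show ?thesis
      using Rep_mat_op_sums[OF G, of n x] sums_unique2 by (metis cinner_ket)
  qed
  then show "cinner (mat_op G x) (c *\<^sub>C ket n) = cinner x (mat_op G (c *\<^sub>C ket n))" for c n
    using bounded_clinear_mat_op[OF G] by (simp add: bounded_clinear_def cinner_scaleC_right)
qed

lemma mat_op_compose:
  assumes G: "bounded_matrix C G" and H: "bounded_matrix D H" and P: "bounded_matrix E P"
    and "\<And>m n. (\<lambda>k. G m k * H k n) sums P m n"
  shows "mat_op G (mat_op H x) = mat_op P x"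
proof (rule bounded_clinear_eqI[of "\<lambda>x. mat_op G (mat_op H x)" "mat_op P"])
  show "mat_op G (mat_op H (ket n)) = mat_op P (ket n)" for n
  proof (rule ell2_eqI)
    fix m
    have "(\<lambda>k. complex_of_real (G m k * H k n)) sums complex_of_real (P m n)"
      using assms(4) by (subst sums_of_real_iff)
    then show "Rep_ell2 (mat_op G (mat_op H (ket n))) m = Rep_ell2 (mat_op P (ket n)) m"
      using Rep_mat_op_sums[OF G, of m "mat_op H (ket n)"] sums_unique2
      by (fastforce simp: Rep_mat_op_ket[OF H] Rep_mat_op_ket[OF P])
  qed
qed (use G H P bounded_clinear_mat_op bounded_clinear_compose in blast)+

lemma mat_op_linear_combination:
  assumes G: "\<And>i. i \<in> I \<Longrightarrow> bounded_matrix (C i) (G i)" and H: "bounded_matrix D H"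
    and eq: "\<And>m n. H m n = (\<Sum>i\<in>I. c i * G i m n)"
  shows "mat_op H x = (\<Sum>i\<in>I. complex_of_real (c i) *\<^sub>C mat_op (G i) x)"
proof (rule bounded_clinear_eqI[of "mat_op H" "\<lambda>x. \<Sum>i\<in>I. complex_of_real (c i) *\<^sub>C mat_op (G i) x"])
  show "bounded_clinear (\<lambda>x. \<Sum>i\<in>I. complex_of_real (c i) *\<^sub>C mat_op (G i) x)"
    by (intro bounded_clinear_sum bounded_clinear_scaleC bounded_clinear_mat_op[OF G])
  show "mat_op H (ket n) = (\<Sum>i\<in>I. complex_of_real (c i) *\<^sub>C mat_op (G i) (ket n))" for n
    by (rule ell2_eqI) (auto simp: Rep_mat_op_ket[OF H] Rep_mat_op_ket[OF G] eq)
qed (rule bounded_clinear_mat_op[OF H])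

lemma mat_op_diff:
  assumes G: "bounded_matrix C G" and H: "bounded_matrix D H"
    and P: "bounded_matrix E P" and eq: "\<And>m n. P m n = G m n - H m n"
  shows "mat_op P x = mat_op G x - mat_op H x"
proof (rule bounded_clinear_eqI[of "mat_op P" "\<lambda>x. mat_op G x - mat_op H x"])
  show "mat_op P (ket n) = mat_op G (ket n) - mat_op H (ket n)" for n
    by (rule ell2_eqI)
      (simp add: Rep_mat_op_ket[OF G] Rep_mat_op_ket[OF H] Rep_mat_op_ket[OF P] eq)
qed (use G H P bounded_clinear_mat_op bounded_clinear_diff in blast)+

lemma linear_op_Some:
  assumes "bounded_clinear T"
  shows "linear_op (\<lambda>x. Some (T x))"
proof -
  interpret T: bounded_linear T using assms by (simp add: bounded_clinear_def)
  have "dom (\<lambda>x. Some (T x)) = UNIV" by auto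
  then show ?thesis
    using assms by (simp add: linear_op_def T.add bounded_clinear_def)
qed

lemma self_adjoint_Some:
  fixes T :: "ell2 \<Rightarrow> ell2"
  assumes T: "bounded_clinear T" and sym: "\<And>x y. cinner (T x) y = cinner x (T y)"
  shows "self_adjoint (\<lambda>x. Some (T x))"
proof -
  have d: "dom (\<lambda>x. Some (T x)) = UNIV" by auto
  have "T y = z" if *: "\<forall>x. cinner (T x) y = cinner x z" for y z
  proof (rule ell2_eqI)
    fix n
    have "cinner (ket n) (T y) = cinner (ket n) z" using * sym by simp
    then show "Rep_ell2 (T y) n = Rep_ell2 z n"
      by (metis cinner_commute cinner_ket)
  qed
  then show ?thesis
    using sym unfolding self_adjoint_def d by (auto simp: linear_op_Some[OF T])
qed


section \<open>A lower bound for singular values\<close>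

text \<open>Linear dependence of a set does not see repetitions in a family. Two equal members are
  therefore treated separately, with coefficients 1 and -1; distinct members are dependent because
  they outnumber a spanning set.\<close>

lemma nontrivial_vanishing_combination:
  fixes v :: "nat \<Rightarrow> 'a::complex_hilbert"
  assumes B: "finite B" "card B < M" and v: "\<And>t. t < M \<Longrightarrow> v t \<in> complex_vector.span B"
  shows "\<exists>u. (\<exists>t<M. u t \<noteq> 0) \<and> (\<Sum>t<M. u t *\<^sub>C v t) = 0"
proof (cases "inj_on v {..<M}")
  case True
  then have "card (v ` {..<M}) = M" by (simp add: card_image)
  then have "complex_vector.dependent (v ` {..<M})"
    using complex_vector.independent_span_bound[OF B(1), of "v ` {..<M}"] v B(2)
    by (metis image_subsetI lessThan_iff not_le)
  then obtain u where u: "\<exists>w\<in>v ` {..<M}. u w \<noteq> 0" "(\<Sum>w\<in>v ` {..<M}. u w *\<^sub>C w) = 0"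
    by (auto simp: complex_vector.dependent_finite)
  then show ?thesis
    using sum.reindex[OF True, of "\<lambda>w. u w *\<^sub>C w"]
    by (intro exI[of _ "\<lambda>t. u (v t)"]) auto
next
  case False
  then obtain s t where st: "s < M" "t < M" "s \<noteq> t" "v s = v t"
    by (auto simp: inj_on_def)
  let ?u = "\<lambda>r. (if r = s then 1 else 0) - (if r = t then 1 else 0) :: complex"
  have "(\<Sum>r<M. ?u r *\<^sub>C v r) = (\<Sum>r<M. if r = s then v r else 0) - (\<Sum>r<M. if r = t then v r else 0)"
    unfolding sum_subtractf[symmetric]
    by (intro sum.cong refl) (auto simp: complex_vector.scale_left_diff_distrib)
  also have "\<dots> = 0" using st by simp
  finally show ?thesis using st by (intro exI[of _ ?u]) auto
qed

lemma op_rank_le_imp_spanned: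
  assumes "op_rank R \<le> enat m"
  obtains B where "finite B" "card B \<le> m" "range R \<subseteq> complex_vector.span B"
proof -
  obtain S where S: "finite S" "range R \<subseteq> complex_vector.span S"
    and dim: "complex_vector.dim (range R) \<le> m"
    using assms by (auto simp: op_rank_def split: if_splits)
  obtain B where B: "B \<subseteq> range R" "complex_vector.independent B"
    "range R \<subseteq> complex_vector.span B" "card B = complex_vector.dim (range R)"
    using complex_vector.basis_exists by blast
  then have "finite B"
    using complex_vector.independent_span_bound[OF S(1) B(2)] S(2) by blast
  with B dim show ?thesis by (intro that[of B]) auto
qed

lemma norm_sum_ket:
  fixes b :: "nat \<Rightarrow> nat"
  assumes "inj_on b {..<M}"
  shows "(norm (\<Sum>t<M. u t *\<^sub>C ket (b t)))\<^sup>2 = (\<Sum>t<M. (cmod (u t))\<^sup>2)"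
proof -
  let ?x = "\<Sum>t<M. u t *\<^sub>C ket (b t)"
  have Rep: "Rep_ell2 ?x n = (\<Sum>t<M. if n = b t then u t else 0)" for n
    by (simp add: if_distrib cong: if_cong)
  have "Rep_ell2 ?x (b s) = u s" if "s < M" for s
  proof -
    have "Rep_ell2 ?x (b s) = (\<Sum>t<M. if t = s then u t else 0)"
      unfolding Rep using assms that by (intro sum.cong refl) (auto simp: inj_on_def)
    also have "\<dots> = u s" using that by simp
    finally show ?thesis .
  qed
  moreover have "Rep_ell2 ?x n = 0" if "n \<notin> b ` {..<M}" for n
    unfolding Rep using that by (intro sum.neutral) auto
  then have "(\<Sum>n. (cmod (Rep_ell2 ?x n))\<^sup>2) = (\<Sum>n\<in>b ` {..<M}. (cmod (Rep_ell2 ?x n))\<^sup>2)"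
    by (intro suminf_finite) auto
  ultimately show ?thesis
    unfolding ell2_norm_power2 sum.reindex[OF assms] by simp
qed

text \<open>The \<open>M\<close> vectors \<open>ket (b t)\<close> span a space whose dimension
  exceeds the rank of any competitor \<open>R\<close>, so \<open>R\<close> kills a nonzero
  \<open>x\<close> in it. The coordinates \<open>r s\<close> of \<open>T x\<close> alone give norm
  at least \<open>c * norm x\<close>; hence \<open>T - R\<close> has norm at least
  \<open>c\<close>.\<close>

lemma singular_value_ge:
  fixes T :: "ell2 \<Rightarrow> ell2"
  assumes T: "bounded_clinear T" and b: "inj_on b {..<M}" and r: "inj_on r {..<M}"
    and entries: "\<And>s t. s < M \<Longrightarrow> t < M \<Longrightarrow>
      Rep_ell2 (T (ket (b t))) (r s) = (if s = t then complex_of_real c else 0)"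
    and "0 \<le> c" "m < M"
  shows "c \<le> singular_value m T"
  unfolding singular_value_def
proof (rule cInf_greatest)
  \<comment> \<open>A bound below an infimum of reals requires a nonempty set; the zero operator is
    a competitor of rank 0.\<close>
  have "range (\<lambda>x :: ell2. 0 :: ell2) = {0}" by auto
  then have "op_rank (\<lambda>x :: ell2. 0 :: ell2) = enat 0"
    unfolding op_rank_def using complex_vector.dim_le_card[of "{0 :: ell2}" "{}"]
    by (auto simp: complex_vector.span_zero intro!: exI[of _ "{}"])
  then show "{onorm (\<lambda>x. T x - R x) |R. bounded_clinear R \<and> op_rank R \<le> enat m} \<noteq> {}"
    using bounded_clinear_zero by (auto intro!: exI[of _ "\<lambda>x :: ell2. 0 :: ell2"])
next
  fix y assume "y \<in> {onorm (\<lambda>x. T x - R x) |R. bounded_clinear R \<and> op_rank R \<le> enat m}"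
  then obtain R where y: "y = onorm (\<lambda>x. T x - R x)" and R: "bounded_clinear R"
    and rank: "op_rank R \<le> enat m" by blast
  interpret T: bounded_linear T using T by (simp add: bounded_clinear_def)
  interpret R: bounded_linear R using R by (simp add: bounded_clinear_def)
  obtain B where B: "finite B" "card B \<le> m" "range R \<subseteq> complex_vector.span B"
    using op_rank_le_imp_spanned[OF rank] by blast
  then obtain u where u: "\<exists>t<M. u t \<noteq> 0" and Ru: "(\<Sum>t<M. u t *\<^sub>C R (ket (b t))) = 0"
    using nontrivial_vanishing_combination[of B M "\<lambda>t. R (ket (b t))"] \<open>m < M\<close> by force
  define x where "x = (\<Sum>t<M. u t *\<^sub>C ket (b t))"
  have x: "(norm x)\<^sup>2 = (\<Sum>t<M. (cmod (u t))\<^sup>2)"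
    unfolding x_def by (rule norm_sum_ket[OF b])
  have Rx: "R x = 0"
    using R Ru by (simp add: x_def R.sum bounded_clinear_def)
  have Tx: "T x = (\<Sum>t<M. u t *\<^sub>C T (ket (b t)))"
    using T by (simp add: x_def T.sum bounded_clinear_def)
  have "Rep_ell2 (T x) (r s) = c * u s" if "s < M" for s
  proof -
    have "Rep_ell2 (T x) (r s) = (\<Sum>t<M. if t = s then u t * c else 0)"
      unfolding Tx Rep_ell2_sum Rep_ell2_scaleC using that
      by (intro sum.cong refl) (auto simp: entries)
    then show ?thesis using that by (simp add: mult.commute)
  qed
  then have "(c * norm x)\<^sup>2 = (\<Sum>n\<in>r ` {..<M}. (cmod (Rep_ell2 (T x) n))\<^sup>2)"
    unfolding sum.reindex[OF r]
    by (simp add: power_mult_distrib x sum_distrib_left norm_mult)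
  also have "\<dots> \<le> (norm (T x))\<^sup>2"
    unfolding ell2_norm_power2 by (intro sum_le_suminf ell2_summable) auto
  finally have "c * norm x \<le> norm (T x - R x)"
    unfolding Rx by (auto intro: power2_le_imp_le)
  also have "\<dots> \<le> y * norm x"
    unfolding y using T.bounded_linear_axioms R.bounded_linear_axioms
    by (intro onorm bounded_linear_sub)
  finally have "c * norm x \<le> y * norm x" .
  moreover have "0 < norm x"
  proof -
    have "0 < (norm x)\<^sup>2"
      unfolding x using u by (auto intro!: sum_pos2)
    then show ?thesis by simp
  qed
  ultimately show "c \<le> y" by simp
qed


section \<open>Orthonormal systems on the half circle\<close>

definition angle :: "real measure" where
  "angle = lebesgue_on {0..pi}"

text \<open>An algebra of functions that are all integrable because \<open>angle\<close> is a finite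
  measure. Integrability side conditions thereby become closure rules.\<close>

definition bounded_borel :: "(real \<Rightarrow> real) \<Rightarrow> bool" where
  "bounded_borel u \<longleftrightarrow> u \<in> borel_measurable borel \<and> (\<exists>C. \<forall>t. \<bar>u t\<bar> \<le> C)"

lemma space_angle: "space angle = {0..pi}"
  by (simp add: angle_def)

lemma finite_measure_angle: "finite_measure angle"
  unfolding angle_def by (rule finite_measure_lebesgue_on) simp

lemma measurable_angle: "u \<in> borel_measurable borel \<Longrightarrow> u \<in> borel_measurable angle"
  unfolding angle_def by (intro measurable_restrict_space1 measurable_completion) simp

lemma bounded_borel_integrable [simp]: "bounded_borel u \<Longrightarrow> integrable angle u"
  unfolding bounded_borel_def real_norm_def[symmetric]
  by (blast intro: finite_measure.integrable_const_bound[OF finite_measure_angle AE_I2]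
      measurable_angle)

lemma bounded_borel_const [simp]: "bounded_borel (\<lambda>t. c)"
  by (auto simp: bounded_borel_def)

lemma bounded_borel_add [simp]:
  assumes "bounded_borel u" "bounded_borel v"
  shows "bounded_borel (\<lambda>t. u t + v t)"
proof -
  obtain C D where "\<And>t. \<bar>u t\<bar> \<le> C" "\<And>t. \<bar>v t\<bar> \<le> D"
    using assms by (auto simp: bounded_borel_def)
  then have "\<bar>u t + v t\<bar> \<le> C + D" for t
    by (rule order_trans[OF abs_triangle_ineq add_mono])
  then show ?thesis
    using assms by (auto simp: bounded_borel_def)
qed

lemma bounded_borel_mult [simp]:
  assumes "bounded_borel u" "bounded_borel v"
  shows "bounded_borel (\<lambda>t. u t * v t)"
proof -
  obtain C D where C: "\<And>t. \<bar>u t\<bar> \<le> C" and D: "\<And>t. \<bar>v t\<bar> \<le> D"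
    using assms by (auto simp: bounded_borel_def)
  then have "0 \<le> C" using abs_ge_zero order_trans by blast
  then have "\<bar>u t * v t\<bar> \<le> C * D" for t
    unfolding abs_mult by (intro mult_mono C D) auto
  then show ?thesis
    using assms by (auto simp: bounded_borel_def)
qed

lemma bounded_borel_diff [simp]:
  "bounded_borel u \<Longrightarrow> bounded_borel v \<Longrightarrow> bounded_borel (\<lambda>t. u t - v t)"
  using bounded_borel_add[of u "\<lambda>t. (-1) * v t"] bounded_borel_mult[of "\<lambda>t. -1" v]
  by simp

lemma bounded_borel_power2 [simp]: "bounded_borel u \<Longrightarrow> bounded_borel (\<lambda>t. (u t)\<^sup>2)"
  by (simp add: power2_eq_square)

lemma bounded_borel_sum [simp]:
  "(\<And>i. i \<in> I \<Longrightarrow> bounded_borel (u i)) \<Longrightarrow> bounded_borel (\<lambda>t. \<Sum>i\<in>I. u i t)"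
  by (induction I rule: infinite_finite_induct) auto

text \<open>The bound is imposed on the range of \<open>cos\<close> only, so that the identity, the
  symbol of \<open>A\<close> and \<open>B\<close> themselves, qualifies.\<close>

definition bounded_symbol :: "real \<Rightarrow> (real \<Rightarrow> real) \<Rightarrow> bool" where
  "bounded_symbol C g \<longleftrightarrow> g \<in> borel_measurable borel \<and> (\<forall>t\<in>{-1..1}. \<bar>g t\<bar> \<le> C)"

lemma bounded_borel_cos [simp]: "bounded_symbol C g \<Longrightarrow> bounded_borel (\<lambda>\<theta>. g (cos \<theta>))"
  by (auto simp: bounded_symbol_def bounded_borel_def intro!: exI[of _ C])

lemma bounded_borel_polynomial_cos:
  fixes p :: "real \<Rightarrow> real"
  assumes "real_polynomial_function p"
  shows "bounded_borel (\<lambda>\<theta>. p (cos \<theta>))"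
proof -
  have "continuous_on UNIV p"
    using assms by (simp add: continuous_on_eq_continuous_at continuous_real_polymonial_function)
  then have "p \<in> borel_measurable borel" "compact (p ` {-1..1})"
    by (auto intro!: borel_measurable_continuous_onI compact_continuous_image
        intro: continuous_on_subset)
  then have "\<exists>B. bounded_symbol B p"
    using compact_imp_bounded[of "p ` {-1..1}"] by (auto simp: bounded_iff bounded_symbol_def)
  then show ?thesis using bounded_borel_cos by blast
qed

lemma bounded_symbol_indicator [simp]: "S \<in> sets borel \<Longrightarrow> bounded_symbol 1 (indicator S)"
  by (auto simp: bounded_symbol_def indicator_def)

lemma bounded_symbol_nonneg: "bounded_symbol C g \<Longrightarrow> 0 \<le> C"
  unfolding bounded_symbol_def by (force dest: bspec[of _ _ 0])

text \<open>Both boundary conditions are treated at once. The recurrences say that multiplication by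
  \<open>cos \<theta>\<close> has the Jacobi matrix with off-diagonal entries 1/2 and diagonal 0
  except for the corner \<open>\<kappa> / 2\<close>. They also force completeness of the system, see
  \<open>parseval\<close>.\<close>

locale cosine_system =
  fixes \<phi> :: "nat \<Rightarrow> real \<Rightarrow> real" and \<kappa> :: real
  assumes continuous_phi: "continuous_on UNIV (\<phi> n)"
    and abs_phi_le: "\<bar>\<phi> n \<theta>\<bar> \<le> 1"
    and phi_1: "\<phi> (Suc 0) \<theta> = (2 * cos \<theta> - \<kappa>) * \<phi> 0 \<theta>"
    and phi_Suc_Suc: "\<phi> (Suc (Suc n)) \<theta> = 2 * cos \<theta> * \<phi> (Suc n) \<theta> - \<phi> n \<theta>"
    and orthonormal: "(LINT \<theta>|angle. \<phi> m \<theta> * \<phi> n \<theta>) = (if m = n then 1 else 0)"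
begin

section \<open>Fourier coefficients and Bessel's inequality\<close>

lemma bounded_borel_phi [simp]: "bounded_borel (\<phi> n)"
  using abs_phi_le[of n]
  by (auto simp: bounded_borel_def continuous_phi intro!: borel_measurable_continuous_onI)

definition coeff :: "(real \<Rightarrow> real) \<Rightarrow> nat \<Rightarrow> real" where
  "coeff u k = (LINT \<theta>|angle. u \<theta> * \<phi> k \<theta>)"

text \<open>Pythagoras for arbitrary coefficients \<open>c\<close>. With \<open>c\<close> the
  Fourier coefficients it yields Bessel's inequality, with \<open>u = 0\<close> the norm of a
  combination, and in general that Fourier sums are best approximations.\<close>

lemma integral_diff_combination_power2:
  assumes u: "bounded_borel u"
  shows "(LINT \<theta>|angle. (u \<theta> - (\<Sum>k<K. c k * \<phi> k \<theta>))\<^sup>2)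
     = (LINT \<theta>|angle. (u \<theta>)\<^sup>2) - (\<Sum>k<K. (coeff u k)\<^sup>2) + (\<Sum>k<K. (coeff u k - c k)\<^sup>2)"
proof -
  let ?s = "\<lambda>\<theta>. \<Sum>k<K. c k * \<phi> k \<theta>"
  have int_s: "(LINT \<theta>|angle. v \<theta> * ?s \<theta>) = (\<Sum>k<K. c k * coeff v k)" if "bounded_borel v" for v
  proof -
    have "(LINT \<theta>|angle. v \<theta> * ?s \<theta>) = (LINT \<theta>|angle. (\<Sum>k<K. c k * (v \<theta> * \<phi> k \<theta>)))"
      by (simp add: sum_distrib_left ac_simps)
    also have "\<dots> = (\<Sum>k<K. c k * coeff v k)"
      using that by (simp add: coeff_def)
    finally show ?thesis .
  qed
  have coeff_s: "coeff ?s k = c k" if "k < K" for k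
  proof -
    have "coeff ?s k = (LINT \<theta>|angle. \<phi> k \<theta> * ?s \<theta>)" by (simp add: coeff_def mult.commute)
    also have "\<dots> = (\<Sum>j<K. if j = k then c j else 0)"
      using bounded_borel_phi[of k] by (subst int_s)
        (auto simp: coeff_def orthonormal if_distrib[of "(*) _"] eq_commute[of k] cong: if_cong)
    finally show ?thesis using that by simp
  qed
  have "(LINT \<theta>|angle. (u \<theta> - ?s \<theta>)\<^sup>2) =
      (LINT \<theta>|angle. (u \<theta>)\<^sup>2 - 2 * (u \<theta> * ?s \<theta>) + ?s \<theta> * ?s \<theta>)"
    by (intro Bochner_Integration.integral_cong refl) (simp add: power2_eq_square algebra_simps)
  also have "\<dots> = (LINT \<theta>|angle. (u \<theta>)\<^sup>2) - 2 * (LINT \<theta>|angle. u \<theta> * ?s \<theta>)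
      + (LINT \<theta>|angle. ?s \<theta> * ?s \<theta>)"
    using u by simp
  also have "\<dots> = (LINT \<theta>|angle. (u \<theta>)\<^sup>2) - (\<Sum>k<K. 2 * (c k * coeff u k)) + (\<Sum>k<K. c k * c k)"
  proof -
    have "(LINT \<theta>|angle. ?s \<theta> * ?s \<theta>) = (\<Sum>k<K. c k * coeff ?s k)"
      by (rule int_s) simp
    also have "\<dots> = (\<Sum>k<K. c k * c k)"
      using coeff_s by (intro sum.cong refl) simp
    finally have ss: "(LINT \<theta>|angle. ?s \<theta> * ?s \<theta>) = (\<Sum>k<K. c k * c k)" .
    show ?thesis
      unfolding ss int_s[OF u] sum_distrib_left[of 2] by (rule refl)
  qed
  also have "\<dots> = (LINT \<theta>|angle. (u \<theta>)\<^sup>2) - (\<Sum>k<K. (coeff u k)\<^sup>2) + (\<Sum>k<K. (coeff u k - c k)\<^sup>2)"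
  proof -
    have "(\<Sum>k<K. (coeff u k - c k)\<^sup>2) = (\<Sum>k<K. (coeff u k)\<^sup>2 - 2 * (c k * coeff u k) + c k * c k)"
      by (intro sum.cong refl) (simp add: power2_eq_square algebra_simps)
    then show ?thesis unfolding sum.distrib sum_subtractf by linarith
  qed
  finally show ?thesis .
qed

lemma bessel:
  assumes "bounded_borel u"
  shows "(\<Sum>k<K. (coeff u k)\<^sup>2) \<le> (LINT \<theta>|angle. (u \<theta>)\<^sup>2)"
proof -
  have "0 \<le> (LINT \<theta>|angle. (u \<theta> - (\<Sum>k<K. coeff u k * \<phi> k \<theta>))\<^sup>2)" by simp
  then show ?thesis by (simp add: integral_diff_combination_power2[OF assms])
qed

lemma integral_combination_power2:
  "(LINT \<theta>|angle. (\<Sum>k<K. c k * \<phi> k \<theta>)\<^sup>2) = (\<Sum>k<K. (c k)\<^sup>2)"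
  using integral_diff_combination_power2[of "\<lambda>\<theta>. 0" c K] by (simp add: coeff_def)

section \<open>Completeness of a cosine system\<close>

definition combinations :: "(real \<Rightarrow> real) set" where
  "combinations = {s. \<exists>N c. \<forall>K\<ge>N. \<forall>\<theta>. s \<theta> = (\<Sum>k<K. c k * \<phi> k \<theta>)}"

lemma combinationI:
  "(\<And>K \<theta>. N \<le> K \<Longrightarrow> s \<theta> = (\<Sum>k<K. c k * \<phi> k \<theta>)) \<Longrightarrow> s \<in> combinations"
  unfolding combinations_def by blast

lemma phi_combination: "\<phi> n \<in> combinations"
proof -
  have "\<phi> n \<theta> = (\<Sum>k<K. (if k = n then 1 else 0) * \<phi> k \<theta>)" if "Suc n \<le> K" for K \<theta>
  proof -
    have "(\<Sum>k<K. (if k = n then 1 else 0) * \<phi> k \<theta>) = (\<Sum>k<K. if k = n then \<phi> k \<theta> else 0)"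
      by (intro sum.cong) auto
    then show ?thesis using that by simp
  qed
  then show ?thesis by (rule combinationI)
qed

lemma zero_combination: "(\<lambda>\<theta>. 0) \<in> combinations"
  unfolding combinations_def by (auto intro!: exI[of _ "\<lambda>k. 0"])

text \<open>Since membership provides a representation of every sufficiently large length
  \<open>K\<close>, both summands can be taken at the same length without padding.
  \<open>parseval\<close> exploits the same freedom for all large partial sums.\<close>

lemma add_combination:
  assumes "s \<in> combinations" "t \<in> combinations"
  shows "(\<lambda>\<theta>. s \<theta> + t \<theta>) \<in> combinations"
proof -
  obtain N c where c: "\<And>K \<theta>. N \<le> K \<Longrightarrow> s \<theta> = (\<Sum>k<K. c k * \<phi> k \<theta>)"
    using assms(1) unfolding combinations_def by blast
  obtain N' c' where c': "\<And>K \<theta>. N' \<le> K \<Longrightarrow> t \<theta> = (\<Sum>k<K. c' k * \<phi> k \<theta>)"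
    using assms(2) unfolding combinations_def by blast
  show ?thesis
  proof (rule combinationI[of "max N N'" _ "\<lambda>k. c k + c' k"])
    show "s \<theta> + t \<theta> = (\<Sum>k<K. (c k + c' k) * \<phi> k \<theta>)" if "max N N' \<le> K" for K \<theta>
      using c[of K \<theta>] c'[of K \<theta>] that by (simp add: distrib_right sum.distrib)
  qed
qed

lemma scale_combination:
  assumes "s \<in> combinations"
  shows "(\<lambda>\<theta>. a * s \<theta>) \<in> combinations"
proof -
  obtain N c where c: "\<And>K \<theta>. N \<le> K \<Longrightarrow> s \<theta> = (\<Sum>k<K. c k * \<phi> k \<theta>)"
    using assms unfolding combinations_def by blast
  show ?thesis
    by (rule combinationI[of N _ "\<lambda>k. a * c k"]) (simp add: c sum_distrib_left mult.assoc)
qed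

text \<open>This is the recurrence solved for \<open>cos \<theta> * \<phi> n \<theta>\<close>; at
  \<open>n = 0\<close> the boundary term \<open>\<kappa> / 2\<close> stands in for the missing
  predecessor.\<close>

lemma cos_combination:
  assumes "s \<in> combinations"
  shows "(\<lambda>\<theta>. cos \<theta> * s \<theta>) \<in> combinations"
proof -
  have phi: "(\<lambda>\<theta>. cos \<theta> * \<phi> n \<theta>) \<in> combinations" for n
  proof (cases n)
    case 0
    have "(\<lambda>\<theta>. cos \<theta> * \<phi> n \<theta>) = (\<lambda>\<theta>. (1/2) * \<phi> (Suc 0) \<theta> + (\<kappa> / 2) * \<phi> 0 \<theta>)"
      by (auto simp: 0 phi_1 field_simps)
    then show ?thesis
      by (simp only:) (intro add_combination scale_combination phi_combination)
  next
    case (Suc m)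
    have "(\<lambda>\<theta>. cos \<theta> * \<phi> n \<theta>) = (\<lambda>\<theta>. (1/2) * \<phi> (Suc (Suc m)) \<theta> + (1/2) * \<phi> m \<theta>)"
      by (auto simp: Suc phi_Suc_Suc field_simps)
    then show ?thesis
      by (simp only:) (intro add_combination scale_combination phi_combination)
  qed
  have sums: "(\<lambda>\<theta>. \<Sum>k<K. c k * (cos \<theta> * \<phi> k \<theta>)) \<in> combinations" for c and K :: nat
    by (induction K) (auto intro!: add_combination scale_combination phi zero_combination)
  obtain N c where "\<And>K \<theta>. N \<le> K \<Longrightarrow> s \<theta> = (\<Sum>k<K. c k * \<phi> k \<theta>)"
    using assms unfolding combinations_def by blast
  from this[of N] have "(\<lambda>\<theta>. cos \<theta> * s \<theta>) = (\<lambda>\<theta>. \<Sum>k<N. c k * (cos \<theta> * \<phi> k \<theta>))"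
    by (auto simp: sum_distrib_left ac_simps)
  then show ?thesis using sums by simp
qed

lemma polynomial_combination:
  assumes "real_polynomial_function (p :: real \<Rightarrow> real)" "s \<in> combinations"
  shows "(\<lambda>\<theta>. p (cos \<theta>) * s \<theta>) \<in> combinations"
  using assms
proof (induction arbitrary: s rule: real_polynomial_function.induct)
  case (linear f)
  \<comment> \<open>A linear map of the real line is multiplication by its value at 1, which reduces
    this case to \<open>cos_combination\<close>.\<close>
  have f: "f x = f 1 * x" for x
    using bounded_linear.linear[OF linear(1)] linear_scale[of f x 1] by (simp add: mult.commute[of x])
  have "(\<lambda>\<theta>. f (cos \<theta>) * s \<theta>) = (\<lambda>\<theta>. f 1 * (cos \<theta> * s \<theta>))"
    by (intro ext) (subst f, simp)
  then show ?case using linear(2) by (auto intro: scale_combination cos_combination)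
next
  case (const c)
  then show ?case by (rule scale_combination)
next
  case (add f g)
  then show ?case by (simp add: distrib_right add_combination)
next
  case (mult f g)
  then show ?case by (simp add: mult.assoc)
qed

text \<open>The factors \<open>q\<close> are Chebyshev polynomials, of the second kind for the sines
  and of the third kind for the half-integer cosines. They extend \<open>parseval\<close>, which is
  stated for multiples of \<open>\<phi> 0\<close>, to multiples of every
  \<open>\<phi> n\<close>.\<close>

lemma phi_eq_continuous_times_phi_0:
  "\<exists>q. continuous_on UNIV q \<and> (\<forall>\<theta>. \<phi> n \<theta> = q (cos \<theta>) * \<phi> 0 \<theta>)"
proof (induction n rule: less_induct)
  case (less n)
  consider "n = 0" | "n = Suc 0" | m where "n = Suc (Suc m)" by (metis not0_implies_Suc)
  then show ?case
  proof cases
    case 1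
    then show ?thesis by (intro exI[of _ "\<lambda>x. 1"]) auto
  next
    case 2
    then show ?thesis
      by (intro exI[of _ "\<lambda>x. 2 * x - \<kappa>"]) (auto simp: phi_1 intro!: continuous_intros)
  next
    case 3
    obtain p q where "continuous_on UNIV p" "\<forall>\<theta>. \<phi> (Suc m) \<theta> = p (cos \<theta>) * \<phi> 0 \<theta>"
      "continuous_on UNIV q" "\<forall>\<theta>. \<phi> m \<theta> = q (cos \<theta>) * \<phi> 0 \<theta>"
      using less[of m] less[of "Suc m"] 3 by auto
    then show ?thesis
      by (intro exI[of _ "\<lambda>x. 2 * x * p x - q x"])
        (auto simp: 3 phi_Suc_Suc algebra_simps intro!: continuous_intros)
  qed
qed

text \<open>A measurable function is almost everywhere a limit of continuous ones. One of these is
  close in mean square by dominated convergence, and polynomials in \<open>cos \<theta>\<close>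
  approximate it uniformly.\<close>

lemma symbol_approx_by_polynomial:
  assumes g: "bounded_symbol C g" and e: "0 < e"
  obtains p :: "real \<Rightarrow> real" where "real_polynomial_function p"
    "(LINT \<theta>|angle. (g (cos \<theta>) - p (cos \<theta>))\<^sup>2) < e"
proof -
  let ?v = "\<lambda>\<theta>. g (cos \<theta>)"
  have "?v \<in> borel_measurable lebesgue"
    using bounded_borel_cos[OF g] by (auto simp: bounded_borel_def intro: measurable_completion)
  then have "?v measurable_on UNIV"
    by (simp add: lebesgue_measurable_imp_measurable_on_real)
  then obtain N h where N: "negligible N" and h: "\<And>n. continuous_on UNIV (h n)"
    and lim: "\<And>\<theta>. \<theta> \<notin> N \<Longrightarrow> (\<lambda>n. h n \<theta>) \<longlonglongrightarrow> ?v \<theta>"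
    unfolding measurable_on_def by auto
  \<comment> \<open>Clipping keeps continuity, and keeps the limit because the target already lies
    between \<open>- C\<close> and \<open>C\<close>; it supplies the dominating constant.\<close>
  define k where "k n \<theta> = max (- C) (min C (h n \<theta>))" for n :: nat and \<theta>
  have C: "0 \<le> C" by (rule bounded_symbol_nonneg[OF g])
  have k: "continuous_on UNIV (k n)" for n
    unfolding k_def by (intro continuous_intros h)
  have v_le: "\<bar>?v \<theta>\<bar> \<le> C" for \<theta>
    using g by (auto simp: bounded_symbol_def)
  have k_le: "\<bar>k n \<theta>\<bar> \<le> C" for n \<theta>
    using C by (auto simp: k_def)
  have klim: "(\<lambda>n. k n \<theta>) \<longlonglongrightarrow> ?v \<theta>" if "\<theta> \<notin> N" for \<theta>
  proof -
    have "(\<lambda>n. k n \<theta>) \<longlonglongrightarrow> max (- C) (min C (?v \<theta>))"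
      unfolding k_def by (intro tendsto_intros lim that)
    moreover have "max (- C) (min C (?v \<theta>)) = ?v \<theta>" using v_le[of \<theta>] by auto
    ultimately show ?thesis by simp
  qed
  have bk: "bounded_borel (k n)" for n
    unfolding bounded_borel_def
    using k_le[of n] by (auto intro!: borel_measurable_continuous_onI k)
  have "(\<lambda>n. LINT \<theta>|angle. (?v \<theta> - k n \<theta>)\<^sup>2) \<longlonglongrightarrow> (LINT \<theta>|angle. 0)"
  proof (rule integral_dominated_convergence[where w = "\<lambda>\<theta>. (2 * C)\<^sup>2"])
    show "(\<lambda>\<theta>. (?v \<theta> - k n \<theta>)\<^sup>2) \<in> borel_measurable angle" for n
      using bk[of n] bounded_borel_cos[OF g] by (intro borel_measurable_integrable) simp
    have "AE \<theta> in angle. \<theta> \<notin> N"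
    proof -
      have "AE \<theta> in lebesgue. \<theta> \<notin> N"
        using N by (intro AE_not_in) (simp add: negligible_iff_null_sets)
      then show ?thesis
        unfolding angle_def by (subst AE_restrict_space_iff) auto
    qed
    then show "AE \<theta> in angle. (\<lambda>n. (?v \<theta> - k n \<theta>)\<^sup>2) \<longlonglongrightarrow> 0"
    proof eventually_elim
      fix \<theta> assume "\<theta> \<notin> N"
      from tendsto_power[OF tendsto_diff[OF tendsto_const[of "?v \<theta>"] klim[OF this]], of 2]
      show "(\<lambda>n. (?v \<theta> - k n \<theta>)\<^sup>2) \<longlonglongrightarrow> 0" by simp
    qed
    have "\<bar>?v \<theta> - k n \<theta>\<bar> \<le> 2 * C" for n \<theta>
      using v_le[of \<theta>] k_le[of n \<theta>] by linarith
    then show "AE \<theta> in angle. norm ((?v \<theta> - k n \<theta>)\<^sup>2) \<le> (2 * C)\<^sup>2" for n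
      using power_mono[of "\<bar>?v _ - k n _\<bar>" "2 * C" 2] by (intro AE_I2) simp
  qed auto
  then have "\<forall>\<^sub>F n in sequentially. (LINT \<theta>|angle. (?v \<theta> - k n \<theta>)\<^sup>2) < e / 4"
    using e by (intro order_tendstoD(2)[where y = 0]) auto
  then obtain n where n: "(LINT \<theta>|angle. (?v \<theta> - k n \<theta>)\<^sup>2) < e / 4"
    by (auto simp: eventually_sequentially)
  \<comment> \<open>A uniform error \<open>d\<close> contributes
    \<open>d\<^sup>2 * pi = e / 4\<close> to the integral. Together with the error of
    \<open>k n\<close> and the factor 2 from
    \<open>(a + b)\<^sup>2 \<le> 2 * a\<^sup>2 + 2 * b\<^sup>2\<close>, the total stays below
    \<open>e\<close>.\<close>
  define d where "d = sqrt (e / (4 * pi))"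
  have d: "0 < d" "d\<^sup>2 * pi = e / 4" using e by (auto simp: d_def)
  obtain p :: "real \<Rightarrow> real" where p: "real_polynomial_function p"
    "\<And>x. x \<in> {-1..1} \<Longrightarrow> \<bar>k n (arccos x) - p x\<bar> < d"
  proof (rule Stone_Weierstrass_real_polynomial_function[of "{-1..1::real}" "\<lambda>x. k n (arccos x)" d])
    show "continuous_on {-1..1} (\<lambda>x. k n (arccos x))"
      by (rule continuous_on_compose2[OF k]) (auto intro!: continuous_on_arccos')
  qed (use d in auto)
  have pc: "bounded_borel (\<lambda>\<theta>. p (cos \<theta>))" by (rule bounded_borel_polynomial_cos[OF p(1)])
  have "(LINT \<theta>|angle. (?v \<theta> - p (cos \<theta>))\<^sup>2) \<le> (LINT \<theta>|angle. 2 * (?v \<theta> - k n \<theta>)\<^sup>2 + 2 * d\<^sup>2)"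
  proof (rule integral_mono)
    fix \<theta> assume "\<theta> \<in> space angle"
    then have "\<bar>k n \<theta> - p (cos \<theta>)\<bar> \<le> d"
      using p(2)[of "cos \<theta>"] by (simp add: space_angle arccos_cos)
    then have "(k n \<theta> - p (cos \<theta>))\<^sup>2 \<le> d\<^sup>2"
      using power_mono[of "\<bar>k n \<theta> - p (cos \<theta>)\<bar>" d 2] by simp
    moreover have "(a + b)\<^sup>2 \<le> 2 * a\<^sup>2 + 2 * b\<^sup>2" for a b :: real
      using sum_squares_bound[of a b] by (simp add: power2_sum)
    from this[of "?v \<theta> - k n \<theta>" "k n \<theta> - p (cos \<theta>)"]
    have "(?v \<theta> - p (cos \<theta>))\<^sup>2 \<le> 2 * (?v \<theta> - k n \<theta>)\<^sup>2 + 2 * (k n \<theta> - p (cos \<theta>))\<^sup>2" by simp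
    ultimately show "(?v \<theta> - p (cos \<theta>))\<^sup>2 \<le> 2 * (?v \<theta> - k n \<theta>)\<^sup>2 + 2 * d\<^sup>2" by linarith
  qed (use bk[of n] bounded_borel_cos[OF g] pc in simp_all)
  also have "\<dots> = 2 * (LINT \<theta>|angle. (?v \<theta> - k n \<theta>)\<^sup>2) + 2 * d\<^sup>2 * measure angle (space angle)"
    using bk[of n] bounded_borel_cos[OF g] finite_measure.emeasure_finite[OF finite_measure_angle]
    by (subst Bochner_Integration.integral_add) auto
  also have "measure angle (space angle) = pi"
    by (simp add: angle_def measure_restrict_space)
  also have "2 * (LINT \<theta>|angle. (?v \<theta> - k n \<theta>)\<^sup>2) + 2 * d\<^sup>2 * pi < e"
    using n d by linarith
  finally show ?thesis using that[OF p(1)] by blast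
qed

text \<open>One inequality is Bessel's. For the other, the function is close in mean square to some
  \<open>p (cos \<theta>) * \<phi> 0 \<theta>\<close>, a finite combination, and a Fourier sum of
  the same length is at least as close.\<close>

lemma parseval:
  assumes g: "bounded_symbol C g"
  shows "(\<lambda>k. (coeff (\<lambda>\<theta>. g (cos \<theta>) * \<phi> 0 \<theta>) k)\<^sup>2) sums (LINT \<theta>|angle. (g (cos \<theta>) * \<phi> 0 \<theta>)\<^sup>2)"
proof -
  let ?u = "\<lambda>\<theta>. g (cos \<theta>) * \<phi> 0 \<theta>"
  have u: "bounded_borel ?u" using g by simp
  have "\<exists>N. \<forall>K\<ge>N. norm ((\<Sum>k<K. (coeff ?u k)\<^sup>2) - (LINT \<theta>|angle. (?u \<theta>)\<^sup>2)) < e"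
    if e: "0 < e" for e
  proof -
    obtain p :: "real \<Rightarrow> real" where p: "real_polynomial_function p"
      "(LINT \<theta>|angle. (g (cos \<theta>) - p (cos \<theta>))\<^sup>2) < e"
      using symbol_approx_by_polynomial[OF g e] by blast
    have pc: "bounded_borel (\<lambda>\<theta>. p (cos \<theta>))" by (rule bounded_borel_polynomial_cos[OF p(1)])
    obtain N c where c: "\<And>K \<theta>. K \<ge> N \<Longrightarrow> p (cos \<theta>) * \<phi> 0 \<theta> = (\<Sum>k<K. c k * \<phi> k \<theta>)"
      using polynomial_combination[OF p(1) phi_combination[of 0]] unfolding combinations_def by blast
    have "norm ((\<Sum>k<K. (coeff ?u k)\<^sup>2) - (LINT \<theta>|angle. (?u \<theta>)\<^sup>2)) < e" if K: "K \<ge> N" for K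
    proof -
      have "(LINT \<theta>|angle. (?u \<theta>)\<^sup>2) - (\<Sum>k<K. (coeff ?u k)\<^sup>2)
         \<le> (LINT \<theta>|angle. (?u \<theta> - (\<Sum>k<K. c k * \<phi> k \<theta>))\<^sup>2)"
        unfolding integral_diff_combination_power2[OF u] by (simp add: sum_nonneg)
      also have "\<dots> \<le> (LINT \<theta>|angle. (g (cos \<theta>) - p (cos \<theta>))\<^sup>2)"
      proof (rule integral_mono)
        fix \<theta>
        have "(?u \<theta> - (\<Sum>k<K. c k * \<phi> k \<theta>))\<^sup>2 = (g (cos \<theta>) - p (cos \<theta>))\<^sup>2 * (\<phi> 0 \<theta>)\<^sup>2"
          unfolding c[OF K, symmetric] by (simp add: left_diff_distrib[symmetric] power_mult_distrib)
        also have "\<dots> \<le> (g (cos \<theta>) - p (cos \<theta>))\<^sup>2 * 1"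
          using abs_phi_le[of 0 \<theta>] by (intro mult_left_mono) (auto simp: abs_square_le_1)
        finally show "(?u \<theta> - (\<Sum>k<K. c k * \<phi> k \<theta>))\<^sup>2 \<le> (g (cos \<theta>) - p (cos \<theta>))\<^sup>2" by simp
      qed (use bounded_borel_cos[OF g] pc in simp_all)
      finally show ?thesis
        using p(2) bessel[OF u, of K] by simp
    qed
    then show ?thesis by blast
  qed
  then show ?thesis unfolding sums_def by (rule LIMSEQ_I)
qed

end


section \<open>The spectral measure of an orthonormal system\<close>

lemma norm_power2_eq_cinner: "(norm x)\<^sup>2 = Re (cinner x x)" for x :: "'a::complex_hilbert"
proof -
  have "0 \<le> sqrt (Re (cinner x x))"
    by (metis norm_eq_sqrt_cinner norm_ge_zero)
  then show ?thesis
    by (simp add: norm_eq_sqrt_cinner)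
qed

text \<open>The common Lipschitz constant transfers smallness from a nearby point uniformly in
  \<open>K\<close>. Strong convergence of projections can thus be tested on basis vectors.\<close>

lemma closed_tendsto_zero:
  fixes T :: "nat \<Rightarrow> 'a::real_normed_vector \<Rightarrow> 'b::real_normed_vector"
  assumes lip: "\<And>K x y. norm (T K x - T K y) \<le> norm (x - y)"
  shows "closed {x. (\<lambda>K. T K x) \<longlonglongrightarrow> 0}"
  unfolding closed_sequential_limits
proof (intro allI impI, elim conjE)
  fix y l assume y: "\<forall>n. y n \<in> {x. (\<lambda>K. T K x) \<longlonglongrightarrow> 0}" and l: "y \<longlonglongrightarrow> l"
  have "(\<lambda>K. T K l) \<longlonglongrightarrow> 0"
  proof (rule LIMSEQ_I)
    fix e :: real assume e: "0 < e"
    then obtain n where n: "norm (y n - l) < e / 2"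
      using LIMSEQ_D[OF l, of "e / 2"] by auto
    obtain N where N: "\<And>K. K \<ge> N \<Longrightarrow> norm (T K (y n)) < e / 2"
      using LIMSEQ_D[of "\<lambda>K. T K (y n)" 0 "e / 2"] y e by auto
    have "norm (T K l) < e" if "K \<ge> N" for K
    proof -
      have "norm (T K l) \<le> norm (T K (y n)) + norm (T K (y n) - T K l)"
        using norm_triangle_ineq[of "T K (y n)" "T K l - T K (y n)"] by (simp add: norm_minus_commute)
      then show ?thesis using lip[of K "y n" l] N[OF that] n by linarith
    qed
    then show "\<exists>N. \<forall>K\<ge>N. norm (T K l - 0) < e" by auto
  qed
  then show "l \<in> {x. (\<lambda>K. T K x) \<longlonglongrightarrow> 0}" by simp
qed

lemma bounded_symbol_mult:
  assumes "bounded_symbol C g" "bounded_symbol D h"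
  shows "bounded_symbol (C * D) (\<lambda>t. g t * h t)"
proof -
  have "\<bar>g t * h t\<bar> \<le> C * D" if "t \<in> {-1..1}" for t
    unfolding abs_mult using assms that bounded_symbol_nonneg[OF assms(1)]
    by (intro mult_mono) (auto simp: bounded_symbol_def)
  then show ?thesis using assms by (auto simp: bounded_symbol_def)
qed

lemma bounded_symbol_add:
  assumes "bounded_symbol C g" "bounded_symbol D h"
  shows "bounded_symbol (C + D) (\<lambda>t. g t + h t)"
proof -
  have "\<bar>g t + h t\<bar> \<le> C + D" if "t \<in> {-1..1}" for t
    using assms that by (intro order_trans[OF abs_triangle_ineq add_mono]) (auto simp: bounded_symbol_def)
  then show ?thesis using assms by (auto simp: bounded_symbol_def)
qed

lemma bounded_symbol_minus: "bounded_symbol C g \<Longrightarrow> bounded_symbol C (\<lambda>t. - g t)"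
  by (auto simp: bounded_symbol_def)

lemma bounded_symbol_continuous:
  assumes "continuous_on UNIV g"
  shows "\<exists>C. bounded_symbol C g"
proof -
  have "compact (g ` {-1..1})"
    using assms by (intro compact_continuous_image) (auto intro: continuous_on_subset)
  then show ?thesis
    using compact_imp_bounded[of "g ` {-1..1}"] borel_measurable_continuous_onI[OF assms]
    by (auto simp: bounded_iff bounded_symbol_def)
qed

lemma bounded_symbol_ident: "bounded_symbol 1 (\<lambda>t. t)"
  by (auto simp: bounded_symbol_def)

section \<open>Multiplication operators in matrix form\<close>

context cosine_system
begin

definition entry :: "(real \<Rightarrow> real) \<Rightarrow> nat \<Rightarrow> nat \<Rightarrow> real" where
  "entry g m n = (LINT \<theta>|angle. g (cos \<theta>) * \<phi> m \<theta> * \<phi> n \<theta>)"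

text \<open>Multiplication by \<open>g (cos \<theta>)\<close>, transported to \<open>ell2\<close>
  through its matrix. As the symbol \<open>\<lambda>t. t\<close> gives the Jacobi matrix,
  \<open>op g\<close> is going to be its function \<open>g\<close>.\<close>

definition op :: "(real \<Rightarrow> real) \<Rightarrow> ell2 \<Rightarrow> ell2" where
  "op g = mat_op (entry g)"

definition proj :: "real set \<Rightarrow> ell2 \<Rightarrow> ell2" where
  "proj S = op (indicator S)"

lemma entry_cong: "(\<And>t. t \<in> {-1..1} \<Longrightarrow> g t = h t) \<Longrightarrow> entry g = entry h"
  unfolding entry_def by (intro ext Bochner_Integration.integral_cong) auto

lemma entry_commute: "entry g m n = entry g n m"
  by (simp add: entry_def ac_simps)

text \<open>The truncated matrix sends \<open>x\<close> to Fourier coefficients of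
  \<open>g (cos \<theta>)\<close> times the combination with coefficients \<open>x\<close>. Bessel's
  inequality and the bound on \<open>g\<close> then give the norm estimate.\<close>

lemma bounded_matrix_entry:
  assumes g: "bounded_symbol C g"
  shows "bounded_matrix C (entry g)"
  unfolding bounded_matrix_def
proof (intro conjI allI)
  show "0 \<le> C" by (rule bounded_symbol_nonneg[OF g])
  show "entry g m n = entry g n m" for m n by (rule entry_commute)
next
  fix M N and x :: "nat \<Rightarrow> real"
  let ?u = "\<lambda>\<theta>. \<Sum>n<N. x n * \<phi> n \<theta>"
  let ?v = "\<lambda>\<theta>. g (cos \<theta>) * ?u \<theta>"
  have gb: "bounded_borel (\<lambda>\<theta>. g (cos \<theta>))" by (rule bounded_borel_cos[OF g])
  have v: "bounded_borel ?v" using gb by simp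
  have "coeff ?v m = (\<Sum>n<N. entry g m n * x n)" for m
  proof -
    have "coeff ?v m = (LINT \<theta>|angle. (\<Sum>n<N. x n * (g (cos \<theta>) * \<phi> m \<theta> * \<phi> n \<theta>)))"
      unfolding coeff_def
      by (intro Bochner_Integration.integral_cong refl)
        (simp add: sum_distrib_left sum_distrib_right ac_simps)
    also have "\<dots> = (\<Sum>n<N. x n * entry g m n)"
      using gb by (simp add: entry_def)
    finally show ?thesis by (simp add: mult.commute)
  qed
  then have "(\<Sum>m<M. (\<Sum>n<N. entry g m n * x n)\<^sup>2) \<le> (LINT \<theta>|angle. (?v \<theta>)\<^sup>2)"
    using bessel[OF v, of M] by simp
  also have "\<dots> \<le> (LINT \<theta>|angle. C\<^sup>2 * (?u \<theta>)\<^sup>2)"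
  proof (rule integral_mono)
    show "(?v \<theta>)\<^sup>2 \<le> C\<^sup>2 * (?u \<theta>)\<^sup>2" for \<theta>
    proof -
      have "\<bar>g (cos \<theta>)\<bar> \<le> C" using g by (auto simp: bounded_symbol_def)
      then have "(g (cos \<theta>))\<^sup>2 \<le> C\<^sup>2"
        using power_mono[of "\<bar>g (cos \<theta>)\<bar>" C 2] by simp
      then show ?thesis
        unfolding power_mult_distrib by (rule mult_right_mono) simp
    qed
    have "bounded_borel (\<lambda>\<theta>. C\<^sup>2 * (?u \<theta>)\<^sup>2)"
      by (intro bounded_borel_mult bounded_borel_power2 bounded_borel_sum bounded_borel_const
          bounded_borel_phi)
    then show "integrable angle (\<lambda>\<theta>. C\<^sup>2 * (?u \<theta>)\<^sup>2)" by (rule bounded_borel_integrable)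
    show "integrable angle (\<lambda>\<theta>. (?v \<theta>)\<^sup>2)"
      by (intro bounded_borel_integrable bounded_borel_power2 v)
  qed
  also have "\<dots> = C\<^sup>2 * (\<Sum>n<N. (x n)\<^sup>2)"
    by (simp add: integral_combination_power2)
  finally show "(\<Sum>m<M. (\<Sum>n<N. entry g m n * x n)\<^sup>2) \<le> C\<^sup>2 * (\<Sum>n<N. (x n)\<^sup>2)" .
qed

text \<open>The entries are Fourier coefficients of
  \<open>g (cos \<theta>) * \<phi> m \<theta>\<close> and
  \<open>h (cos \<theta>) * \<phi> n \<theta>\<close>, so this is the polarized Parseval identity.
  It turns products of symbols into products of matrices, and here completeness of the system
  enters.\<close>

lemma entry_product_sums:
  assumes g: "bounded_symbol C g" and h: "bounded_symbol D h"
  shows "(\<lambda>k. entry g m k * entry h k n) sums entry (\<lambda>t. g t * h t) m n"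
proof -
  \<comment> \<open>A bounded symbol times \<open>\<phi> 0\<close> is the form of function that
    \<open>parseval\<close> covers.\<close>
  obtain p where p: "continuous_on UNIV p" "\<And>\<theta>. \<phi> m \<theta> = p (cos \<theta>) * \<phi> 0 \<theta>"
    using phi_eq_continuous_times_phi_0 by blast
  obtain q where q: "continuous_on UNIV q" "\<And>\<theta>. \<phi> n \<theta> = q (cos \<theta>) * \<phi> 0 \<theta>"
    using phi_eq_continuous_times_phi_0 by blast
  obtain P Q where P: "bounded_symbol P p" and Q: "bounded_symbol Q q"
    using bounded_symbol_continuous p(1) q(1) by blast
  let ?u = "\<lambda>\<theta>. g (cos \<theta>) * \<phi> m \<theta>" and ?v = "\<lambda>\<theta>. h (cos \<theta>) * \<phi> n \<theta>"
  have gb: "bounded_borel (\<lambda>\<theta>. g (cos \<theta>))" and hb: "bounded_borel (\<lambda>\<theta>. h (cos \<theta>))"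
    using g h by simp_all
  note G = bounded_symbol_mult[OF g P] and H = bounded_symbol_mult[OF h Q]
  have plus: "(\<lambda>k. (coeff (\<lambda>\<theta>. ?u \<theta> + ?v \<theta>) k)\<^sup>2) sums (LINT \<theta>|angle. (?u \<theta> + ?v \<theta>)\<^sup>2)"
    using parseval[OF bounded_symbol_add[OF G H]] by (simp add: p(2) q(2) algebra_simps)
  have minus: "(\<lambda>k. (coeff (\<lambda>\<theta>. ?u \<theta> - ?v \<theta>) k)\<^sup>2) sums (LINT \<theta>|angle. (?u \<theta> - ?v \<theta>)\<^sup>2)"
    using parseval[OF bounded_symbol_add[OF G bounded_symbol_minus[OF H]]]
    by (simp add: p(2) q(2) algebra_simps)
  have cp: "coeff (\<lambda>\<theta>. ?u \<theta> + ?v \<theta>) k = entry g m k + entry h k n" for k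
    unfolding entry_commute[of h k n] using gb hb
    by (simp add: coeff_def entry_def distrib_right)
  have cm: "coeff (\<lambda>\<theta>. ?u \<theta> - ?v \<theta>) k = entry g m k - entry h k n" for k
    unfolding entry_commute[of h k n] using gb hb
    by (simp add: coeff_def entry_def left_diff_distrib)
  have "(\<lambda>k. ((entry g m k + entry h k n)\<^sup>2 - (entry g m k - entry h k n)\<^sup>2) / 4) sums
     (((LINT \<theta>|angle. (?u \<theta> + ?v \<theta>)\<^sup>2) - (LINT \<theta>|angle. (?u \<theta> - ?v \<theta>)\<^sup>2)) / 4)"
    using plus minus unfolding cp cm by (intro sums_divide sums_diff)
  moreover have "((entry g m k + entry h k n)\<^sup>2 - (entry g m k - entry h k n)\<^sup>2) / 4
      = entry g m k * entry h k n" for k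
    by (simp add: power2_eq_square algebra_simps)
  moreover have "((LINT \<theta>|angle. (?u \<theta> + ?v \<theta>)\<^sup>2) - (LINT \<theta>|angle. (?u \<theta> - ?v \<theta>)\<^sup>2)) / 4
      = entry (\<lambda>t. g t * h t) m n"
  proof -
    have "(LINT \<theta>|angle. (?u \<theta> + ?v \<theta>)\<^sup>2) - (LINT \<theta>|angle. (?u \<theta> - ?v \<theta>)\<^sup>2)
        = (LINT \<theta>|angle. (?u \<theta> + ?v \<theta>)\<^sup>2 - (?u \<theta> - ?v \<theta>)\<^sup>2)"
      using gb hb by (intro Bochner_Integration.integral_diff[symmetric]) simp_all
    also have "\<dots> = (LINT \<theta>|angle. 4 * (g (cos \<theta>) * h (cos \<theta>) * \<phi> m \<theta> * \<phi> n \<theta>))"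
      by (intro Bochner_Integration.integral_cong refl) (simp add: power2_eq_square algebra_simps)
    also have "\<dots> = 4 * entry (\<lambda>t. g t * h t) m n"
      by (simp add: entry_def)
    finally show ?thesis by simp
  qed
  ultimately show ?thesis by simp
qed

lemma entry_diff:
  "bounded_symbol C g \<Longrightarrow> bounded_symbol D h \<Longrightarrow> entry (\<lambda>t. g t - h t) m n = entry g m n - entry h m n"
  by (simp add: entry_def left_diff_distrib)

lemma entry_linear_combination:
  assumes "\<And>i. i \<in> I \<Longrightarrow> bounded_symbol (C i) (g i)"
  shows "entry (\<lambda>t. \<Sum>i\<in>I. c i * g i t) m n = (\<Sum>i\<in>I. c i * entry (g i) m n)"
proof -
  have "entry (\<lambda>t. \<Sum>i\<in>I. c i * g i t) m n
      = (LINT \<theta>|angle. (\<Sum>i\<in>I. c i * (g i (cos \<theta>) * \<phi> m \<theta> * \<phi> n \<theta>)))"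
    unfolding entry_def
    by (intro Bochner_Integration.integral_cong refl)
      (simp add: sum_distrib_left sum_distrib_right ac_simps)
  also have "\<dots> = (\<Sum>i\<in>I. c i * entry (g i) m n)"
    using bounded_borel_cos[OF assms] by (simp add: entry_def)
  finally show ?thesis .
qed

lemma bounded_clinear_op: "bounded_symbol C g \<Longrightarrow> bounded_clinear (op g)"
  unfolding op_def by (rule bounded_clinear_mat_op[OF bounded_matrix_entry])

lemma op_symmetric: "bounded_symbol C g \<Longrightarrow> cinner (op g x) y = cinner x (op g y)"
  unfolding op_def by (rule mat_op_symmetric[OF bounded_matrix_entry])

lemma norm_op_le: "bounded_symbol C g \<Longrightarrow> norm (op g x) \<le> C * norm x"
  unfolding op_def by (rule norm_mat_op_le[OF bounded_matrix_entry])

lemma op_diff: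
  assumes g: "bounded_symbol C g" and h: "bounded_symbol D h"
  shows "op (\<lambda>t. g t - h t) x = op g x - op h x"
  unfolding op_def
  by (rule mat_op_diff[OF bounded_matrix_entry[OF g] bounded_matrix_entry[OF h]
      bounded_matrix_entry[of "C + D"]])
    (use bounded_symbol_add[OF g bounded_symbol_minus[OF h]] entry_diff[OF g h] in simp_all)

lemma op_linear_combination:
  assumes g: "\<And>i. i \<in> I \<Longrightarrow> bounded_symbol (C i) (g i)"
    and h: "bounded_symbol D (\<lambda>t. \<Sum>i\<in>I. c i * g i t)"
  shows "op (\<lambda>t. \<Sum>i\<in>I. c i * g i t) x = (\<Sum>i\<in>I. complex_of_real (c i) *\<^sub>C op (g i) x)"
  unfolding op_def
  by (rule mat_op_linear_combination[OF bounded_matrix_entry[OF g] bounded_matrix_entry[OF h]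
        entry_linear_combination[OF g]])

section \<open>Indicator symbols as a spectral measure\<close>

lemma proj_idem:
  assumes S: "S \<in> sets borel"
  shows "proj S (proj S x) = proj S x"
proof -
  have "(\<lambda>t. indicator S t * indicator S t :: real) = indicator S"
    by (auto simp: indicator_def)
  then show ?thesis
    unfolding proj_def op_def using S
    by (intro mat_op_compose[of 1 _ 1 _ 1])
      (use entry_product_sums[OF bounded_symbol_indicator[OF S] bounded_symbol_indicator[OF S]]
        in \<open>auto intro!: bounded_matrix_entry\<close>)
qed

lemma bounded_clinear_proj: "S \<in> sets borel \<Longrightarrow> bounded_clinear (proj S)"
  unfolding proj_def by (rule bounded_clinear_op[OF bounded_symbol_indicator])

lemma proj_symmetric: "S \<in> sets borel \<Longrightarrow> cinner (proj S x) y = cinner x (proj S y)"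
  unfolding proj_def by (rule op_symmetric[OF bounded_symbol_indicator])

lemma norm_proj_le: "S \<in> sets borel \<Longrightarrow> norm (proj S x) \<le> norm x"
  unfolding proj_def using norm_op_le[OF bounded_symbol_indicator[of S], of x] by simp

lemma Re_cinner_proj: "S \<in> sets borel \<Longrightarrow> Re (cinner (proj S x) x) = (norm (proj S x))\<^sup>2"
  by (metis norm_power2_eq_cinner proj_idem proj_symmetric)

lemma proj_UNIV: "proj UNIV x = x"
proof (rule bounded_clinear_eqI[of "proj UNIV" "\<lambda>x. x"])
  have G: "bounded_matrix 1 (entry (indicator UNIV))"
    by (rule bounded_matrix_entry[OF bounded_symbol_indicator]) simp
  have "entry (indicator UNIV) m n = (if m = n then 1 else 0)" for m n
    by (simp add: entry_def orthonormal)
  then show "proj UNIV (ket n) = ket n" for n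
    by (intro ell2_eqI) (simp add: proj_def op_def Rep_mat_op_ket[OF G] del: indicator_UNIV)
qed (simp_all add: bounded_clinear_proj bounded_clinear_id)

text \<open>Finite additivity is linearity in the symbol. It remains to show that the projections
  for the tails \<open>R K\<close> tend strongly to 0; being contractions, they need testing on
  basis vectors only.\<close>

lemma proj_sums:
  assumes S: "range S \<subseteq> sets borel" and disj: "disjoint_family S"
  shows "(\<lambda>n. proj (S n) x) sums proj (\<Union>n. S n) x"
proof -
  have Sn: "S n \<in> sets borel" for n using S by auto
  define R where "R K = (\<Union>n\<in>{K..}. S n)" for K
  have R: "R K \<in> sets borel" for K
    unfolding R_def using Sn by (intro sets.countable_UN'') auto
  have U: "(\<Union>n. S n) \<in> sets borel" using Sn by auto
  have disjR: "disjoint_family_on S {..<K}" for K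
    using disj by (auto simp: disjoint_family_on_def)
  have "proj (\<Union>n. S n) x = (\<Sum>n<K. proj (S n) x) + proj (R K) x" for K
  proof -
    have W: "(\<Union>n<K. S n) \<in> sets borel" using Sn by auto
    have ind: "indicator (\<Union>n<K. S n) = (\<lambda>t. \<Sum>n<K. 1 * indicator (S n) t :: real)"
      using indicator_UN_disjoint[OF _ disjR[of K]] by auto
    have 1: "proj (\<Union>n<K. S n) x = (\<Sum>n<K. proj (S n) x)"
    proof -
      have "proj (\<Union>n<K. S n) x = (\<Sum>n<K. complex_of_real 1 *\<^sub>C proj (S n) x)"
        unfolding proj_def ind
        by (rule op_linear_combination[of _ "\<lambda>_. 1" _ 1])
          (use Sn bounded_symbol_indicator[OF W] in \<open>simp_all add: ind\<close>)
      then show ?thesis by simp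
    qed
    have "(\<lambda>t. indicator (\<Union>n. S n) t - indicator (\<Union>n<K. S n) t :: real) = indicator (R K)"
    proof
      fix t
      consider "\<forall>n. t \<notin> S n" | n where "t \<in> S n" by blast
      then show "indicator (\<Union>n. S n) t - indicator (\<Union>n<K. S n) t = (indicator (R K) t :: real)"
      proof cases
        case 1
        then show ?thesis by (simp add: R_def indicator_def)
      next
        case 2
        then have "t \<in> S m \<longleftrightarrow> m = n" for m
          using disj by (auto simp: disjoint_family_on_def)
        then show ?thesis by (auto simp: R_def indicator_def)
      qed
    qed
    then have "proj (R K) x = proj (\<Union>n. S n) x - proj (\<Union>n<K. S n) x"
      unfolding proj_def
      using op_diff[OF bounded_symbol_indicator[OF U] bounded_symbol_indicator[OF W], of x] by simp
    with 1 show ?thesis by simp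
  qed
  then have partial: "(\<Sum>n<K. proj (S n) x) = proj (\<Union>n. S n) x - proj (R K) x" for K
    by (simp add: algebra_simps)
  have "(\<lambda>K. proj (R K) x) \<longlonglongrightarrow> 0"
  proof (rule ell2_closed_induct[of "\<lambda>x. (\<lambda>K. proj (R K) x) \<longlonglongrightarrow> 0"])
    have bl: "bounded_linear (proj (R K))" for K
      using bounded_clinear_proj[OF R] by (simp add: bounded_clinear_def)
    have "norm (proj (R K) x - proj (R K) y) \<le> norm (x - y)" for K x y
      using norm_proj_le[OF R, of K "x - y"]
      by (simp add: linear_diff[OF bounded_linear.linear[OF bl]])
    then show "closed {x. (\<lambda>K. proj (R K) x) \<longlonglongrightarrow> 0}" by (rule closed_tendsto_zero)
    show "(\<lambda>K. proj (R K) 0) \<longlonglongrightarrow> 0"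
      by (simp add: linear_0[OF bounded_linear.linear[OF bl]])
    show "(\<lambda>K. proj (R K) (x + y)) \<longlonglongrightarrow> 0"
      if "(\<lambda>K. proj (R K) x) \<longlonglongrightarrow> 0" "(\<lambda>K. proj (R K) y) \<longlonglongrightarrow> 0" for x y
      using tendsto_add[OF that] by (simp add: linear_add[OF bounded_linear.linear[OF bl]])
    show "(\<lambda>K. proj (R K) (c *\<^sub>C ket n)) \<longlonglongrightarrow> 0" for c n
    proof -
      have entry_lim: "(\<lambda>K. entry (indicator (R K)) n n) \<longlonglongrightarrow> (LINT \<theta>|angle. 0)"
        unfolding entry_def
      proof (rule integral_dominated_convergence[where w = "\<lambda>_. 1"])
        have "bounded_borel (\<lambda>\<theta>. indicator (R K) (cos \<theta>) * \<phi> n \<theta> * \<phi> n \<theta>)" for K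
          by (intro bounded_borel_mult bounded_borel_phi
              bounded_borel_cos[OF bounded_symbol_indicator[OF R]])
        then show "(\<lambda>\<theta>. indicator (R K) (cos \<theta>) * \<phi> n \<theta> * \<phi> n \<theta>) \<in> borel_measurable angle" for K
          by (intro borel_measurable_integrable bounded_borel_integrable)
        \<comment> \<open>By disjointness a point lies in at most one \<open>S n\<close>, and it
          leaves the tails once \<open>K\<close> exceeds that index.\<close>
        have ev: "\<forall>\<^sub>F K in sequentially. t \<notin> R K" for t
        proof (cases "\<exists>n. t \<in> S n")
          case True
          then obtain n where n: "t \<in> S n" by blast
          have *: "t \<notin> S m" if "m > n" for m
            using disjoint_family_onD[OF disj, of n m] that n by auto
          have "t \<notin> R K" if "K > n" for K
            using that * by (auto simp: R_def)
          then show ?thesis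
            using eventually_gt_at_top[of n] by (rule eventually_mono[rotated])
        qed (auto simp: R_def)
        show "AE \<theta> in angle. (\<lambda>K. indicator (R K) (cos \<theta>) * \<phi> n \<theta> * \<phi> n \<theta>) \<longlonglongrightarrow> 0"
        proof (intro AE_I2 tendsto_eventually)
          show "\<forall>\<^sub>F K in sequentially. indicator (R K) (cos \<theta>) * \<phi> n \<theta> * \<phi> n \<theta> = 0" for \<theta>
            using ev[of "cos \<theta>"] by eventually_elim simp
        qed
        have "\<bar>\<phi> n \<theta> * \<phi> n \<theta>\<bar> \<le> 1" for \<theta>
          using mult_mono[OF abs_phi_le abs_phi_le, of n \<theta> n \<theta>] by (simp add: abs_mult)
        then show "AE \<theta> in angle. norm (indicator (R K) (cos \<theta>) * \<phi> n \<theta> * \<phi> n \<theta>) \<le> 1" for K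
          by (intro AE_I2) (simp add: indicator_def)
        show "integrable angle (\<lambda>_. 1 :: real)" by (rule bounded_borel_integrable) simp
      qed simp
      \<comment> \<open>For an orthogonal projection the squared norm of the image of a basis vector
        is a diagonal entry, here an integral with limit 0.\<close>
      have "(norm (proj (R K) (ket n)))\<^sup>2 = entry (indicator (R K)) n n" for K
        unfolding Re_cinner_proj[OF R, symmetric] cinner_ket
        by (simp add: proj_def op_def
            Rep_mat_op_ket[OF bounded_matrix_entry[OF bounded_symbol_indicator[OF R]]])
      with entry_lim have "(\<lambda>K. sqrt ((norm (proj (R K) (ket n)))\<^sup>2)) \<longlonglongrightarrow> sqrt 0"
        by (intro tendsto_real_sqrt) simp
      then have lim: "(\<lambda>K. proj (R K) (ket n)) \<longlonglongrightarrow> 0"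
        by (simp add: tendsto_norm_zero_iff)
      have "bounded_clinear (\<lambda>x :: ell2. c *\<^sub>C x)"
        by (rule bounded_clinear_scaleC[OF bounded_clinear_id])
      then have "bounded_linear (\<lambda>x :: ell2. c *\<^sub>C x)" by (simp add: bounded_clinear_def)
      from bounded_linear.tendsto[OF this lim] show ?thesis
        using bounded_clinear_proj[OF R] by (simp add: bounded_clinear_def)
    qed
  qed
  then have "(\<lambda>K. proj (\<Union>n. S n) x - proj (R K) x) \<longlonglongrightarrow> proj (\<Union>n. S n) x - 0"
    by (intro tendsto_intros)
  then show ?thesis unfolding sums_def partial by simp
qed

lemma spectral_measure_proj: "spectral_measure proj"
  unfolding spectral_measure_def
  by (simp add: bounded_clinear_proj proj_idem proj_symmetric proj_UNIV proj_sums)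

section \<open>Scalar measures and spectral integrals\<close>

lemma
  shows sets_scalar_measure [simp]: "sets (scalar_measure proj x) = sets borel"
    and space_scalar_measure [simp]: "space (scalar_measure proj x) = UNIV"
    and emeasure_scalar_measure:
      "S \<in> sets borel \<Longrightarrow> emeasure (scalar_measure proj x) S = ennreal (Re (cinner (proj S x) x))"
proof -
  have sa: "sigma_algebra UNIV (sets borel :: real set set)"
    using sets.sigma_algebra_axioms[of "borel :: real measure"] by simp
  show "sets (scalar_measure proj x) = sets borel"
    unfolding scalar_measure_def using sa
    by (simp add: sigma_algebra.sigma_sets_eq)
  show "space (scalar_measure proj x) = UNIV"
    unfolding scalar_measure_def by (simp add: space_measure_of_conv)
  assume S: "S \<in> sets borel"
  show "emeasure (scalar_measure proj x) S = ennreal (Re (cinner (proj S x) x))"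
    unfolding scalar_measure_def
  proof (rule emeasure_measure_of_sigma[OF sa _ _ S])
    have "proj {} x = 0"
    proof -
      have *: "indicator {} = (\<lambda>t. indicator UNIV t - indicator UNIV t :: real)"
        by (rule ext) simp
      show ?thesis
        unfolding proj_def *
        by (subst op_diff[OF bounded_symbol_indicator bounded_symbol_indicator]) simp_all
    qed
    then show "positive (sets borel) (\<lambda>S. ennreal (Re (cinner (proj S x) x)))"
      using linear_0[OF bounded_linear.linear[OF bounded_linear_cinner_left[of x]]]
      by (simp add: positive_def)
    show "countably_additive (sets borel) (\<lambda>S. ennreal (Re (cinner (proj S x) x)))"
    proof (rule countably_additiveI)
      fix A :: "nat \<Rightarrow> real set"
      assume A: "range A \<subseteq> sets borel" "disjoint_family A" "\<Union> (range A) \<in> sets borel"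
      have "bounded_linear (\<lambda>y. Re (cinner y x))"
        by (intro bounded_linear_compose[OF bounded_linear_Re] bounded_linear_cinner_left)
      from bounded_linear.sums[OF this proj_sums[OF A(1,2), of x]]
      show "(\<Sum>i. ennreal (Re (cinner (proj (A i) x) x)))
          = ennreal (Re (cinner (proj (\<Union> (range A)) x) x))"
        using A(1) by (intro suminf_ennreal_eq) (auto simp: Re_cinner_proj)
    qed
  qed
qed

lemma measurable_scalar_measure:
  "g \<in> borel_measurable borel \<Longrightarrow> g \<in> borel_measurable (scalar_measure proj x)"
  by (simp cong: measurable_cong_sets)

lemma finite_measure_scalar_measure: "finite_measure (scalar_measure proj x)"
  by (rule finite_measureI) (simp add: emeasure_scalar_measure)

lemma measure_scalar_measure:
  "S \<in> sets borel \<Longrightarrow> measure (scalar_measure proj x) S = Re (cinner (proj S x) x)"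
  by (simp add: measure_def emeasure_scalar_measure Re_cinner_proj)

text \<open>A symbol acts only through its values at \<open>cos \<theta>\<close>, so the projection
  for the complement of this interval is 0. Bounds in the sense of \<open>bounded_symbol\<close>
  therefore control integrals over the whole line.\<close>

lemma AE_scalar_measure: "AE t in scalar_measure proj x. t \<in> {-1..1}"
proof (rule AE_I)
  have m: "- {-1..1::real} \<in> sets borel" by simp
  have "entry (indicator (- {-1..1})) = entry (\<lambda>t. 0)"
    by (rule entry_cong) simp
  then have "entry (indicator (- {-1..1})) k n = 0" for k n
    by (simp add: entry_def)
  then have "proj (- {-1..1}) (ket n) = 0" for n
    by (intro ell2_eqI)
      (simp add: proj_def op_def
        Rep_mat_op_ket[OF bounded_matrix_entry[OF bounded_symbol_indicator[OF m]]])
  then have "proj (- {-1..1}) x = 0"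
    using bounded_clinear_eqI[OF bounded_clinear_proj[OF m] bounded_clinear_zero] by blast
  then show "emeasure (scalar_measure proj x) (- {-1..1}) = 0"
    using m Re_cinner_proj[OF m, of x] by (simp add: emeasure_scalar_measure)
qed auto

text \<open>For step functions both sides are the same finite sum of measures. Rounding
  \<open>g\<close> down to multiples of \<open>1 / n\<close> moves the symbol by at most
  \<open>1 / n\<close> on the interval, hence either side by at most
  \<open>(norm x)\<^sup>2 / n\<close>.\<close>

lemma cinner_op_eq_integral:
  assumes g: "bounded_symbol C g"
  shows "Re (cinner (op g x) x) = (LINT t|scalar_measure proj x. g t)"
proof -
  let ?\<mu> = "scalar_measure proj x"
  interpret finite_measure ?\<mu> by (rule finite_measure_scalar_measure)
  have C: "0 \<le> C" by (rule bounded_symbol_nonneg[OF g])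
  have gm: "g \<in> borel_measurable borel" using g by (simp add: bounded_symbol_def)
  have total: "measure ?\<mu> UNIV = (norm x)\<^sup>2"
    by (simp add: measure_scalar_measure proj_UNIV norm_power2_eq_cinner)
  have gi: "integrable ?\<mu> g"
    using AE_scalar_measure[of x] g gm
    by (intro integrable_const_bound[where B = C]) (auto simp: bounded_symbol_def intro: measurable_scalar_measure)
  have "\<bar>Re (cinner (op g x) x) - (LINT t|?\<mu>. g t)\<bar> \<le> 2 * (norm x)\<^sup>2 / real (Suc N)" for N
  proof -
    define n where "n = real (Suc N)"
    have n: "0 < n" by (simp add: n_def)
    define S where "S i = {t\<in>{-1..1}. \<lfloor>n * g t\<rfloor> = i}" for i
    \<comment> \<open>A finite range containing every floor of \<open>n * g t\<close>, since
      \<open>g\<close> is bounded by \<open>C\<close> there; it makes \<open>h\<close> a step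
      function.\<close>
    define I where "I = {- \<lceil>n * C\<rceil> - 1 .. \<lceil>n * C\<rceil>}"
    define h where "h t = (\<Sum>i\<in>I. (real_of_int i / n) * indicator (S i) t)" for t
    have S: "S i \<in> sets borel" for i
    proof -
      have "(\<lambda>t. \<lfloor>n * g t\<rfloor>) \<in> measurable borel (count_space UNIV)"
        using gm by measurable
      then have "(\<lambda>t. \<lfloor>n * g t\<rfloor>) -` {i} \<inter> space borel \<in> sets borel"
        by (rule measurable_sets) simp
      moreover have "S i = ((\<lambda>t. \<lfloor>n * g t\<rfloor>) -` {i} \<inter> space borel) \<inter> {-1..1}"
        by (auto simp: S_def)
      ultimately show ?thesis by auto
    qed
    have h_eq: "h t = real_of_int \<lfloor>n * g t\<rfloor> / n" if t: "t \<in> {-1..1}" for t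
    proof -
      have "\<bar>n * g t\<bar> \<le> n * C"
        using g t n by (simp add: bounded_symbol_def abs_mult)
      then have "\<lfloor>n * g t\<rfloor> \<in> I"
        unfolding I_def by simp linarith
      moreover have "h t = (\<Sum>i\<in>I. if i = \<lfloor>n * g t\<rfloor> then real_of_int i / n else 0)"
        unfolding h_def using t by (intro sum.cong) (auto simp: S_def indicator_def)
      ultimately show ?thesis by (simp add: I_def)
    qed
    have gh: "\<bar>g t - h t\<bar> \<le> 1 / n" if t: "t \<in> {-1..1}" for t
    proof -
      have "\<bar>n * g t - real_of_int \<lfloor>n * g t\<rfloor>\<bar> \<le> 1" by linarith
      then have "\<bar>n * g t - real_of_int \<lfloor>n * g t\<rfloor>\<bar> / n \<le> 1 / n"
        using n by (intro divide_right_mono) auto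
      moreover have "g t - h t = (n * g t - real_of_int \<lfloor>n * g t\<rfloor>) / n"
        using n by (simp add: h_eq[OF t] diff_divide_distrib)
      ultimately show ?thesis using n by (simp only: abs_divide abs_of_pos)
    qed
    have hm: "h \<in> borel_measurable borel"
      unfolding h_def using S by measurable
    have dg: "bounded_symbol (1 / n) (\<lambda>t. g t - h t)"
      using gh gm hm by (simp add: bounded_symbol_def)
    have hb: "bounded_symbol (C + 1 / n) h"
      using bounded_symbol_add[OF g bounded_symbol_minus[OF dg]] by simp
    have "op h x = (\<Sum>i\<in>I. complex_of_real (real_of_int i / n) *\<^sub>C proj (S i) x)"
      using hb S unfolding proj_def h_def
      by (intro op_linear_combination[of _ "\<lambda>_. 1"]) auto
    then have "Re (cinner (op h x) x) = (\<Sum>i\<in>I. real_of_int i / n * Re (cinner (proj (S i) x) x))"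
      by (simp add: linear_sum[OF bounded_linear.linear[OF bounded_linear_cinner_left[of x]]]
          cinner_scaleC_left)
    also have "\<dots> = (LINT t|?\<mu>. h t)"
    proof -
      have "integrable ?\<mu> (\<lambda>t. indicator (S i) t :: real)" for i
        using S by (intro integrable_real_indicator) (auto simp: emeasure_eq_measure)
      then show ?thesis
        unfolding h_def using S by (simp add: measure_scalar_measure)
    qed
    finally have h: "Re (cinner (op h x) x) = (LINT t|?\<mu>. h t)" .
    have "\<bar>Re (cinner (op g x) x) - Re (cinner (op h x) x)\<bar> \<le> (norm x)\<^sup>2 / n"
    proof -
      have "cinner (op g x) x - cinner (op h x) x = cinner (op (\<lambda>t. g t - h t) x) x"
        using linear_diff[OF bounded_linear.linear[OF bounded_linear_cinner_left[of x]]]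
        by (simp add: op_diff[OF g hb])
      then have "\<bar>Re (cinner (op g x) x) - Re (cinner (op h x) x)\<bar>
          \<le> cmod (cinner (op (\<lambda>t. g t - h t) x) x)"
        by (metis abs_Re_le_cmod minus_complex.sel(1))
      also have "\<dots> \<le> norm (op (\<lambda>t. g t - h t) x) * norm x"
        by (rule norm_cinner_le)
      also have "\<dots> \<le> (1 / n * norm x) * norm x"
        by (intro mult_right_mono norm_op_le[OF dg]) simp
      finally show ?thesis by (simp add: power2_eq_square)
    qed
    moreover have "\<bar>(LINT t|?\<mu>. g t) - (LINT t|?\<mu>. h t)\<bar> \<le> (norm x)\<^sup>2 / n"
    proof -
      have hi: "integrable ?\<mu> h"
        using AE_scalar_measure[of x] hb hm
        by (intro integrable_const_bound[where B = "C + 1 / n"])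
          (auto simp: bounded_symbol_def intro: measurable_scalar_measure)
      have "(LINT t|?\<mu>. g t) - (LINT t|?\<mu>. h t) = (LINT t|?\<mu>. g t - h t)"
        using gi hi by simp
      also have "\<bar>\<dots>\<bar> \<le> (LINT t|?\<mu>. \<bar>g t - h t\<bar>)"
        by (rule integral_abs_bound)
      also have "\<dots> \<le> (LINT t|?\<mu>. 1 / n)"
      proof (rule integral_mono_AE)
        show "AE t in ?\<mu>. \<bar>g t - h t\<bar> \<le> 1 / n"
          using AE_scalar_measure by (rule eventually_mono) (rule gh)
      qed (use gi hi in auto)
      also have "\<dots> = (norm x)\<^sup>2 / n" by (simp add: total)
      finally show ?thesis .
    qed
    ultimately show ?thesis unfolding h n_def[symmetric] by (simp add: field_simps)
  qed
  then have "\<bar>Re (cinner (op g x) x) - (LINT t|?\<mu>. g t)\<bar> \<le> 0"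
  proof (intro LIMSEQ_le_const)
    show "(\<lambda>N. 2 * (norm x)\<^sup>2 / real (Suc N)) \<longlonglongrightarrow> 0"
      using LIMSEQ_Suc[OF lim_const_over_n[of "2 * (norm x)\<^sup>2"]] by simp
  qed blast
  then show ?thesis by simp
qed

lemma is_spectral_integral_op:
  assumes g: "bounded_symbol C g"
  shows "is_spectral_integral proj (\<lambda>t. complex_of_real (g t)) (\<lambda>x. Some (op g x))"
  unfolding is_spectral_integral_def
proof (intro conjI ballI)
  have gm: "g \<in> borel_measurable borel" using g by (simp add: bounded_symbol_def)
  then show "(\<lambda>t. complex_of_real (g t)) \<in> borel_measurable borel" by measurable
  show "linear_op (\<lambda>x. Some (op g x))" by (rule linear_op_Some[OF bounded_clinear_op[OF g]])
  show "cinner (the (Some (op g x))) x = (LINT t|scalar_measure proj x. complex_of_real (g t))" for x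
  proof -
    \<comment> \<open>Symmetry makes the quadratic form real, so the identity for real parts is
      enough.\<close>
    have "cnj (cinner (op g x) x) = cinner (op g x) x"
      by (metis cinner_commute op_symmetric[OF g])
    then have "cinner (op g x) x = complex_of_real (Re (cinner (op g x) x))"
      by (simp add: complex_eq_iff)
    then show ?thesis by (simp add: cinner_op_eq_integral[OF g])
  qed
  have "(\<integral>\<^sup>+t. ennreal ((cmod (complex_of_real (g t)))\<^sup>2) \<partial>scalar_measure proj x) < \<infinity>" for x
  proof -
    interpret finite_measure "scalar_measure proj x" by (rule finite_measure_scalar_measure)
    have "(\<integral>\<^sup>+t. ennreal ((cmod (complex_of_real (g t)))\<^sup>2) \<partial>scalar_measure proj x)
       \<le> (\<integral>\<^sup>+t. ennreal (C\<^sup>2) \<partial>scalar_measure proj x)"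
    proof (rule nn_integral_mono_AE)
      show "AE t in scalar_measure proj x. ennreal ((cmod (complex_of_real (g t)))\<^sup>2) \<le> ennreal (C\<^sup>2)"
        using AE_scalar_measure[of x]
      proof eventually_elim
        case (elim t)
        then have "\<bar>g t\<bar> \<le> C" using g by (auto simp: bounded_symbol_def)
        from power_mono[OF this, of 2] show ?case by (auto intro: ennreal_leI)
      qed
    qed
    also have "\<dots> < \<infinity>"
    proof -
      have "emeasure (scalar_measure proj x) UNIV < top"
        by (rule top.not_eq_extremum[THEN iffD1, OF emeasure_finite])
      then show ?thesis by (simp add: ennreal_mult_less_top)
    qed
    finally show ?thesis .
  qed
  then show "dom (\<lambda>x. Some (op g x)) =
      {x. (\<integral>\<^sup>+t. ennreal ((cmod (complex_of_real (g t)))\<^sup>2) \<partial>scalar_measure proj x) < \<infinity>}"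
    by auto
qed

lemma self_adjoint_op: "bounded_symbol C g \<Longrightarrow> self_adjoint (\<lambda>x. Some (op g x))"
  by (intro self_adjoint_Some bounded_clinear_op op_symmetric)

lemma is_functional_calculus_op:
  assumes "bounded_symbol C g"
  shows "is_functional_calculus (\<lambda>t. complex_of_real (g t)) (\<lambda>x. Some (op (\<lambda>t. t) x))
    (\<lambda>x. Some (op g x))"
  unfolding is_functional_calculus_def
  using spectral_measure_proj is_spectral_integral_op[OF assms]
    is_spectral_integral_op[OF bounded_symbol_ident] by blast

end


section \<open>The Dirichlet and Neumann systems\<close>

lemma bounded_borel_continuous:
  assumes "continuous_on UNIV u" "\<And>t. \<bar>u t\<bar> \<le> C"
  shows "bounded_borel u"
  using assms by (auto simp: bounded_borel_def intro!: borel_measurable_continuous_onI)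

lemma bounded_borel_cos_mult [simp]: "bounded_borel (\<lambda>\<theta>. cos (a * \<theta>))"
  by (rule bounded_borel_continuous[where C = 1]) (auto intro!: continuous_intros)

lemma integral_cos_multiple:
  "(LINT \<theta>|angle. cos (real_of_int i * \<theta>)) = (if i = 0 then pi else 0)"
proof (cases "i = 0")
  case True
  then show ?thesis by (simp add: angle_def measure_restrict_space)
next
  case False
  have "((\<lambda>\<theta>. cos (real_of_int i * \<theta>)) has_integral
      sin (real_of_int i * pi) / real_of_int i - sin (real_of_int i * 0) / real_of_int i) {0..pi}"
    using False
    by (intro fundamental_theorem_of_calculus)
      (auto intro!: derivative_eq_intros simp flip: has_real_derivative_iff_has_vector_derivative)
  moreover have "sin (real_of_int i * pi) = 0"
    using sin_zero_iff_int2 by blast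
  ultimately have "integral {0..pi} (\<lambda>\<theta>. cos (real_of_int i * \<theta>)) = 0"
    by (simp add: integral_unique)
  then show ?thesis
    using False bounded_borel_integrable[OF bounded_borel_cos_mult[of "real_of_int i"]]
    unfolding angle_def by (subst lebesgue_integral_eq_integral) auto
qed

lemma integral_cos_cos:
  "(LINT \<theta>|angle. cos (real_of_int i * \<theta>) * cos (real_of_int j * \<theta>))
     = ((if i = j then pi else 0) + (if i + j = 0 then pi else 0)) / 2"
proof -
  have "cos (real_of_int i * \<theta>) * cos (real_of_int j * \<theta>)
      = (cos (real_of_int (i - j) * \<theta>) + cos (real_of_int (i + j) * \<theta>)) / 2" for \<theta>
    by (simp add: cos_times_cos algebra_simps)
  then have "(LINT \<theta>|angle. cos (real_of_int i * \<theta>) * cos (real_of_int j * \<theta>))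
      = (LINT \<theta>|angle. (cos (real_of_int (i - j) * \<theta>) + cos (real_of_int (i + j) * \<theta>)) / 2)"
    by (simp only:)
  also have "\<dots> = ((LINT \<theta>|angle. cos (real_of_int (i - j) * \<theta>))
        + (LINT \<theta>|angle. cos (real_of_int (i + j) * \<theta>))) / 2"
    by (simp del: of_int_add of_int_diff)
  finally show ?thesis
    unfolding integral_cos_multiple by simp
qed

definition dirichlet :: "nat \<Rightarrow> real \<Rightarrow> real" where
  "dirichlet n \<theta> = sqrt (2 / pi) * sin ((real n + 1) * \<theta>)"

definition neumann :: "nat \<Rightarrow> real \<Rightarrow> real" where
  "neumann n \<theta> = sqrt (2 / pi) * cos ((real n + 1 / 2) * \<theta>)"

lemma sqrt_two_over_pi: "sqrt (2 / pi) * sqrt (2 / pi) = 2 / pi" "0 \<le> sqrt (2 / pi)"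
    "sqrt (2 / pi) \<le> 1"
  using pi_ge_two by (simp_all del: real_sqrt_divide)

lemma dirichlet_product:
  "dirichlet m \<theta> * dirichlet n \<theta> =
    (cos (real_of_int (int m - int n) * \<theta>) - cos (real_of_int (int m + int n + 2) * \<theta>)) / pi"
proof -
  have "dirichlet m \<theta> * dirichlet n \<theta>
      = (sqrt (2 / pi) * sqrt (2 / pi)) * (sin ((real m + 1) * \<theta>) * sin ((real n + 1) * \<theta>))"
    unfolding dirichlet_def by (simp only: ac_simps)
  then show ?thesis
    unfolding sqrt_two_over_pi(1) sin_times_sin
    by (simp add: diff_divide_distrib) (simp add: algebra_simps)
qed

lemma neumann_product:
  "neumann m \<theta> * neumann n \<theta> =
    (cos (real_of_int (int m - int n) * \<theta>) + cos (real_of_int (int m + int n + 1) * \<theta>)) / pi"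
proof -
  have "neumann m \<theta> * neumann n \<theta>
      = (sqrt (2 / pi) * sqrt (2 / pi)) * (cos ((real m + 1 / 2) * \<theta>) * cos ((real n + 1 / 2) * \<theta>))"
    unfolding neumann_def by (simp only: ac_simps)
  then show ?thesis
    unfolding sqrt_two_over_pi(1) cos_times_cos
    by (simp add: add_divide_distrib) (simp add: algebra_simps)
qed

global_interpretation dirichlet: cosine_system dirichlet 0
proof
  show "continuous_on UNIV (dirichlet n)" for n
    unfolding dirichlet_def by (intro continuous_intros)
  show "\<bar>dirichlet n \<theta>\<bar> \<le> 1" for n \<theta>
    unfolding dirichlet_def abs_mult using sqrt_two_over_pi by (intro mult_le_one) auto
  show "dirichlet (Suc 0) \<theta> = (2 * cos \<theta> - 0) * dirichlet 0 \<theta>" for \<theta>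
    using sin_double[of \<theta>] by (simp add: dirichlet_def)
  show "dirichlet (Suc (Suc n)) \<theta> = 2 * cos \<theta> * dirichlet (Suc n) \<theta> - dirichlet n \<theta>" for n \<theta>
  proof -
    have *: "(real (Suc (Suc n)) + 1) * \<theta> = (real (Suc n) + 1) * \<theta> + \<theta>"
      "(real n + 1) * \<theta> = (real (Suc n) + 1) * \<theta> - \<theta>"
      by (simp_all add: algebra_simps)
    show ?thesis
      unfolding dirichlet_def * sin_add sin_diff by algebra
  qed
  show "(LINT \<theta>|angle. dirichlet m \<theta> * dirichlet n \<theta>) = (if m = n then 1 else 0)" for m n
  proof -
    have "(LINT \<theta>|angle. dirichlet m \<theta> * dirichlet n \<theta>)
        = ((LINT \<theta>|angle. cos (real_of_int (int m - int n) * \<theta>))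
          - (LINT \<theta>|angle. cos (real_of_int (int m + int n + 2) * \<theta>))) / pi"
      unfolding dirichlet_product by simp
    then show ?thesis unfolding integral_cos_multiple by auto
  qed
qed

global_interpretation neumann: cosine_system neumann 1
proof
  show "continuous_on UNIV (neumann n)" for n
    unfolding neumann_def by (intro continuous_intros)
  show "\<bar>neumann n \<theta>\<bar> \<le> 1" for n \<theta>
    unfolding neumann_def abs_mult using sqrt_two_over_pi by (intro mult_le_one) auto
  show "neumann (Suc 0) \<theta> = (2 * cos \<theta> - 1) * neumann 0 \<theta>" for \<theta>
  proof -
    have *: "(real (Suc 0) + 1 / 2) * \<theta> = \<theta> + (real 0 + 1 / 2) * \<theta>"
      by (simp add: algebra_simps)
    have "2 * cos \<theta> * cos (\<theta> / 2) = cos (\<theta> + \<theta> / 2) + cos (\<theta> - \<theta> / 2)"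
      unfolding cos_add cos_diff by simp
    then show ?thesis
      unfolding neumann_def * by (simp add: algebra_simps)
  qed
  show "neumann (Suc (Suc n)) \<theta> = 2 * cos \<theta> * neumann (Suc n) \<theta> - neumann n \<theta>" for n \<theta>
  proof -
    have *: "(real (Suc (Suc n)) + 1 / 2) * \<theta> = (real (Suc n) + 1 / 2) * \<theta> + \<theta>"
      "(real n + 1 / 2) * \<theta> = (real (Suc n) + 1 / 2) * \<theta> - \<theta>"
      by (simp_all add: algebra_simps)
    show ?thesis
      unfolding neumann_def * cos_add cos_diff by algebra
  qed
  show "(LINT \<theta>|angle. neumann m \<theta> * neumann n \<theta>) = (if m = n then 1 else 0)" for m n
  proof -
    have "(LINT \<theta>|angle. neumann m \<theta> * neumann n \<theta>)
        = ((LINT \<theta>|angle. cos (real_of_int (int m - int n) * \<theta>))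
          + (LINT \<theta>|angle. cos (real_of_int (int m + int n + 1) * \<theta>))) / pi"
      unfolding neumann_product by simp
    then show ?thesis unfolding integral_cos_multiple by auto
  qed
qed

text \<open>Both products contain the same Toeplitz term \<open>cos ((m - n) * \<theta>)\<close>,
  which cancels. The remaining terms carry opposite signs, so in the difference the two Hankel parts
  add up.\<close>

lemma entry_neumann_minus_dirichlet:
  assumes g: "bounded_symbol C g"
  shows "neumann.entry g m n - dirichlet.entry g m n =
    (LINT \<theta>|angle. g (cos \<theta>) * (cos (real_of_int (int m + int n + 1) * \<theta>)
      + cos (real_of_int (int m + int n + 2) * \<theta>))) / pi"
proof -
  have gb: "bounded_borel (\<lambda>\<theta>. g (cos \<theta>))" by (rule bounded_borel_cos[OF g])
  have "neumann.entry g m n - dirichlet.entry g m n =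
      (LINT \<theta>|angle. g (cos \<theta>) * neumann m \<theta> * neumann n \<theta>
        - g (cos \<theta>) * dirichlet m \<theta> * dirichlet n \<theta>)"
    unfolding neumann.entry_def dirichlet.entry_def using gb
    by (intro Bochner_Integration.integral_diff[symmetric] bounded_borel_integrable
        bounded_borel_mult dirichlet.bounded_borel_phi neumann.bounded_borel_phi)
  also have "\<dots> = (LINT \<theta>|angle. g (cos \<theta>) * (cos (real_of_int (int m + int n + 1) * \<theta>)
      + cos (real_of_int (int m + int n + 2) * \<theta>)) / pi)"
    unfolding mult.assoc neumann_product dirichlet_product
    by (intro Bochner_Integration.integral_cong refl) (simp add: field_simps)
  finally show ?thesis by simp
qed


section \<open>A rank one perturbation\<close>

lemma bounded_clinear_coordinate: "bounded_clinear (\<lambda>x. Rep_ell2 x n *\<^sub>C ket n)"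
proof -
  have norm: "norm (Rep_ell2 x n *\<^sub>C ket n) \<le> norm x" for x
  proof -
    have "(norm (Rep_ell2 x n *\<^sub>C ket n))\<^sup>2 = (cmod (Rep_ell2 x n))\<^sup>2"
      using norm_sum_ket[of "\<lambda>_. n" 1 "\<lambda>_. Rep_ell2 x n"] by (simp add: inj_on_def)
    also have "\<dots> \<le> (norm x)\<^sup>2" by (intro power_mono ell2_coord_le_norm) simp
    finally show ?thesis by (rule power2_le_imp_le) simp
  qed
  have "bounded_linear (\<lambda>x. Rep_ell2 x n *\<^sub>C ket n)"
    by (rule bounded_linear_intro[of _ 1])
      (auto simp: norm scaleC_add_left scaleR_scaleC scaleC_scaleC)
  then show ?thesis by (simp add: bounded_clinear_def scaleC_scaleC)
qed

text \<open>The symbol is \<open>cos \<theta>\<close>, of frequency 1, and meets the frequencies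
  \<open>m + n + 1\<close> and \<open>m + n + 2\<close>. Orthogonality leaves only the entry
  \<open>m = n = 0\<close>, with value \<open>(pi / 2) / pi\<close>.\<close>

lemma neumann_minus_dirichlet_ident:
  "neumann.op (\<lambda>t. t) x - dirichlet.op (\<lambda>t. t) x = (1 / 2) *\<^sub>C (Rep_ell2 x 0 *\<^sub>C ket 0)"
proof (rule bounded_clinear_eqI[of "\<lambda>x. neumann.op (\<lambda>t. t) x - dirichlet.op (\<lambda>t. t) x"
      "\<lambda>x. (1 / 2) *\<^sub>C (Rep_ell2 x 0 *\<^sub>C ket 0)"])
  have "neumann.entry (\<lambda>t. t) m n - dirichlet.entry (\<lambda>t. t) m n
      = (if m = 0 \<and> n = 0 then 1 / 2 else 0)" for m n
  proof -
    have "neumann.entry (\<lambda>t. t) m n - dirichlet.entry (\<lambda>t. t) m n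
      = (LINT \<theta>|angle. cos (real_of_int 1 * \<theta>) * cos (real_of_int (int m + int n + 1) * \<theta>)
          + cos (real_of_int 1 * \<theta>) * cos (real_of_int (int m + int n + 2) * \<theta>)) / pi"
      unfolding entry_neumann_minus_dirichlet[OF bounded_symbol_ident]
      by (simp add: distrib_left)
    also have "\<dots> = ((LINT \<theta>|angle. cos (real_of_int 1 * \<theta>) * cos (real_of_int (int m + int n + 1) * \<theta>))
          + (LINT \<theta>|angle. cos (real_of_int 1 * \<theta>) * cos (real_of_int (int m + int n + 2) * \<theta>))) / pi"
      by (subst Bochner_Integration.integral_add)
        (intro refl bounded_borel_integrable bounded_borel_mult bounded_borel_cos_mult)+
    finally show ?thesis unfolding integral_cos_cos by auto
  qed
  then have "complex_of_real (neumann.entry (\<lambda>t. t) m n) - complex_of_real (dirichlet.entry (\<lambda>t. t) m n)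
      = (if m = 0 \<and> n = 0 then 1 / 2 else 0)" for m n
    by (metis (mono_tags, lifting) of_real_0 of_real_1 of_real_diff of_real_divide of_real_numeral)
  then show "neumann.op (\<lambda>t. t) (ket n) - dirichlet.op (\<lambda>t. t) (ket n)
      = (1 / 2) *\<^sub>C (Rep_ell2 (ket n) 0 *\<^sub>C ket 0)" for n
    unfolding neumann.op_def dirichlet.op_def
    by (intro ell2_eqI)
      (auto simp: Rep_mat_op_ket[OF neumann.bounded_matrix_entry[OF bounded_symbol_ident]]
        Rep_mat_op_ket[OF dirichlet.bounded_matrix_entry[OF bounded_symbol_ident]])
  show "bounded_clinear (\<lambda>x. neumann.op (\<lambda>t. t) x - dirichlet.op (\<lambda>t. t) x)"
    by (rule bounded_clinear_diff[OF neumann.bounded_clinear_op[OF bounded_symbol_ident]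
          dirichlet.bounded_clinear_op[OF bounded_symbol_ident]])
  show "bounded_clinear (\<lambda>x. (1 / 2) *\<^sub>C (Rep_ell2 x 0 *\<^sub>C ket 0))"
    by (rule bounded_clinear_scaleC[OF bounded_clinear_coordinate])
qed

lemma op_rank_neumann_minus_dirichlet:
  "op_rank (\<lambda>x. neumann.op (\<lambda>t. t) x - dirichlet.op (\<lambda>t. t) x) = 1"
proof -
  let ?K = "\<lambda>x. neumann.op (\<lambda>t. t) x - dirichlet.op (\<lambda>t. t) x"
  have ne: "ket 0 \<noteq> 0" by (metis Rep_ell2_zero Rep_ket zero_neq_one)
  \<comment> \<open>The factor 2 undoes the coefficient 1/2, so every multiple of
    \<open>ket 0\<close> is attained.\<close>
  have "?K ((2 * c) *\<^sub>C ket 0) = c *\<^sub>C ket 0" for c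
    by (simp add: neumann_minus_dirichlet_ident)
  from this[symmetric] have "c *\<^sub>C ket 0 \<in> range ?K" for c
    by (rule range_eqI)
  moreover have "?K x = (Rep_ell2 x 0 / 2) *\<^sub>C ket 0" for x
    by (simp add: neumann_minus_dirichlet_ident)
  ultimately have "range ?K = complex_vector.span {ket 0}"
    unfolding complex_vector.span_singleton by auto
  then show ?thesis
    using ne complex_vector.dim_span_eq_card_independent[of "{ket 0}"]
    by (auto simp: op_rank_def one_enat_def intro!: exI[of _ "{ket 0}"])
qed


section \<open>Lacunary symbols\<close>

text \<open>The function \<open>f\<close> lives on the whole line and needs a global modulus of
  continuity. Clipping is 1-Lipschitz, so estimates in the interval extend to the line with the same
  constants.\<close>

definition clipped_arccos :: "real \<Rightarrow> real" where
  "clipped_arccos x = arccos (max (-1) (min 1 x))"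

definition wave :: "nat \<Rightarrow> real \<Rightarrow> real" where
  "wave k x = cos (real_of_int (int k - 1) * clipped_arccos x)
     - cos (real_of_int (int k + 1) * clipped_arccos x)"

definition lacunary :: "(nat \<Rightarrow> real) \<Rightarrow> real \<Rightarrow> real" where
  "lacunary c x = (\<Sum>j. c j * wave (4 * 2 ^ j) x)"

section \<open>Size and modulus of continuity of lacunary series\<close>

lemma clipped_arccos_cos: "\<theta> \<in> {0..pi} \<Longrightarrow> clipped_arccos (cos \<theta>) = \<theta>"
  by (simp add: clipped_arccos_def arccos_cos)

lemma wave_measurable: "wave k \<in> borel_measurable borel"
proof -
  have "continuous_on UNIV clipped_arccos"
    unfolding clipped_arccos_def
    by (intro continuous_on_arccos continuous_intros) auto
  then show ?thesis
    unfolding wave_def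
    by (intro borel_measurable_continuous_onI continuous_intros)
qed

lemma abs_wave_le: "\<bar>wave k x\<bar> \<le> 2"
  unfolding wave_def
  by (rule order_trans[OF abs_triangle_ineq4])
    (use add_mono[OF abs_cos_le_one abs_cos_le_one] in auto)

lemma abs_sin_multiple_le: "\<bar>sin (real k * t)\<bar> \<le> real k * \<bar>sin t\<bar>"
proof (induction k)
  case (Suc k)
  have "sin (real (Suc k) * t) = sin (real k * t) * cos t + cos (real k * t) * sin t"
    by (simp add: distrib_right sin_add)
  also have "\<bar>\<dots>\<bar> \<le> \<bar>sin (real k * t)\<bar> * \<bar>cos t\<bar> + \<bar>cos (real k * t)\<bar> * \<bar>sin t\<bar>"
    by (metis abs_mult abs_triangle_ineq)
  also have "\<dots> \<le> \<bar>sin (real k * t)\<bar> * 1 + 1 * \<bar>sin t\<bar>"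
    by (intro add_mono mult_left_mono mult_right_mono) auto
  finally show ?case using Suc by (simp add: distrib_right)
qed simp

text \<open>The factor \<open>sin \<theta>\<close> in \<open>cos ((k - 1) \<theta>) - cos ((k + 1) \<theta>) = 2 sin \<theta> sin (k \<theta>)\<close> compensates the
  square root singularity of \<open>arccos\<close> at the end points: the Lipschitz constant in \<open>cos \<theta>\<close> is of
  order \<open>k\<close> instead of \<open>k\<^sup>2\<close>.\<close>

lemma wave_angle_lipschitz:
  "\<bar>(cos ((real k - 1) * \<theta>) - cos ((real k + 1) * \<theta>)) - (cos ((real k - 1) * \<eta>) - cos ((real k + 1) * \<eta>))\<bar>
     \<le> 4 * real k * \<bar>cos \<theta> - cos \<eta>\<bar>"
proof -
  \<comment> \<open>Half sum and half difference turn differences of cosines into products of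
    sines.\<close>
  define a b where "a = (\<theta> + \<eta>) / 2" and "b = (\<theta> - \<eta>) / 2"
  have ab: "\<theta> = a + b" "\<eta> = a - b" by (simp_all add: a_def b_def field_simps)
  let ?k = "real k"
  have prod: "cos (r * \<theta>) - cos (r * \<eta>) = - 2 * (sin (r * a) * sin (r * b))" for r
    unfolding ab distrib_left right_diff_distrib cos_add cos_diff by simp
  have "(cos ((?k - 1) * \<theta>) - cos ((?k + 1) * \<theta>)) - (cos ((?k - 1) * \<eta>) - cos ((?k + 1) * \<eta>))
      = 2 * (sin ((?k + 1) * a) * sin ((?k + 1) * b)) - 2 * (sin ((?k - 1) * a) * sin ((?k - 1) * b))"
    using prod[of "?k - 1"] prod[of "?k + 1"] by linarith
  \<comment> \<open>In each summand only one of the two sines has a multiple angle, so comparison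
    with \<open>sin a * sin b\<close> costs a single factor \<open>k\<close>. Finally \<open>2 *
    \<bar>sin a * sin b\<bar> = \<bar>cos \<theta> - cos \<eta>\<bar>\<close>.\<close>
  also have "\<dots> = 4 * (sin (?k * a) * cos a * (cos (?k * b) * sin b)
      + cos (?k * a) * sin a * (sin (?k * b) * cos b))"
    unfolding left_diff_distrib distrib_right sin_add sin_diff mult_1 by algebra
  finally have "\<bar>(cos ((?k - 1) * \<theta>) - cos ((?k + 1) * \<theta>)) - (cos ((?k - 1) * \<eta>) - cos ((?k + 1) * \<eta>))\<bar>
      = 4 * \<bar>sin (?k * a) * cos a * (cos (?k * b) * sin b)
      + cos (?k * a) * sin a * (sin (?k * b) * cos b)\<bar>"
    by (simp only: abs_mult)
  also have "\<dots> \<le> 4 * ((?k * \<bar>sin a\<bar>) * 1 * (1 * \<bar>sin b\<bar>) + 1 * \<bar>sin a\<bar> * ((?k * \<bar>sin b\<bar>) * 1))"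
  proof (intro mult_left_mono order_trans[OF abs_triangle_ineq add_mono])
    show "\<bar>sin (?k * a) * cos a * (cos (?k * b) * sin b)\<bar> \<le> ?k * \<bar>sin a\<bar> * 1 * (1 * \<bar>sin b\<bar>)"
      unfolding abs_mult by (intro mult_mono abs_sin_multiple_le) auto
    show "\<bar>cos (?k * a) * sin a * (sin (?k * b) * cos b)\<bar> \<le> 1 * \<bar>sin a\<bar> * (?k * \<bar>sin b\<bar> * 1)"
      unfolding abs_mult by (intro mult_mono abs_sin_multiple_le) auto
  qed simp
  also have "\<dots> = 4 * ?k * \<bar>cos \<theta> - cos \<eta>\<bar>"
    using prod[of 1] by (simp add: abs_mult)
  finally show ?thesis .
qed

lemma wave_lipschitz: "\<bar>wave k x - wave k y\<bar> \<le> 4 * real k * \<bar>x - y\<bar>"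
proof -
  have "\<bar>wave k x - wave k y\<bar> \<le> 4 * real k * \<bar>cos (clipped_arccos x) - cos (clipped_arccos y)\<bar>"
    using wave_angle_lipschitz[of k "clipped_arccos x" "clipped_arccos y"] by (simp add: wave_def)
  also have "\<dots> \<le> 4 * real k * \<bar>x - y\<bar>"
    by (intro mult_left_mono) (auto simp: clipped_arccos_def cos_arccos)
  finally show ?thesis .
qed

text \<open>The Lipschitz constant \<open>4 * k\<close> at \<open>k = 4 * 2 ^ j\<close> is
  \<open>16 * 2 ^ j\<close>; the trivial bound 4 is absorbed into the same 16.\<close>

lemma wave_diff_le: "\<bar>wave (4 * 2 ^ j) x - wave (4 * 2 ^ j) y\<bar> \<le> 16 * min 1 (2 ^ j * \<bar>x - y\<bar>)"
proof -
  have "\<bar>wave (4 * 2 ^ j) x - wave (4 * 2 ^ j) y\<bar> \<le> 2 + 2"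
    by (rule order_trans[OF abs_triangle_ineq4 add_mono[OF abs_wave_le abs_wave_le]])
  then show ?thesis
    using wave_lipschitz[of "4 * 2 ^ j" x y] by simp
qed

lemma lacunary_summable:
  assumes "\<And>j. 0 \<le> c j" "summable c"
  shows "summable (\<lambda>j. c j * wave (4 * 2 ^ j) x)"
proof (rule summable_comparison_test)
  show "\<exists>N. \<forall>n\<ge>N. norm (c n * wave (4 * 2 ^ n) x) \<le> c n * 2"
    using assms(1) abs_wave_le by (auto simp: abs_mult intro!: mult_left_mono)
  show "summable (\<lambda>n. c n * 2)" by (intro summable_mult2 assms)
qed

lemma bounded_symbol_lacunary:
  assumes c: "\<And>j. 0 \<le> c j" "summable c"
  shows "bounded_symbol (2 * suminf c) (lacunary c)"
proof -
  have "lacunary c \<in> borel_measurable borel"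
    unfolding lacunary_def
    by (intro borel_measurable_suminf borel_measurable_times borel_measurable_const wave_measurable)
  moreover have "\<bar>lacunary c x\<bar> \<le> 2 * suminf c" for x
  proof -
    have *: "norm (c j * wave (4 * 2 ^ j) x) \<le> 2 * c j" for j
      using mult_left_mono[OF abs_wave_le[of "4 * 2 ^ j" x] c(1)[of j]] c(1)[of j]
      by (simp add: abs_mult mult.commute)
    have "norm (\<Sum>j. c j * wave (4 * 2 ^ j) x) \<le> (\<Sum>j. 2 * c j)"
      by (rule norm_suminf_le[OF *]) (intro summable_mult c)
    then show ?thesis by (simp add: lacunary_def suminf_mult c)
  qed
  ultimately show ?thesis by (simp add: bounded_symbol_def)
qed

lemma lacunary_diff_le:
  assumes c: "\<And>j. 0 \<le> c j" "summable c"
  shows "\<bar>lacunary c x - lacunary c y\<bar> \<le> 16 * (\<Sum>j. c j * min 1 (2 ^ j * \<bar>x - y\<bar>))"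
proof -
  have summ: "summable (\<lambda>j. c j * min 1 (2 ^ j * \<bar>x - y\<bar>))"
  proof (rule summable_comparison_test[OF _ c(2)])
    show "\<exists>N. \<forall>n\<ge>N. norm (c n * min 1 (2 ^ n * \<bar>x - y\<bar>)) \<le> c n"
      using c(1) by (auto simp: abs_mult intro!: mult_left_le)
  qed
  have *: "norm (c j * wave (4 * 2 ^ j) x - c j * wave (4 * 2 ^ j) y)
      \<le> 16 * (c j * min 1 (2 ^ j * \<bar>x - y\<bar>))" for j
    using mult_left_mono[OF wave_diff_le[of j x y] c(1)[of j]] c(1)[of j]
    by (simp add: abs_mult mult.left_commute flip: right_diff_distrib)
  have "lacunary c x - lacunary c y
      = (\<Sum>j. c j * wave (4 * 2 ^ j) x - c j * wave (4 * 2 ^ j) y)"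
    unfolding lacunary_def by (intro suminf_diff lacunary_summable c)
  also have "norm \<dots> \<le> (\<Sum>j. 16 * (c j * min 1 (2 ^ j * \<bar>x - y\<bar>)))"
    by (rule norm_suminf_le[OF *]) (intro summable_mult summ)
  also have "\<dots> = 16 * (\<Sum>j. c j * min 1 (2 ^ j * \<bar>x - y\<bar>))"
    by (rule suminf_mult[OF summ])
  finally show ?thesis by simp
qed

text \<open>Restricted to rows divisible by 4 and columns congruent to 2 modulo 4, the Hankel matrix sees
  only one of the frequencies \<open>k - 2, k - 1, k, k + 1\<close> produced by each wave.\<close>

lemma lacunary_hankel_entry:
  assumes c: "\<And>j. 0 \<le> c j" "summable c"
  shows "neumann.entry (lacunary c) (4 * s) (4 * t + 2) - dirichlet.entry (lacunary c) (4 * s) (4 * t + 2)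
     = (\<Sum>j. if 2 ^ j = s + t + 1 then c j / 2 else 0)"
proof -
  \<comment> \<open>Row \<open>4 * s\<close> and column \<open>4 * t + 2\<close> lead to the Hankel
    frequencies \<open>m + n + 1 = l\<close> and \<open>m + n + 2 = l + 1\<close>.\<close>
  define l where "l = 4 * (int s + int t) + 3"
  let ?w = "\<lambda>\<theta>. cos (real_of_int l * \<theta>) + cos (real_of_int (l + 1) * \<theta>)"
  let ?f = "\<lambda>j \<theta>. c j * (cos (real_of_int (4 * 2 ^ j - 1) * \<theta>) - cos (real_of_int (4 * 2 ^ j + 1) * \<theta>)) * ?w \<theta>"
  have bb: "bounded_borel (?f j)" for j
    by (intro bounded_borel_mult bounded_borel_add bounded_borel_diff bounded_borel_const
        bounded_borel_cos_mult)
  \<comment> \<open>Domination by the summable \<open>4 * c j\<close> justifies exchanging series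
    and integral.\<close>
  have le: "\<bar>?f j \<theta>\<bar> \<le> 4 * c j" for j \<theta>
  proof -
    have "\<bar>?f j \<theta>\<bar> \<le> (c j * (1 + 1)) * (1 + 1)"
      unfolding abs_mult using c(1)[of j]
      by (intro mult_mono order_trans[OF abs_triangle_ineq add_mono]
          order_trans[OF abs_triangle_ineq4 add_mono]) auto
    then show ?thesis by simp
  qed
  have sint: "(LINT \<theta>|angle. (\<Sum>j. ?f j \<theta>)) = (\<Sum>j. LINT \<theta>|angle. ?f j \<theta>)"
  proof (rule integral_suminf)
    show "integrable angle (?f j)" for j by (rule bounded_borel_integrable[OF bb])
    show "AE \<theta> in angle. summable (\<lambda>j. norm (?f j \<theta>))"
      using le c by (intro AE_I2 summable_comparison_test[OF _ summable_mult[OF c(2), of 4]]) auto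
    have "(LINT \<theta>|angle. norm (?f j \<theta>)) \<le> (LINT \<theta>|angle. 4 * c j)" for j
      using le by (intro integral_mono integrable_norm bounded_borel_integrable[OF bb]) auto
    then have "norm (LINT \<theta>|angle. norm (?f j \<theta>)) \<le> 4 * measure angle (space angle) * c j" for j
      by (simp add: ac_simps)
    then show "summable (\<lambda>j. LINT \<theta>|angle. norm (?f j \<theta>))"
      by (intro summable_comparison_test[OF _ summable_mult[OF c(2)]]) blast
  qed
  have eachterm: "(LINT \<theta>|angle. ?f j \<theta>) = pi * (if 2 ^ j = s + t + 1 then c j / 2 else 0)" for j
  proof -
    let ?C = "\<lambda>a b. LINT \<theta>|angle. cos (real_of_int a * \<theta>) * cos (real_of_int b * \<theta>)"
    have ib: "integrable angle (\<lambda>\<theta>. cos (real_of_int a * \<theta>) * cos (real_of_int b * \<theta>))" for a b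
      by (intro bounded_borel_integrable bounded_borel_mult bounded_borel_cos_mult)
    define K where "K = 4 * (2 :: int) ^ j"
    have "(LINT \<theta>|angle. ?f j \<theta>) = (LINT \<theta>|angle. c j *
        ((cos (real_of_int (K - 1) * \<theta>) * cos (real_of_int l * \<theta>)
        + cos (real_of_int (K - 1) * \<theta>) * cos (real_of_int (l + 1) * \<theta>))
        - (cos (real_of_int (K + 1) * \<theta>) * cos (real_of_int l * \<theta>)
        + cos (real_of_int (K + 1) * \<theta>) * cos (real_of_int (l + 1) * \<theta>))))"
      unfolding K_def[symmetric]
      by (intro Bochner_Integration.integral_cong refl) algebra
    also have "\<dots> = c j * ((?C (K - 1) l + ?C (K - 1) (l + 1)) - (?C (K + 1) l + ?C (K + 1) (l + 1)))"
      by (simp only: integral_mult_right_zero Bochner_Integration.integral_diff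
          Bochner_Integration.integral_add ib Bochner_Integration.integrable_add)
    also have "\<dots> = c j * (if K - 1 = l then pi / 2 else 0)"
    proof -
      have "0 < l" "0 < K" by (simp_all add: l_def K_def)
      \<comment> \<open>Modulo 4, \<open>K\<close> is 0 and \<open>l\<close> is 3. Of the four
        possible coincidences of \<open>K - 1\<close> or \<open>K + 1\<close> with \<open>l\<close>
        or \<open>l + 1\<close>, only \<open>K - 1 = l\<close> survives; positivity rules out
        frequencies adding up to 0.\<close>
      moreover have "K \<noteq> l + 2" "K + 1 \<noteq> l"  "K \<noteq> l"
        unfolding l_def K_def by presburger+
      ultimately show ?thesis
        unfolding integral_cos_cos by auto
    qed
    also have "K - 1 = l \<longleftrightarrow> 2 ^ j = s + t + 1"
    proof -
      have "K - 1 = l \<longleftrightarrow> (2 :: int) ^ j = int s + int t + 1" by (auto simp: K_def l_def)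
      also have "\<dots> \<longleftrightarrow> int (2 ^ j) = int (s + t + 1)" by (simp add: ac_simps)
      finally show ?thesis unfolding of_nat_eq_iff .
    qed
    finally show ?thesis by simp
  qed
  have "neumann.entry (lacunary c) (4 * s) (4 * t + 2) - dirichlet.entry (lacunary c) (4 * s) (4 * t + 2)
     = (LINT \<theta>|angle. lacunary c (cos \<theta>) * ?w \<theta>) / pi"
  proof -
    have "int (4 * s) + int (4 * t + 2) + 1 = l" "int (4 * s) + int (4 * t + 2) + 2 = l + 1"
      by (simp_all add: l_def)
    then show ?thesis
      unfolding entry_neumann_minus_dirichlet[OF bounded_symbol_lacunary[OF c]] by (simp only:)
  qed
  also have "(LINT \<theta>|angle. lacunary c (cos \<theta>) * ?w \<theta>) = (LINT \<theta>|angle. (\<Sum>j. ?f j \<theta>))"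
  proof (intro Bochner_Integration.integral_cong refl)
    fix \<theta> assume "\<theta> \<in> space angle"
    then have "clipped_arccos (cos \<theta>) = \<theta>"
      by (intro clipped_arccos_cos) (simp add: space_angle)
    then have "wave (4 * 2 ^ j) (cos \<theta>)
        = cos (real_of_int (4 * 2 ^ j - 1) * \<theta>) - cos (real_of_int (4 * 2 ^ j + 1) * \<theta>)" for j
      by (simp add: wave_def)
    then show "lacunary c (cos \<theta>) * ?w \<theta> = (\<Sum>j. ?f j \<theta>)"
      unfolding lacunary_def using suminf_mult2[OF lacunary_summable[OF c], of "cos \<theta>" "?w \<theta>"]
      by (simp only:)
  qed
  also have "\<dots> / pi = (\<Sum>j. if 2 ^ j = s + t + 1 then c j / 2 else 0)"
  proof -
    have "summable (\<lambda>j. if 2 ^ j = s + t + 1 then c j / 2 else 0)"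
      by (rule summable_comparison_test[OF _ c(2)]) (use c(1) in auto)
    then show ?thesis
      unfolding sint eachterm by (simp add: suminf_mult)
  qed
  finally show ?thesis .
qed

text \<open>With the rows in reverse order the index sum is \<open>2 * 2 ^ i + t - s\<close>,
  strictly between \<open>2 ^ i\<close> and \<open>2 ^ (i + 2)\<close>. The only power of two in
  this window is \<open>2 ^ Suc i\<close>, attained exactly for \<open>s = t\<close>. The chosen
  block of size \<open>2 ^ i\<close> is thus \<open>c (Suc i) / 2\<close> times the
  identity.\<close>

lemma singular_value_lacunary:
  assumes c: "\<And>j. 0 \<le> c j" "summable c" and m: "m < 2 ^ i"
  shows "c (Suc i) / 2 \<le> singular_value m
    (\<lambda>x. neumann.op (lacunary c) x - dirichlet.op (lacunary c) x)"
proof (rule singular_value_ge)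
  let ?M = "2 ^ i :: nat"
  note b = bounded_symbol_lacunary[OF c]
  show "bounded_clinear (\<lambda>x. neumann.op (lacunary c) x - dirichlet.op (lacunary c) x)"
    by (intro bounded_clinear_diff[OF neumann.bounded_clinear_op[OF b] dirichlet.bounded_clinear_op[OF b]])
  show "inj_on (\<lambda>t. 4 * (?M + t) + 2) {..<?M}" "inj_on (\<lambda>s. 4 * (?M - 1 - s)) {..<?M}"
    by (auto simp: inj_on_def)
  show "Rep_ell2 (neumann.op (lacunary c) (ket (4 * (?M + t) + 2))
        - dirichlet.op (lacunary c) (ket (4 * (?M + t) + 2))) (4 * (?M - 1 - s))
      = (if s = t then complex_of_real (c (Suc i) / 2) else 0)"
    if s: "s < ?M" and t: "t < ?M" for s t
  proof -
    have "2 ^ j = (?M - 1 - s) + (?M + t) + 1 \<longleftrightarrow> s = t \<and> j = Suc i" for j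
    proof
      assume *: "2 ^ j = (?M - 1 - s) + (?M + t) + 1"
      then have "(2 :: nat) ^ i < 2 ^ j" "(2 :: nat) ^ j < 2 ^ Suc (Suc i)"
        using s t by auto
      then have "i < j" "j < Suc (Suc i)"
        by (auto intro: power_less_imp_less_exp[of "2 :: nat"] simp del: power_Suc)
      then have "j = Suc i" by simp
      with * s t show "s = t \<and> j = Suc i" by auto
    qed (use s t in auto)
    then have "(\<Sum>j. if 2 ^ j = (?M - 1 - s) + (?M + t) + 1 then c j / 2 else 0)
        = (\<Sum>j. if s = t \<and> j = Suc i then c j / 2 else 0)"
      by simp
    also have "\<dots> = (if s = t then c (Suc i) / 2 else 0)"
      using suminf_finite[of "{Suc i}" "\<lambda>j. if s = t \<and> j = Suc i then c j / 2 else 0"] by auto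
    finally have "neumann.entry (lacunary c) (4 * (?M - 1 - s)) (4 * (?M + t) + 2)
        - dirichlet.entry (lacunary c) (4 * (?M - 1 - s)) (4 * (?M + t) + 2)
        = (if s = t then c (Suc i) / 2 else 0)"
      unfolding lacunary_hankel_entry[OF c] .
    then show ?thesis
      unfolding neumann.op_def dirichlet.op_def Rep_ell2_diff
        Rep_mat_op_ket[OF neumann.bounded_matrix_entry[OF b]]
        Rep_mat_op_ket[OF dirichlet.bounded_matrix_entry[OF b]] of_real_diff[symmetric]
      by simp
  qed
qed (use c(1)[of "Suc i"] m in auto)


section \<open>The dyadic minorant of the transform\<close>

lemma modulus_of_continuityD:
  assumes "modulus_of_continuity \<omega>"
  shows "0 \<le> x \<Longrightarrow> 0 \<le> \<omega> x" "0 \<le> x \<Longrightarrow> x \<le> y \<Longrightarrow> \<omega> x \<le> \<omega> y"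
    "0 \<le> x \<Longrightarrow> 0 \<le> y \<Longrightarrow> \<omega> (x + y) \<le> \<omega> x + \<omega> y" "continuous_on {0..} \<omega>"
proof -
  show "0 \<le> \<omega> x" if "0 \<le> x"
    using assms that unfolding modulus_of_continuity_def
    by (cases "x = 0") (auto intro: less_imp_le)
qed (use assms in \<open>auto simp: modulus_of_continuity_def mono_on_def\<close>)

lemma omega_sharp_eq_nn_integral:
  assumes \<omega>: "modulus_of_continuity \<omega>" and d: "0 < d"
  shows "omega_sharp \<omega> d = (\<integral>\<^sup>+t. ennreal d * (ennreal (\<omega> t / t\<^sup>2) * indicator {d..} t)
    + ennreal (\<omega> t / t) * indicator {0<..d} t \<partial>lborel)"
proof -
  \<comment> \<open>\<open>\<omega>\<close> is arbitrary at negative arguments; freezing it there at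
    its value at 0 gives a Borel function that agrees with it where the integrands live.\<close>
  define W where "W t = \<omega> (max 0 t)" for t
  have "continuous_on UNIV W"
    unfolding W_def
    by (rule continuous_on_compose2[OF modulus_of_continuityD(4)[OF \<omega>]])
      (auto intro!: continuous_intros)
  then have W[measurable]: "W \<in> borel_measurable borel"
    by (rule borel_measurable_continuous_onI)
  have 1: "ennreal (\<omega> t / t\<^sup>2) * indicator {d..} t = ennreal (W t / t\<^sup>2) * indicator {d..} t" for t
    using d by (auto simp: W_def indicator_def)
  have 2: "ennreal (\<omega> t / t) * indicator {0<..d} t = ennreal (W t / t) * indicator {0<..d} t" for t
    by (auto simp: W_def indicator_def)
  show ?thesis
    unfolding omega_sharp_def 1 2
    by (subst nn_integral_add) (auto simp: nn_integral_cmult)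
qed

text \<open>For \<open>t\<close> between \<open>p = 2^-j\<close> and \<open>2 * p\<close>,
  monotonicity bounds the integrand below: by \<open>\<omega> p / (2 * p)\<close> if
  \<open>t \<le> d\<close>, by \<open>d * \<omega> p / (2 * p)\<^sup>2\<close> otherwise. Either is
  at least the \<open>j\<close>-th term divided by \<open>4 * p\<close>. The intervals are disjoint
  and of length \<open>p\<close>, whence the factor 4.\<close>

lemma dyadic_sum_le_omega_sharp:
  assumes \<omega>: "modulus_of_continuity \<omega>" and d: "0 < d"
  shows "(\<Sum>j. ennreal (\<omega> ((1/2) ^ j) * min 1 (2 ^ j * d))) \<le> 4 * omega_sharp \<omega> d"
proof -
  define p :: "nat \<Rightarrow> real" where "p j = (1/2) ^ j" for j
  have p: "0 < p j" "2 ^ j = 1 / p j" for j by (simp_all add: p_def power_one_over field_simps)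
  define a where "a j = \<omega> (p j) * min 1 (2 ^ j * d)" for j
  have a: "0 \<le> a j" for j
    using modulus_of_continuityD(1)[OF \<omega>, of "p j"] p(1)[of j] d by (simp add: a_def)
  let ?J = "\<lambda>j. {p j<..2 * p j}"
  let ?F = "\<lambda>t. ennreal d * (ennreal (\<omega> t / t\<^sup>2) * indicator {d..} t)
      + ennreal (\<omega> t / t) * indicator {0<..d} t"
  have term_le: "ennreal (a j / (4 * p j)) \<le> ?F t" if t: "t \<in> ?J j" for j t
  proof (cases "t \<le> d")
    case True
    have t0: "0 < t" using t p(1)[of j] by simp
    have "a j / (4 * p j) \<le> \<omega> (p j) * 1 / (2 * p j)"
      unfolding a_def using p(1)[of j] modulus_of_continuityD(1)[OF \<omega>, of "p j"]
      by (intro frac_le mult_left_mono) auto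
    also have "\<dots> \<le> \<omega> t / t"
      using t t0 p(1)[of j] modulus_of_continuityD(2)[OF \<omega>, of "p j" t]
        modulus_of_continuityD(1)[OF \<omega>, of t]
      by (intro frac_le) auto
    finally show ?thesis using True t0 by (auto intro!: ennreal_leI add_increasing)
  next
    case False
    have t0: "0 < t" using t p(1)[of j] by simp
    have "a j / (4 * p j) \<le> \<omega> (p j) * (2 ^ j * d) / (4 * p j)"
      unfolding a_def using p(1)[of j] modulus_of_continuityD(1)[OF \<omega>, of "p j"]
      by (intro divide_right_mono mult_left_mono) auto
    also have "\<dots> = d * (\<omega> (p j) / (2 * p j)\<^sup>2)"
      unfolding p(2) by (simp add: power2_eq_square field_simps)
    also have "\<dots> \<le> d * (\<omega> t / t\<^sup>2)"
      using t t0 d p(1)[of j] modulus_of_continuityD(2)[OF \<omega>, of "p j" t]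
        modulus_of_continuityD(1)[OF \<omega>, of t]
      by (intro mult_left_mono frac_le power_mono) auto
    finally have "ennreal (a j / (4 * p j)) \<le> ennreal (d * (\<omega> t / t\<^sup>2))" by (rule ennreal_leI)
    also have "\<dots> = ennreal d * ennreal (\<omega> t / t\<^sup>2)"
      using d by (intro ennreal_mult') simp
    finally show ?thesis using False by simp
  qed
  have "(\<Sum>j. ennreal (a j)) = (\<Sum>j. 4 * (ennreal (a j / (4 * p j)) * emeasure lborel (?J j)))"
  proof (rule suminf_cong)
    show "ennreal (a j) = 4 * (ennreal (a j / (4 * p j)) * emeasure lborel (?J j))" for j
    proof -
      have "4 * (ennreal (a j / (4 * p j)) * emeasure lborel (?J j))
          = ennreal 4 * (ennreal (a j / (4 * p j)) * ennreal (p j))"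
        using p(1)[of j] by simp
      also have "ennreal (a j / (4 * p j)) * ennreal (p j) = ennreal (a j / (4 * p j) * p j)"
        using a[of j] p(1)[of j] by (intro ennreal_mult[symmetric]) auto
      also have "a j / (4 * p j) * p j = a j / 4"
        using p(1)[of j] by simp
      also have "ennreal 4 * ennreal (a j / 4) = ennreal (4 * (a j / 4))"
        using a[of j] by (intro ennreal_mult[symmetric]) auto
      finally show ?thesis by simp
    qed
  qed
  also have "\<dots> = 4 * (\<Sum>j. ennreal (a j / (4 * p j)) * emeasure lborel (?J j))"
    by (rule ennreal_suminf_cmult)
  also have "(\<Sum>j. ennreal (a j / (4 * p j)) * emeasure lborel (?J j))
      = (\<integral>\<^sup>+t. (\<Sum>j. ennreal (a j / (4 * p j)) * indicator (?J j) t) \<partial>lborel)"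
    by (subst nn_integral_suminf) (auto simp: nn_integral_cmult_indicator)
  also have "\<dots> \<le> (\<integral>\<^sup>+t. ?F t \<partial>lborel)"
  proof (rule nn_integral_mono)
    fix t :: real
    show "(\<Sum>j. ennreal (a j / (4 * p j)) * indicator (?J j) t) \<le> ?F t"
    proof (cases "\<exists>j. t \<in> ?J j")
      case True
      then obtain j where j: "t \<in> ?J j" by blast
      have disj: "t \<notin> ?J k" if "k \<noteq> j" for k
      proof -
        \<comment> \<open>The right end of a later interval is at most the left end of an earlier
          one, so a point meets a single summand.\<close>
        have less: "2 * p n \<le> p m" if "m < n" for m n
        proof -
          have "p n \<le> p (Suc m)"
            using that unfolding p_def by (intro power_decreasing) auto
          then show ?thesis by (simp add: p_def)
        qed
        show ?thesis
          using less[of j k] less[of k j] that j by (cases "j < k") auto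
      qed
      have "(\<Sum>k. ennreal (a k / (4 * p k)) * indicator (?J k) t)
          = (\<Sum>k\<in>{j}. ennreal (a k / (4 * p k)) * indicator (?J k) t)"
        using disj by (intro suminf_finite) auto
      also have "\<dots> = ennreal (a j / (4 * p j)) * indicator (?J j) t"
        by (simp only: sum.insert finite.emptyI empty_iff not_False_eq_True sum.empty add_0_right)
      finally show ?thesis using term_le[OF j] j by simp
    next
      case False
      then show ?thesis by simp
    qed
  qed
  also have "\<dots> = omega_sharp \<omega> d"
    by (rule omega_sharp_eq_nn_integral[OF \<omega> d, symmetric])
  finally show ?thesis
    unfolding a_def p_def by (simp add: mult_left_mono)
qed

text \<open>At \<open>d = 1\<close> every minimum equals 1, so one finite value of the transform
  bounds the whole series.\<close>

lemma dyadic_modulus_summable: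
  assumes \<omega>: "modulus_of_continuity \<omega>" and fin: "omega_sharp \<omega> 1 < \<infinity>"
  shows "summable (\<lambda>j. \<omega> ((1/2) ^ j))"
proof (rule summable_suminf_not_top)
  show "0 \<le> \<omega> ((1/2) ^ j)" for j
    by (rule modulus_of_continuityD(1)[OF \<omega>]) simp
  have "(\<Sum>j. ennreal (\<omega> ((1/2) ^ j))) \<le> 4 * omega_sharp \<omega> 1"
    using dyadic_sum_le_omega_sharp[OF \<omega>, of 1] by (simp add: min_absorb1)
  also have "\<dots> < top" using fin by (simp add: ennreal_mult_less_top)
  finally show "(\<Sum>j. ennreal (\<omega> ((1/2) ^ j))) \<noteq> top" by simp
qed

lemma lacunary_in_Lambda_space:
  assumes \<omega>: "modulus_of_continuity \<omega>" and fin: "\<forall>x>0. omega_sharp \<omega> x < \<infinity>"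
    and K: "0 \<le> K"
  shows "(\<lambda>x. complex_of_real (lacunary (\<lambda>j. K * \<omega> ((1/2) ^ j)) x)) \<in> Lambda_space (omega_sharp \<omega>)"
proof -
  let ?c = "\<lambda>j. K * \<omega> ((1/2) ^ j)"
  have c: "\<And>j. 0 \<le> ?c j" "summable ?c"
    using K modulus_of_continuityD(1)[OF \<omega>] dyadic_modulus_summable[OF \<omega>] fin
    by (auto intro!: summable_mult)
  \<comment> \<open>The constant is 16 from the waves times 4 from the dyadic comparison.\<close>
  have "ennreal (cmod (complex_of_real (lacunary ?c x) - complex_of_real (lacunary ?c y)))
      / omega_sharp \<omega> \<bar>x - y\<bar> \<le> ennreal (64 * K)" if "x \<noteq> y" for x y
  proof -
    define d where "d = \<bar>x - y\<bar>"
    have d: "0 < d" using that by (simp add: d_def)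
    let ?a = "\<lambda>j. \<omega> ((1/2) ^ j) * min 1 (2 ^ j * d)"
    have a: "0 \<le> ?a j" for j
      using modulus_of_continuityD(1)[OF \<omega>, of "(1/2) ^ j"] d by simp
    have sa: "summable ?a"
      using modulus_of_continuityD(1)[OF \<omega>] d fin
      by (intro summable_comparison_test[OF _ dyadic_modulus_summable[OF \<omega>]])
        (auto simp: abs_mult intro!: mult_left_le)
    have "cmod (complex_of_real (lacunary ?c x) - complex_of_real (lacunary ?c y))
        = \<bar>lacunary ?c x - lacunary ?c y\<bar>"
      by (simp flip: of_real_diff)
    also have "\<dots> \<le> 16 * K * (\<Sum>j. ?a j)"
      using lacunary_diff_le[OF c, of x y] suminf_mult[OF sa, of K] by (simp add: d_def mult.assoc)
    finally have "ennreal (cmod (complex_of_real (lacunary ?c x) - complex_of_real (lacunary ?c y)))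
        \<le> ennreal (16 * K * (\<Sum>j. ?a j))" by (rule ennreal_leI)
    also have "\<dots> = ennreal (16 * K) * ennreal (\<Sum>j. ?a j)"
      using K suminf_nonneg[OF sa a] by (intro ennreal_mult) auto
    also have "ennreal (\<Sum>j. ?a j) = (\<Sum>j. ennreal (?a j))"
      by (rule suminf_ennreal2[symmetric, OF a sa])
    also have "ennreal (16 * K) * \<dots> \<le> ennreal (16 * K) * (4 * omega_sharp \<omega> d)"
      by (intro mult_left_mono dyadic_sum_le_omega_sharp[OF \<omega> d]) simp
    also have "\<dots> = ennreal (64 * K) * omega_sharp \<omega> d"
    proof -
      have "ennreal (16 * K) * 4 = ennreal (64 * K)"
        using K by (simp flip: ennreal_mult' ennreal_numeral)
      then show ?thesis by (simp add: mult.assoc[symmetric])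
    qed
    finally have "ennreal (cmod (complex_of_real (lacunary ?c x) - complex_of_real (lacunary ?c y)))
        \<le> omega_sharp \<omega> d * ennreal (64 * K)" by (simp add: mult.commute)
    then show ?thesis
      unfolding d_def[symmetric]
      \<comment> \<open>Should the transform vanish, the numerator vanishes as well, and
        \<open>0 / 0 = 0\<close> in \<open>ennreal\<close>.\<close>
      by (cases "omega_sharp \<omega> d = 0") (auto intro: divide_le_posI_ennreal simp: zero_less_iff_neq_zero)
  qed
  then have "(SUP (x, y)\<in>{(x, y). x \<noteq> y}.
      ennreal (cmod (complex_of_real (lacunary ?c x) - complex_of_real (lacunary ?c y)))
        / omega_sharp \<omega> \<bar>x - y\<bar>) \<le> ennreal (64 * K)"
    by (intro SUP_least) auto
  also have "\<dots> < \<infinity>" by simp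
  finally show ?thesis unfolding Lambda_space_def by simp
qed

section \<open>Choice of the amplitudes and assembly of the operators\<close>

theorem theorem3p8:
  fixes \<omega> :: "real \<Rightarrow> real"
  assumes "modulus_of_continuity \<omega>"
    and "\<forall>x>0. omega_sharp \<omega> x < \<infinity>"
  shows "\<exists>(A :: ell2 unbounded_op) B f. self_adjoint A \<and> self_adjoint B \<and>
           f \<in> Lambda_space (omega_sharp \<omega>) \<and> (\<forall>x. f x \<in> \<real>) \<and>
           (\<exists>K. has_bounded_difference A B K \<and> op_rank K = 1) \<and>
           (\<exists>fA fB T. is_functional_calculus f A fA \<and> is_functional_calculus f B fB \<and>
              has_bounded_difference fA fB T \<and>
              (\<forall>m. singular_value m T \<ge> \<omega> (inverse (1 + real m))))"
proof -
  \<comment> \<open>A block entry is half an amplitude, and replacing an argument of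
    \<open>\<omega>\<close> by its quarter costs a factor 4; 8 compensates for both.\<close>
  let ?c = "\<lambda>j. 8 * \<omega> ((1/2) ^ j)"
  let ?g = "lacunary ?c"
  have c: "\<And>j. 0 \<le> ?c j" "summable ?c"
    using modulus_of_continuityD(1)[OF assms(1)] dyadic_modulus_summable[OF assms(1)] assms(2)
    by (auto intro!: summable_mult)
  note b = bounded_symbol_lacunary[OF c]
  have dom: "dom (\<lambda>x. Some (T x)) = UNIV" for T :: "ell2 \<Rightarrow> ell2" by auto
  have diff: "has_bounded_difference (\<lambda>x. Some (neumann.op g x)) (\<lambda>x. Some (dirichlet.op g x))
      (\<lambda>x. neumann.op g x - dirichlet.op g x)" if "bounded_symbol C g" for C g
    unfolding has_bounded_difference_def dom
    using bounded_clinear_diff[OF neumann.bounded_clinear_op[OF that]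
        dirichlet.bounded_clinear_op[OF that]] by simp
  have sv: "\<omega> (inverse (1 + real m)) \<le> singular_value m (\<lambda>x. neumann.op ?g x - dirichlet.op ?g x)" for m
  proof -
    \<comment> \<open>Since \<open>m < 2 ^ Suc n\<close>, the block with \<open>i = Suc n\<close> is
      large enough, and its amplitude involves \<open>\<omega>\<close> at \<open>2^-(n + 2)\<close>.
      As \<open>1 / (1 + m)\<close> is at most \<open>2^-n\<close>, its quarter \<open>?x\<close> is
      at most that argument.\<close>
    obtain n where n: "2 ^ n \<le> Suc m" "Suc m < 2 ^ (n + 1)"
      using ex_power_ivl1[of 2 "Suc m"] by auto
    let ?x = "inverse (4 * (1 + real m))"
    have double: "\<omega> (2 * x) \<le> 2 * \<omega> x" if "0 \<le> x" for x
      using modulus_of_continuityD(3)[OF assms(1) that that] by simp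
    have "inverse (1 + real m) = 2 * (2 * ?x)" by (simp add: field_simps)
    then have "\<omega> (inverse (1 + real m)) \<le> 4 * \<omega> ?x"
      using double[of ?x] double[of "2 * ?x"] by simp
    also have "\<dots> \<le> 4 * \<omega> ((1/2) ^ Suc (Suc n))"
    proof -
      have "(2 :: real) ^ n \<le> 1 + real m"
        using n(1) by (metis of_nat_Suc of_nat_le_iff of_nat_numeral of_nat_power)
      then have "?x \<le> inverse (2 ^ Suc (Suc n))"
        by (intro le_imp_inverse_le) auto
      then show ?thesis
        by (intro mult_left_mono modulus_of_continuityD(2)[OF assms(1)])
          (auto simp: power_one_over inverse_eq_divide)
    qed
    also have "\<dots> \<le> singular_value m (\<lambda>x. neumann.op ?g x - dirichlet.op ?g x)"
      using singular_value_lacunary[OF c, of m "Suc n"] n(2) by simp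
    finally show ?thesis .
  qed
  show ?thesis
  proof (intro exI conjI allI)
    show "self_adjoint (\<lambda>x. Some (neumann.op (\<lambda>t. t) x))"
      by (rule neumann.self_adjoint_op[OF bounded_symbol_ident])
    show "self_adjoint (\<lambda>x. Some (dirichlet.op (\<lambda>t. t) x))"
      by (rule dirichlet.self_adjoint_op[OF bounded_symbol_ident])
    show "(\<lambda>x. complex_of_real (?g x)) \<in> Lambda_space (omega_sharp \<omega>)"
      by (rule lacunary_in_Lambda_space[OF assms]) simp
    show "complex_of_real (?g x) \<in> \<real>" for x by simp
    show "has_bounded_difference (\<lambda>x. Some (neumann.op (\<lambda>t. t) x)) (\<lambda>x. Some (dirichlet.op (\<lambda>t. t) x))
        (\<lambda>x. neumann.op (\<lambda>t. t) x - dirichlet.op (\<lambda>t. t) x)"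
      by (rule diff[OF bounded_symbol_ident])
    show "op_rank (\<lambda>x. neumann.op (\<lambda>t. t) x - dirichlet.op (\<lambda>t. t) x) = 1"
      by (rule op_rank_neumann_minus_dirichlet)
    show "is_functional_calculus (\<lambda>x. complex_of_real (?g x))
        (\<lambda>x. Some (neumann.op (\<lambda>t. t) x)) (\<lambda>x. Some (neumann.op ?g x))"
      by (rule neumann.is_functional_calculus_op[OF b])
    show "is_functional_calculus (\<lambda>x. complex_of_real (?g x))
        (\<lambda>x. Some (dirichlet.op (\<lambda>t. t) x)) (\<lambda>x. Some (dirichlet.op ?g x))"
      by (rule dirichlet.is_functional_calculus_op[OF b])
    show "has_bounded_difference (\<lambda>x. Some (neumann.op ?g x)) (\<lambda>x. Some (dirichlet.op ?g x))
        (\<lambda>x. neumann.op ?g x - dirichlet.op ?g x)"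
      by (rule diff[OF b])
    show "\<omega> (inverse (1 + real m)) \<le> singular_value m (\<lambda>x. neumann.op ?g x - dirichlet.op ?g x)" for m
      by (rule sv)
  qed
qed

end
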